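(* Let $k$ be a commutative ring and $H$ a $k$-prebialgebra. (1) If $H$ satisfies (rm) or (rc), then $\varepsilon_t:H\to H_t$ and $\varepsilon_s:H\to H_s$ are coalgebra maps. If $H$ satisfies (lm) or (lc), then $\overline{\varepsilon}_s:H\to\overline{H}_s$ and $\overline{\varepsilon}_t:H\to\overline{H}_t$ are coalgebra maps. (2) If $H$ satisfies (m), then (the restrictions of) $\overline{\varepsilon}_s:H_t\to\overline{H}_s$ and $\varepsilon_t:\overline{H}_s\to H_t$ are mutually inverse anti-algebra and coalgebra isomorphisms, and (the restrictions of) $\overline{\varepsilon}_t:H_s\to\overline{H}_t$ and $\varepsilon_s:\overline{H}_t\to H_s$ are mutually inverse anti-algebra and coalgebra isomorphisms. (3) If $H$ satisfies (c), then $\overline{H}_t=H_t$, $\overline{H}_s=H_s$, $\overline{\Delta}_t=\Delta_t^{\mathrm{cop}}$ and $\overline{\Delta}_s=\Delta_s^{\mathrm{cop}}$.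
   Context: Conventions. $k$ is a commutative ring and $\otimes=\otimes_k$. A $k$-prebialgebra is a $k$-module $H$ that is both an associative unital $k$-algebra (unit $1$) and a coassociative counital $k$-coalgebra ($\Delta$, $\varepsilon$) such that $\Delta(hk)=\Delta(h)\Delta(k)$ for all $h,k\in H$; it is not required that $\Delta(1)=1\otimes 1$ nor that $\varepsilon$ is multiplicative. Sweedler notation: $\Delta(h)=h_{(1)}\otimes h_{(2)}$, $\Delta(1)=1_{(1)}\otimes 1_{(2)}=1_{(1')}\otimes 1_{(2')}$, $\Delta^2=(\Delta\otimes H)\circ\Delta$. Axioms (for all $h,k,l\in H$): (lm) $\varepsilon(hkl)=\varepsilon(hk_{(1)})\varepsilon(k_{(2)}l)$; (rm) $\varepsilon(hkl)=\varepsilon(hk_{(2)})\varepsilon(k_{(1)}l)$; (lc) $\Delta^2(1)=1_{(1)}\otimes 1_{(2)}1_{(1')}\otimes 1_{(2')}$; (rc) $\Delta^2(1)=1_{(1)}\otimes 1_{(1')}1_{(2)}\otimes 1_{(2')}$; (m) means (lm) and (rm); (c) means (lc) and (rc). Define $\varepsilon_t(h)=\langle\varepsilon,1_{(1)}h\rangle 1_{(2)}$, $\varepsilon_s(h)=\langle\varepsilon,h1_{(2)}\rangle 1_{(1)}$, $\overline{\varepsilon}_t(h)=\langle\varepsilon,h1_{(1)}\rangle 1_{(2)}$, $\overline{\varepsilon}_s(h)=\langle\varepsilon,1_{(2)}h\rangle 1_{(1)}$, with images $H_t,H_s,\overline{H}_t,\overline{H}_s\subset H$. If (rm) or (rc)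 holds then $H_t,H_s$ are subalgebras of $H$ and are coalgebras with comultiplications $\Delta_t(z)=\varepsilon_t(1_{(1)}z)\otimes\varepsilon_t(1_{(2)})$, $\Delta_s(y)=\varepsilon_s(1_{(1)})\otimes\varepsilon_s(y1_{(2)})$; if (lm) or (lc) holds then $\overline{H}_t,\overline{H}_s$ are subalgebras of $H$ and are coalgebras with comultiplications $\overline{\Delta}_t(z)=\overline{\varepsilon}_t(z1_{(1)})\otimes\overline{\varepsilon}_t(1_{(2)})$, $\overline{\Delta}_s(y)=\overline{\varepsilon}_s(1_{(1)})\otimes\overline{\varepsilon}_s(1_{(2)}y)$; all counits are the restrictions of $\varepsilon$. $\Delta^{\mathrm{cop}}$ denotes the comultiplication followed by the flip of tensor factors. *)

theory Defs
  imports "HOL-Algebra.Module"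
begin

section \<open>Linear maps and tensor products of modules\<close>

definition linear_maps ::
  "('k, 'c) ring_scheme \<Rightarrow> ('k, 'm, 'd) module_scheme \<Rightarrow> ('k, 'n, 'e) module_scheme \<Rightarrow> ('m \<Rightarrow> 'n) set"
where
  "linear_maps R M N =
    {f \<in> carrier M \<rightarrow> carrier N.
      (\<forall>x\<in>carrier M. \<forall>y\<in>carrier M. f (x \<oplus>\<^bsub>M\<^esub> y) = f x \<oplus>\<^bsub>N\<^esub> f y) \<and>
      (\<forall>r\<in>carrier R. \<forall>x\<in>carrier M. f (r \<odot>\<^bsub>M\<^esub> x) = r \<odot>\<^bsub>N\<^esub> f x)}"

definition regular_module :: "('k, 'c) ring_scheme \<Rightarrow> ('k, 'k) module" where
  "regular_module R =
    \<lparr>carrier = carrier R, mult = mult R, one = one R, zero = zero R, add = add R, smult = mult R\<rparr>"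

text \<open>The list \<open>[(x\<^sub>1, y\<^sub>1), \<dots>, (x\<^sub>n, y\<^sub>n)]\<close> stands for the formal sum
  \<open>x\<^sub>1 \<otimes> y\<^sub>1 + \<dots> + x\<^sub>n \<otimes> y\<^sub>n\<close>. The tensor product \<open>M \<otimes>\<^sub>R N\<close> is the set of formal sums modulo the
  least congruence for concatenation that makes the sum commutative and \<open>(x, y) \<mapsto> x \<otimes> y\<close>
  additive in both arguments and \<open>R\<close>-balanced. Formal negatives and scalars are not needed, as
  \<open>- (x \<otimes> y) = (- x) \<otimes> y\<close> and \<open>r (x \<otimes> y) = (r x) \<otimes> y\<close>; the rule \<open>zero\<close> replaces the
  cancellation that a formal group would provide.\<close>

inductive_set tensor_rel ::
  "('k, 'c) ring_scheme \<Rightarrow> ('k, 'm, 'd) module_scheme \<Rightarrow> ('k, 'n, 'e) module_scheme \<Rightarrow>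
    (('m \<times> 'n) list \<times> ('m \<times> 'n) list) set"
  for R and M and N
where
  refl: "xs \<in> lists (carrier M \<times> carrier N) \<Longrightarrow> (xs, xs) \<in> tensor_rel R M N"
| sym: "(xs, ys) \<in> tensor_rel R M N \<Longrightarrow> (ys, xs) \<in> tensor_rel R M N"
| trans: "\<lbrakk>(xs, ys) \<in> tensor_rel R M N; (ys, zs) \<in> tensor_rel R M N\<rbrakk>
    \<Longrightarrow> (xs, zs) \<in> tensor_rel R M N"
| append: "\<lbrakk>(xs, xs') \<in> tensor_rel R M N; (ys, ys') \<in> tensor_rel R M N\<rbrakk>
    \<Longrightarrow> (xs @ ys, xs' @ ys') \<in> tensor_rel R M N"
| commute: "\<lbrakk>xs \<in> lists (carrier M \<times> carrier N); ys \<in> lists (carrier M \<times> carrier N)\<rbrakk>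
    \<Longrightarrow> (xs @ ys, ys @ xs) \<in> tensor_rel R M N"
| add_left: "\<lbrakk>x \<in> carrier M; x' \<in> carrier M; y \<in> carrier N\<rbrakk>
    \<Longrightarrow> ([(x \<oplus>\<^bsub>M\<^esub> x', y)], [(x, y), (x', y)]) \<in> tensor_rel R M N"
| add_right: "\<lbrakk>x \<in> carrier M; y \<in> carrier N; y' \<in> carrier N\<rbrakk>
    \<Longrightarrow> ([(x, y \<oplus>\<^bsub>N\<^esub> y')], [(x, y), (x, y')]) \<in> tensor_rel R M N"
| balanced: "\<lbrakk>r \<in> carrier R; x \<in> carrier M; y \<in> carrier N\<rbrakk>
    \<Longrightarrow> ([(r \<odot>\<^bsub>M\<^esub> x, y)], [(x, r \<odot>\<^bsub>N\<^esub> y)]) \<in> tensor_rel R M N"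
| zero: "y \<in> carrier N \<Longrightarrow> ([(\<zero>\<^bsub>M\<^esub>, y)], []) \<in> tensor_rel R M N"

definition tensor_class ::
  "('k, 'c) ring_scheme \<Rightarrow> ('k, 'm, 'd) module_scheme \<Rightarrow> ('k, 'n, 'e) module_scheme \<Rightarrow>
    ('m \<times> 'n) list \<Rightarrow> ('m \<times> 'n) list set"
where
  "tensor_class R M N xs = tensor_rel R M N `` {xs}"

definition tens ::
  "('k, 'c) ring_scheme \<Rightarrow> ('k, 'm, 'd) module_scheme \<Rightarrow> ('k, 'n, 'e) module_scheme \<Rightarrow>
    'm \<Rightarrow> 'n \<Rightarrow> ('m \<times> 'n) list set"
where
  "tens R M N x y = tensor_class R M N [(x, y)]"

text \<open>The fields \<open>mult\<close> and \<open>one\<close> are those of the tensor product algebra,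
  \<open>(a \<otimes> b) (c \<otimes> d) = a c \<otimes> b d\<close>; they are meaningful only if \<open>M\<close> and \<open>N\<close> are algebras.\<close>

definition tensor ::
  "('k, 'c) ring_scheme \<Rightarrow> ('k, 'm, 'd) module_scheme \<Rightarrow> ('k, 'n, 'e) module_scheme \<Rightarrow>
    ('k, ('m \<times> 'n) list set) module"
where
  "tensor R M N =
    \<lparr>carrier = lists (carrier M \<times> carrier N) // tensor_rel R M N,
     mult = (\<lambda>X Y. \<Union>xs\<in>X. \<Union>ys\<in>Y.
       tensor_class R M N [(a \<otimes>\<^bsub>M\<^esub> c, b \<otimes>\<^bsub>N\<^esub> d). (a, b) \<leftarrow> xs, (c, d) \<leftarrow> ys]),
     one = tensor_class R M N [(\<one>\<^bsub>M\<^esub>, \<one>\<^bsub>N\<^esub>)],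
     zero = tensor_class R M N [],
     add = (\<lambda>X Y. \<Union>xs\<in>X. \<Union>ys\<in>Y. tensor_class R M N (xs @ ys)),
     smult = (\<lambda>r X. \<Union>xs\<in>X. tensor_class R M N [(r \<odot>\<^bsub>M\<^esub> a, b). (a, b) \<leftarrow> xs])\<rparr>"

text \<open>\<open>tensor_lift P b\<close> is the map \<open>\<Sum>\<^sub>i x\<^sub>i \<otimes> y\<^sub>i \<mapsto> \<Sum>\<^sub>i b x\<^sub>i y\<^sub>i\<close> into \<open>P\<close> induced by a balanced
  biadditive \<open>b\<close>. Sweedler notation is rendered with it: an expression \<open>b h\<^sub>(\<^sub>1\<^sub>) h\<^sub>(\<^sub>2\<^sub>)\<close> with
  values in \<open>P\<close> is \<open>tensor_lift P b (\<Delta> h)\<close>.\<close>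

definition tensor_lift :: "('p, 'f) ring_scheme \<Rightarrow> ('m \<Rightarrow> 'n \<Rightarrow> 'p) \<Rightarrow> ('m \<times> 'n) list set \<Rightarrow> 'p" where
  "tensor_lift P b X = the_elem ((\<lambda>xs. foldr (\<lambda>(x, y) s. b x y \<oplus>\<^bsub>P\<^esub> s) xs \<zero>\<^bsub>P\<^esub>) ` X)"

text \<open>\<open>tensor_map R M' N' f g\<close> is \<open>f \<otimes> g\<close> with codomain \<open>M' \<otimes> N'\<close>.\<close>

definition tensor_map ::
  "('k, 'c) ring_scheme \<Rightarrow> ('k, 'm1, 'd) module_scheme \<Rightarrow> ('k, 'n1, 'e) module_scheme \<Rightarrow>
    ('m \<Rightarrow> 'm1) \<Rightarrow> ('n \<Rightarrow> 'n1) \<Rightarrow> ('m \<times> 'n) list set \<Rightarrow> ('m1 \<times> 'n1) list set"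
where
  "tensor_map R M' N' f g = tensor_lift (tensor R M' N') (\<lambda>x y. tens R M' N' (f x) (g y))"

text \<open>\<open>M \<otimes> N \<rightarrow> N \<otimes> M\<close>\<close>

definition tensor_flip ::
  "('k, 'c) ring_scheme \<Rightarrow> ('k, 'm, 'd) module_scheme \<Rightarrow> ('k, 'n, 'e) module_scheme \<Rightarrow>
    ('m \<times> 'n) list set \<Rightarrow> ('n \<times> 'm) list set"
where
  "tensor_flip R M N = tensor_lift (tensor R N M) (\<lambda>x y. tens R N M y x)"

text \<open>\<open>(L \<otimes> M) \<otimes> N \<rightarrow> L \<otimes> (M \<otimes> N)\<close>\<close>

definition tensor_assoc ::
  "('k, 'c) ring_scheme \<Rightarrow> ('k, 'l, 'd) module_scheme \<Rightarrow> ('k, 'm, 'e) module_scheme \<Rightarrow>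
    ('k, 'n, 'f) module_scheme \<Rightarrow>
    (('l \<times> 'm) list set \<times> 'n) list set \<Rightarrow> ('l \<times> ('m \<times> 'n) list set) list set"
where
  "tensor_assoc R L M N =
    (let T = tensor R L (tensor R M N)
     in tensor_lift T (\<lambda>X z. tensor_lift T (\<lambda>x y. tens R L (tensor R M N) x (tens R M N y z)) X))"


section \<open>Algebras and coalgebras\<close>

text \<open>The library locale \<^locale>\<open>algebra\<close> is restricted to commutative algebras.\<close>

locale assoc_algebra = module R A + ring A for R (structure) and A (structure) +
  assumes smult_mult_left:
      "\<lbrakk>r \<in> carrier R; x \<in> carrier A; y \<in> carrier A\<rbrakk>
        \<Longrightarrow> (r \<odot>\<^bsub>A\<^esub> x) \<otimes>\<^bsub>A\<^esub> y = r \<odot>\<^bsub>A\<^esub> (x \<otimes>\<^bsub>A\<^esub> y)"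
    and smult_mult_right:
      "\<lbrakk>r \<in> carrier R; x \<in> carrier A; y \<in> carrier A\<rbrakk>
        \<Longrightarrow> x \<otimes>\<^bsub>A\<^esub> (r \<odot>\<^bsub>A\<^esub> y) = r \<odot>\<^bsub>A\<^esub> (x \<otimes>\<^bsub>A\<^esub> y)"

locale coalgebra = module R C for R (structure) and C (structure) +
  fixes \<Delta> :: "'b \<Rightarrow> ('b \<times> 'b) list set" and \<epsilon> :: "'b \<Rightarrow> 'a"
  assumes comult_linear: "\<Delta> \<in> linear_maps R C (tensor R C C)"
    and counit_linear: "\<epsilon> \<in> linear_maps R C (regular_module R)"
    and coassoc: "c \<in> carrier C \<Longrightarrow>
      tensor_assoc R C C C (tensor_map R (tensor R C C) C \<Delta> (\<lambda>x. x) (\<Delta> c)) =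
      tensor_map R C (tensor R C C) (\<lambda>x. x) \<Delta> (\<Delta> c)"
    and counit_left: "c \<in> carrier C \<Longrightarrow> tensor_lift C (\<lambda>x y. \<epsilon> x \<odot>\<^bsub>C\<^esub> y) (\<Delta> c) = c"
    and counit_right: "c \<in> carrier C \<Longrightarrow> tensor_lift C (\<lambda>x y. \<epsilon> y \<odot>\<^bsub>C\<^esub> x) (\<Delta> c) = c"

locale coalgebra_hom =
  C: coalgebra R C \<Delta>C \<epsilon>C + D: coalgebra R D \<Delta>D \<epsilon>D
  for R (structure) and C (structure) and \<Delta>C and \<epsilon>C
    and D (structure) and \<Delta>D and \<epsilon>D and f +
  assumes hom_linear: "f \<in> linear_maps R C D"
    and hom_comult: "c \<in> carrier C \<Longrightarrow> \<Delta>D (f c) = tensor_map R D D f f (\<Delta>C c)"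
    and hom_counit: "c \<in> carrier C \<Longrightarrow> \<epsilon>D (f c) = \<epsilon>C c"

locale anti_algebra_hom =
  A: assoc_algebra R A + B: assoc_algebra R B
  for R (structure) and A (structure) and B (structure) and f +
  assumes hom_linear: "f \<in> linear_maps R A B"
    and hom_mult: "\<lbrakk>x \<in> carrier A; y \<in> carrier A\<rbrakk> \<Longrightarrow> f (x \<otimes>\<^bsub>A\<^esub> y) = f y \<otimes>\<^bsub>B\<^esub> f x"
    and hom_one: "f \<one>\<^bsub>A\<^esub> = \<one>\<^bsub>B\<^esub>"

text \<open>The maps \<open>f\<close> and \<open>g\<close> are mutually inverse anti-algebra and coalgebra isomorphisms.\<close>

definition inverse_anti_algebra_coalgebra_isos ::
  "('k, 'c) ring_scheme \<Rightarrow>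
    ('k, 'a, 'd) module_scheme \<Rightarrow> ('a \<Rightarrow> ('a \<times> 'a) list set) \<Rightarrow> ('a \<Rightarrow> 'k) \<Rightarrow>
    ('k, 'b, 'e) module_scheme \<Rightarrow> ('b \<Rightarrow> ('b \<times> 'b) list set) \<Rightarrow> ('b \<Rightarrow> 'k) \<Rightarrow>
    ('a \<Rightarrow> 'b) \<Rightarrow> ('b \<Rightarrow> 'a) \<Rightarrow> bool"
where
  "inverse_anti_algebra_coalgebra_isos R A \<Delta>A \<epsilon>A B \<Delta>B \<epsilon>B f g \<longleftrightarrow>
    anti_algebra_hom R A B f \<and> coalgebra_hom R A \<Delta>A \<epsilon>A B \<Delta>B \<epsilon>B f \<and>
    anti_algebra_hom R B A g \<and> coalgebra_hom R B \<Delta>B \<epsilon>B A \<Delta>A \<epsilon>A g \<and>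
    (\<forall>x\<in>carrier A. g (f x) = x) \<and> (\<forall>y\<in>carrier B. f (g y) = y)"


section \<open>Prebialgebras\<close>

locale prebialgebra = assoc_algebra R H + coalgebra R H \<Delta> \<epsilon>
  for R (structure) and H (structure) and \<Delta> and \<epsilon> +
  assumes comult_mult: "\<lbrakk>h \<in> carrier H; l \<in> carrier H\<rbrakk>
    \<Longrightarrow> \<Delta> (h \<otimes>\<^bsub>H\<^esub> l) = \<Delta> h \<otimes>\<^bsub>tensor R H H\<^esub> \<Delta> l"

definition axiom_lm ::
  "('k, 'c) ring_scheme \<Rightarrow> ('k, 'h, 'd) module_scheme \<Rightarrow> ('h \<Rightarrow> ('h \<times> 'h) list set) \<Rightarrow> ('h \<Rightarrow> 'k) \<Rightarrow> bool"
where
  "axiom_lm R H \<Delta> \<epsilon> \<longleftrightarrow>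
    (\<forall>h\<in>carrier H. \<forall>k\<in>carrier H. \<forall>l\<in>carrier H.
      \<epsilon> (h \<otimes>\<^bsub>H\<^esub> k \<otimes>\<^bsub>H\<^esub> l) =
      tensor_lift R (\<lambda>k1 k2. \<epsilon> (h \<otimes>\<^bsub>H\<^esub> k1) \<otimes>\<^bsub>R\<^esub> \<epsilon> (k2 \<otimes>\<^bsub>H\<^esub> l)) (\<Delta> k))"

definition axiom_rm ::
  "('k, 'c) ring_scheme \<Rightarrow> ('k, 'h, 'd) module_scheme \<Rightarrow> ('h \<Rightarrow> ('h \<times> 'h) list set) \<Rightarrow> ('h \<Rightarrow> 'k) \<Rightarrow> bool"
where
  "axiom_rm R H \<Delta> \<epsilon> \<longleftrightarrow>
    (\<forall>h\<in>carrier H. \<forall>k\<in>carrier H. \<forall>l\<in>carrier H.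
      \<epsilon> (h \<otimes>\<^bsub>H\<^esub> k \<otimes>\<^bsub>H\<^esub> l) =
      tensor_lift R (\<lambda>k1 k2. \<epsilon> (h \<otimes>\<^bsub>H\<^esub> k2) \<otimes>\<^bsub>R\<^esub> \<epsilon> (k1 \<otimes>\<^bsub>H\<^esub> l)) (\<Delta> k))"

text \<open>In the next two definitions \<open>a \<otimes> b\<close> and \<open>c \<otimes> d\<close> stand for the two copies
  \<open>1\<^sub>(\<^sub>1\<^sub>) \<otimes> 1\<^sub>(\<^sub>2\<^sub>)\<close> and \<open>1\<^sub>(\<^sub>1\<^sub>'\<^sub>) \<otimes> 1\<^sub>(\<^sub>2\<^sub>'\<^sub>)\<close> of \<open>\<Delta>(1)\<close>.\<close>

definition axiom_lc ::
  "('k, 'c) ring_scheme \<Rightarrow> ('k, 'h, 'd) module_scheme \<Rightarrow> ('h \<Rightarrow> ('h \<times> 'h) list set) \<Rightarrow> bool"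
where
  "axiom_lc R H \<Delta> \<longleftrightarrow>
    tensor_map R (tensor R H H) H \<Delta> (\<lambda>x. x) (\<Delta> \<one>\<^bsub>H\<^esub>) =
    (let T = tensor R (tensor R H H) H
     in tensor_lift T (\<lambda>a b.
          tensor_lift T (\<lambda>c d. tens R (tensor R H H) H (tens R H H a (b \<otimes>\<^bsub>H\<^esub> c)) d)
            (\<Delta> \<one>\<^bsub>H\<^esub>)) (\<Delta> \<one>\<^bsub>H\<^esub>))"

definition axiom_rc ::
  "('k, 'c) ring_scheme \<Rightarrow> ('k, 'h, 'd) module_scheme \<Rightarrow> ('h \<Rightarrow> ('h \<times> 'h) list set) \<Rightarrow> bool"
where
  "axiom_rc R H \<Delta> \<longleftrightarrow>
    tensor_map R (tensor R H H) H \<Delta> (\<lambda>x. x) (\<Delta> \<one>\<^bsub>H\<^esub>) =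
    (let T = tensor R (tensor R H H) H
     in tensor_lift T (\<lambda>a b.
          tensor_lift T (\<lambda>c d. tens R (tensor R H H) H (tens R H H a (c \<otimes>\<^bsub>H\<^esub> b)) d)
            (\<Delta> \<one>\<^bsub>H\<^esub>)) (\<Delta> \<one>\<^bsub>H\<^esub>))"

definition axiom_m ::
  "('k, 'c) ring_scheme \<Rightarrow> ('k, 'h, 'd) module_scheme \<Rightarrow> ('h \<Rightarrow> ('h \<times> 'h) list set) \<Rightarrow> ('h \<Rightarrow> 'k) \<Rightarrow> bool"
where
  "axiom_m R H \<Delta> \<epsilon> \<longleftrightarrow> axiom_lm R H \<Delta> \<epsilon> \<and> axiom_rm R H \<Delta> \<epsilon>"

definition axiom_c ::
  "('k, 'c) ring_scheme \<Rightarrow> ('k, 'h, 'd) module_scheme \<Rightarrow> ('h \<Rightarrow> ('h \<times> 'h) list set) \<Rightarrow> bool"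
where
  "axiom_c R H \<Delta> \<longleftrightarrow> axiom_lc R H \<Delta> \<and> axiom_rc R H \<Delta>"

definition eps_t ::
  "('k, 'h, 'd) module_scheme \<Rightarrow> ('h \<Rightarrow> ('h \<times> 'h) list set) \<Rightarrow> ('h \<Rightarrow> 'k) \<Rightarrow> 'h \<Rightarrow> 'h"
where
  "eps_t H \<Delta> \<epsilon> h = tensor_lift H (\<lambda>a b. \<epsilon> (a \<otimes>\<^bsub>H\<^esub> h) \<odot>\<^bsub>H\<^esub> b) (\<Delta> \<one>\<^bsub>H\<^esub>)"

definition eps_s ::
  "('k, 'h, 'd) module_scheme \<Rightarrow> ('h \<Rightarrow> ('h \<times> 'h) list set) \<Rightarrow> ('h \<Rightarrow> 'k) \<Rightarrow> 'h \<Rightarrow> 'h"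
where
  "eps_s H \<Delta> \<epsilon> h = tensor_lift H (\<lambda>a b. \<epsilon> (h \<otimes>\<^bsub>H\<^esub> b) \<odot>\<^bsub>H\<^esub> a) (\<Delta> \<one>\<^bsub>H\<^esub>)"

definition bar_eps_t ::
  "('k, 'h, 'd) module_scheme \<Rightarrow> ('h \<Rightarrow> ('h \<times> 'h) list set) \<Rightarrow> ('h \<Rightarrow> 'k) \<Rightarrow> 'h \<Rightarrow> 'h"
where
  "bar_eps_t H \<Delta> \<epsilon> h = tensor_lift H (\<lambda>a b. \<epsilon> (h \<otimes>\<^bsub>H\<^esub> a) \<odot>\<^bsub>H\<^esub> b) (\<Delta> \<one>\<^bsub>H\<^esub>)"

definition bar_eps_s ::
  "('k, 'h, 'd) module_scheme \<Rightarrow> ('h \<Rightarrow> ('h \<times> 'h) list set) \<Rightarrow> ('h \<Rightarrow> 'k) \<Rightarrow> 'h \<Rightarrow> 'h"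
where
  "bar_eps_s H \<Delta> \<epsilon> h = tensor_lift H (\<lambda>a b. \<epsilon> (b \<otimes>\<^bsub>H\<^esub> h) \<odot>\<^bsub>H\<^esub> a) (\<Delta> \<one>\<^bsub>H\<^esub>)"

text \<open>The images carry the module and algebra operations of \<open>H\<close>. Their tensor squares below are
  formed from the submodules themselves, not inside \<open>H \<otimes> H\<close>.\<close>

definition im_t ::
  "('k, 'h, 'd) module_scheme \<Rightarrow> ('h \<Rightarrow> ('h \<times> 'h) list set) \<Rightarrow> ('h \<Rightarrow> 'k) \<Rightarrow> ('k, 'h, 'd) module_scheme"
where
  "im_t H \<Delta> \<epsilon> = H\<lparr>carrier := eps_t H \<Delta> \<epsilon> ` carrier H\<rparr>"

definition im_s ::
  "('k, 'h, 'd) module_scheme \<Rightarrow> ('h \<Rightarrow> ('h \<times> 'h) list set) \<Rightarrow> ('h \<Rightarrow> 'k) \<Rightarrow> ('k, 'h, 'd) module_scheme"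
where
  "im_s H \<Delta> \<epsilon> = H\<lparr>carrier := eps_s H \<Delta> \<epsilon> ` carrier H\<rparr>"

definition bar_im_t ::
  "('k, 'h, 'd) module_scheme \<Rightarrow> ('h \<Rightarrow> ('h \<times> 'h) list set) \<Rightarrow> ('h \<Rightarrow> 'k) \<Rightarrow> ('k, 'h, 'd) module_scheme"
where
  "bar_im_t H \<Delta> \<epsilon> = H\<lparr>carrier := bar_eps_t H \<Delta> \<epsilon> ` carrier H\<rparr>"

definition bar_im_s ::
  "('k, 'h, 'd) module_scheme \<Rightarrow> ('h \<Rightarrow> ('h \<times> 'h) list set) \<Rightarrow> ('h \<Rightarrow> 'k) \<Rightarrow> ('k, 'h, 'd) module_scheme"
where
  "bar_im_s H \<Delta> \<epsilon> = H\<lparr>carrier := bar_eps_s H \<Delta> \<epsilon> ` carrier H\<rparr>"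

definition comult_t ::
  "('k, 'c) ring_scheme \<Rightarrow> ('k, 'h, 'd) module_scheme \<Rightarrow> ('h \<Rightarrow> ('h \<times> 'h) list set) \<Rightarrow> ('h \<Rightarrow> 'k) \<Rightarrow>
    'h \<Rightarrow> ('h \<times> 'h) list set"
where
  "comult_t R H \<Delta> \<epsilon> z =
    tensor_lift (tensor R (im_t H \<Delta> \<epsilon>) (im_t H \<Delta> \<epsilon>))
      (\<lambda>a b. tens R (im_t H \<Delta> \<epsilon>) (im_t H \<Delta> \<epsilon>) (eps_t H \<Delta> \<epsilon> (a \<otimes>\<^bsub>H\<^esub> z)) (eps_t H \<Delta> \<epsilon> b))
      (\<Delta> \<one>\<^bsub>H\<^esub>)"

definition comult_s ::
  "('k, 'c) ring_scheme \<Rightarrow> ('k, 'h, 'd) module_scheme \<Rightarrow> ('h \<Rightarrow> ('h \<times> 'h) list set) \<Rightarrow> ('h \<Rightarrow> 'k) \<Rightarrow>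
    'h \<Rightarrow> ('h \<times> 'h) list set"
where
  "comult_s R H \<Delta> \<epsilon> y =
    tensor_lift (tensor R (im_s H \<Delta> \<epsilon>) (im_s H \<Delta> \<epsilon>))
      (\<lambda>a b. tens R (im_s H \<Delta> \<epsilon>) (im_s H \<Delta> \<epsilon>) (eps_s H \<Delta> \<epsilon> a) (eps_s H \<Delta> \<epsilon> (y \<otimes>\<^bsub>H\<^esub> b)))
      (\<Delta> \<one>\<^bsub>H\<^esub>)"

definition bar_comult_t ::
  "('k, 'c) ring_scheme \<Rightarrow> ('k, 'h, 'd) module_scheme \<Rightarrow> ('h \<Rightarrow> ('h \<times> 'h) list set) \<Rightarrow> ('h \<Rightarrow> 'k) \<Rightarrow>
    'h \<Rightarrow> ('h \<times> 'h) list set"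
where
  "bar_comult_t R H \<Delta> \<epsilon> z =
    tensor_lift (tensor R (bar_im_t H \<Delta> \<epsilon>) (bar_im_t H \<Delta> \<epsilon>))
      (\<lambda>a b. tens R (bar_im_t H \<Delta> \<epsilon>) (bar_im_t H \<Delta> \<epsilon>)
        (bar_eps_t H \<Delta> \<epsilon> (z \<otimes>\<^bsub>H\<^esub> a)) (bar_eps_t H \<Delta> \<epsilon> b))
      (\<Delta> \<one>\<^bsub>H\<^esub>)"

definition bar_comult_s ::
  "('k, 'c) ring_scheme \<Rightarrow> ('k, 'h, 'd) module_scheme \<Rightarrow> ('h \<Rightarrow> ('h \<times> 'h) list set) \<Rightarrow> ('h \<Rightarrow> 'k) \<Rightarrow>
    'h \<Rightarrow> ('h \<times> 'h) list set"
where
  "bar_comult_s R H \<Delta> \<epsilon> y =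
    tensor_lift (tensor R (bar_im_s H \<Delta> \<epsilon>) (bar_im_s H \<Delta> \<epsilon>))
      (\<lambda>a b. tens R (bar_im_s H \<Delta> \<epsilon>) (bar_im_s H \<Delta> \<epsilon>)
        (bar_eps_s H \<Delta> \<epsilon> a) (bar_eps_s H \<Delta> \<epsilon> (b \<otimes>\<^bsub>H\<^esub> y)))
      (\<Delta> \<one>\<^bsub>H\<^esub>)"

end

theory Submission
  imports Defs
begin

text \<open>
  The four maps \<open>\<epsilon>\<^sub>t\<close>, \<open>\<epsilon>\<^sub>s\<close>, \<open>\<epsilon>\<^sub>t\<close>-bar and \<open>\<epsilon>\<^sub>s\<close>-bar are one map seen through two symmetries.
  Reversing the multiplication of a prebialgebra gives a prebialgebra again, and so does reversing
  its comultiplication. Each reversal exchanges (lm) with (rm) and (lc) with (rc). The first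
  exchanges each of \<open>\<epsilon>\<^sub>t\<close>, \<open>\<epsilon>\<^sub>s\<close> with its barred version, the second exchanges \<open>\<epsilon>\<^sub>t\<close> with
  \<open>\<epsilon>\<^sub>s\<close>-bar and \<open>\<epsilon>\<^sub>s\<close> with \<open>\<epsilon>\<^sub>t\<close>-bar. So all calculations are made for \<open>\<epsilon>\<^sub>t\<close> under (rm) or (rc),
  and the other cases are instances (lemmas \<open>prebialgebra_opposite\<close>, \<open>prebialgebra_coopposite\<close>,
  \<open>axiom_coopposite\<close>, \<open>eps_opposite\<close>, \<open>eps_coopposite\<close>).

  Part (1). The map \<open>\<epsilon>\<^sub>t : H \<rightarrow> H\<^sub>t\<close> is surjective and preserves the counit. If moreover
  \<open>\<Delta>\<^sub>t(\<epsilon>\<^sub>t(h)) = \<epsilon>\<^sub>t(h\<^sub>1) \<otimes> \<epsilon>\<^sub>t(h\<^sub>2)\<close>, then linearity, coassociativity and counitality of \<open>\<Delta>\<^sub>t\<close> are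
  inherited from \<open>\<Delta>\<close>, and \<open>\<epsilon>\<^sub>t\<close> is a coalgebra map (\<open>quotient_coalgebra_hom\<close>). Both sides of the
  required identity equal \<open>\<epsilon>\<^sub>t(1\<^sub>1 h) \<otimes> \<epsilon>\<^sub>t(1\<^sub>2)\<close>.
  For the right-hand side (\<open>sw_eps_t_eps_t\<close>) one writes \<open>\<Delta>(h) = \<Delta>(1) \<Delta>(h)\<close> and uses
  \<open>1\<^sub>1 \<otimes> \<epsilon>\<^sub>t(1\<^sub>2 d) = 1\<^sub>1 \<otimes> \<epsilon>(1\<^sub>2 d) \<epsilon>\<^sub>t(1\<^sub>3)\<close>, which (rm) and (rc) both imply.
  For the left-hand side (\<open>sw_one_eps_t_absorb\<close>) one needs
  \<open>\<epsilon>\<^sub>t(x \<epsilon>\<^sub>t(h)) = \<epsilon>\<^sub>t(x h)\<close>. Under (rm) this holds for all \<open>x\<close>. Under (rc) it holds for \<open>x \<in> H\<^sub>s\<close>,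
  because \<open>H\<^sub>s\<close> is closed under multiplication and \<open>\<epsilon>(y \<epsilon>\<^sub>t(h)) = \<epsilon>(\<epsilon>\<^sub>s(y) h)\<close>; this is enough,
  as (rc) gives \<open>\<Delta>(1) = \<epsilon>\<^sub>s(1\<^sub>1) \<otimes> 1\<^sub>2\<close>.

  Part (2). Under (m), \<open>\<epsilon>\<^sub>t\<close> and \<open>\<epsilon>\<^sub>s\<close>-bar absorb each other, so that their restrictions are mutually
  inverse, and they are coalgebra maps because \<open>\<epsilon>\<^sub>t\<close> and \<open>\<epsilon>\<^sub>s\<close>-bar are coalgebra maps on \<open>H\<close>
  (\<open>coalgebra_hom_descends\<close>). Under (rm), \<open>\<epsilon>\<^sub>t(h) \<epsilon>\<^sub>t(k) = \<epsilon>(1\<^sub>1 h) \<epsilon>(1\<^sub>2 k) 1\<^sub>3\<close>, and the image of this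
  product under \<open>\<epsilon>\<^sub>s\<close>-bar is \<open>1\<^sub>1 \<epsilon>(1\<^sub>2 h) \<epsilon>(1\<^sub>3 k)\<close>. The co-opposite of the first formula says that
  the latter is the product of \<open>\<epsilon>\<^sub>s\<close>-bar of \<open>k\<close> with \<open>\<epsilon>\<^sub>s\<close>-bar of \<open>h\<close>.

  Part (3). Under (c), \<open>\<Delta>(1)\<close> lies in \<open>H\<^sub>s \<otimes> H\<^sub>t\<close>, whence the images coincide, and the elements of
  \<open>H\<^sub>s\<close> commute with those of \<open>H\<^sub>t\<close>, which turns one comultiplication into the flip of the other.

  The Sweedler calculus itself is obtained by choosing for every \<open>\<Delta>(h)\<close> a representing formal sum.
\<close>

text \<open>Operations whose structure is a single letter are written with a plain subscript.\<close>

abbreviation (input) add_subscript ("_ \<oplus>\<^sub>_ _" [65, 1000, 66] 65) where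
  "x \<oplus>\<^sub>M y \<equiv> x \<oplus>\<^bsub>M\<^esub> y"

abbreviation (input) mult_subscript ("_ \<otimes>\<^sub>_ _" [70, 1000, 71] 70) where
  "x \<otimes>\<^sub>M y \<equiv> x \<otimes>\<^bsub>M\<^esub> y"

abbreviation (input) smult_subscript ("_ \<odot>\<^sub>_ _" [70, 1000, 71] 70) where
  "r \<odot>\<^sub>M x \<equiv> r \<odot>\<^bsub>M\<^esub> x"

abbreviation (input) one_subscript ("\<one>\<^sub>_" [1000] 1000) where
  "\<one>\<^sub>M \<equiv> \<one>\<^bsub>M\<^esub>"


section \<open>Linear, bilinear and trilinear maps\<close>

lemma linear_mapsI:
  assumes "\<And>x. x \<in> carrier M \<Longrightarrow> f x \<in> carrier N"
    and "\<And>x y. \<lbrakk>x \<in> carrier M; y \<in> carrier M\<rbrakk> \<Longrightarrow> f (x \<oplus>\<^sub>M y) = f x \<oplus>\<^sub>N f y"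
    and "\<And>r x. \<lbrakk>r \<in> carrier R; x \<in> carrier M\<rbrakk> \<Longrightarrow> f (r \<odot>\<^sub>M x) = r \<odot>\<^sub>N f x"
  shows "f \<in> linear_maps R M N"
  using assms by (auto simp: linear_maps_def)

lemma linear_mapsD:
  assumes "f \<in> linear_maps R M N"
  shows "x \<in> carrier M \<Longrightarrow> f x \<in> carrier N"
    and "\<lbrakk>x \<in> carrier M; y \<in> carrier M\<rbrakk> \<Longrightarrow> f (x \<oplus>\<^sub>M y) = f x \<oplus>\<^sub>N f y"
    and "\<lbrakk>r \<in> carrier R; x \<in> carrier M\<rbrakk> \<Longrightarrow> f (r \<odot>\<^sub>M x) = r \<odot>\<^sub>N f x"
  using assms by (auto simp: linear_maps_def)

lemma linear_map_zero:
  assumes "module R M" "module R N" "f \<in> linear_maps R M N"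
  shows "f \<zero>\<^bsub>M\<^esub> = \<zero>\<^bsub>N\<^esub>"
proof -
  interpret M: module R M by fact
  interpret N: module R N by fact
  have "f (\<zero>\<^bsub>R\<^esub> \<odot>\<^sub>M \<zero>\<^bsub>M\<^esub>) = \<zero>\<^bsub>R\<^esub> \<odot>\<^sub>N f \<zero>\<^bsub>M\<^esub>"
    by (rule linear_mapsD(3)[OF assms(3)]) simp_all
  then show ?thesis using linear_mapsD(1)[OF assms(3)] by simp
qed

definition bilinear_map ::
  "('k, 'c) ring_scheme \<Rightarrow> ('k, 'm, 'd) module_scheme \<Rightarrow> ('k, 'n, 'e) module_scheme \<Rightarrow>
    ('k, 'p, 'f) module_scheme \<Rightarrow> ('m \<Rightarrow> 'n \<Rightarrow> 'p) \<Rightarrow> bool"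
where
  "bilinear_map R M N P b \<longleftrightarrow>
    (\<forall>y\<in>carrier N. (\<lambda>x. b x y) \<in> linear_maps R M P) \<and>
    (\<forall>x\<in>carrier M. (\<lambda>y. b x y) \<in> linear_maps R N P)"

definition trilinear_map ::
  "('k, 'c) ring_scheme \<Rightarrow> ('k, 'l, 'g) module_scheme \<Rightarrow> ('k, 'm, 'd) module_scheme \<Rightarrow>
    ('k, 'n, 'e) module_scheme \<Rightarrow> ('k, 'p, 'f) module_scheme \<Rightarrow>
    ('l \<Rightarrow> 'm \<Rightarrow> 'n \<Rightarrow> 'p) \<Rightarrow> bool"
where
  "trilinear_map R L M N P t \<longleftrightarrow>
    (\<forall>y\<in>carrier M. \<forall>z\<in>carrier N. (\<lambda>x. t x y z) \<in> linear_maps R L P) \<and>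
    (\<forall>x\<in>carrier L. \<forall>z\<in>carrier N. (\<lambda>y. t x y z) \<in> linear_maps R M P) \<and>
    (\<forall>x\<in>carrier L. \<forall>y\<in>carrier M. (\<lambda>z. t x y z) \<in> linear_maps R N P)"

lemma bilinear_mapI:
  assumes "\<And>y. y \<in> carrier N \<Longrightarrow> (\<lambda>x. b x y) \<in> linear_maps R M P"
    and "\<And>x. x \<in> carrier M \<Longrightarrow> (\<lambda>y. b x y) \<in> linear_maps R N P"
  shows "bilinear_map R M N P b"
  using assms by (auto simp: bilinear_map_def)

lemma trilinear_mapI:
  assumes "\<And>y z. \<lbrakk>y \<in> carrier M; z \<in> carrier N\<rbrakk> \<Longrightarrow> (\<lambda>x. t x y z) \<in> linear_maps R L P"
    and "\<And>x z. \<lbrakk>x \<in> carrier L; z \<in> carrier N\<rbrakk> \<Longrightarrow> (\<lambda>y. t x y z) \<in> linear_maps R M P"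
    and "\<And>x y. \<lbrakk>x \<in> carrier L; y \<in> carrier M\<rbrakk> \<Longrightarrow> (\<lambda>z. t x y z) \<in> linear_maps R N P"
  shows "trilinear_map R L M N P t"
  using assms by (auto simp: trilinear_map_def)

lemma bilinear_mapD:
  assumes "bilinear_map R M N P b"
  shows "y \<in> carrier N \<Longrightarrow> (\<lambda>x. b x y) \<in> linear_maps R M P"
    and "x \<in> carrier M \<Longrightarrow> (\<lambda>y. b x y) \<in> linear_maps R N P"
    and "\<lbrakk>x \<in> carrier M; y \<in> carrier N\<rbrakk> \<Longrightarrow> b x y \<in> carrier P"
  using assms linear_mapsD(1)[of "\<lambda>x. b x y" R M P] by (auto simp: bilinear_map_def)

lemma trilinear_mapD:
  assumes "trilinear_map R L M N P t"
  shows "\<lbrakk>y \<in> carrier M; z \<in> carrier N\<rbrakk> \<Longrightarrow> (\<lambda>x. t x y z) \<in> linear_maps R L P"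
    and "\<lbrakk>x \<in> carrier L; z \<in> carrier N\<rbrakk> \<Longrightarrow> (\<lambda>y. t x y z) \<in> linear_maps R M P"
    and "\<lbrakk>x \<in> carrier L; y \<in> carrier M\<rbrakk> \<Longrightarrow> (\<lambda>z. t x y z) \<in> linear_maps R N P"
    and "\<lbrakk>x \<in> carrier L; y \<in> carrier M; z \<in> carrier N\<rbrakk> \<Longrightarrow> t x y z \<in> carrier P"
    and "z \<in> carrier N \<Longrightarrow> bilinear_map R L M P (\<lambda>x y. t x y z)"
    and "x \<in> carrier L \<Longrightarrow> bilinear_map R M N P (\<lambda>y z. t x y z)"
  using assms linear_mapsD(1)[of "\<lambda>x. t x y z" R L P]
  by (auto simp: trilinear_map_def intro!: bilinear_mapI)

lemma linear_map_id: "(\<lambda>x. x) \<in> linear_maps R M M"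
  by (simp add: linear_maps_def)

lemma linear_map_smult:
  assumes "module R M" "r \<in> carrier R"
  shows "(\<lambda>x. r \<odot>\<^sub>M x) \<in> linear_maps R M M"
proof -
  interpret M: module R M by fact
  show ?thesis
    using assms(2)
    by (auto intro!: linear_mapsI simp: M.smult_r_distr M.smult_assoc1[symmetric] M.R.m_comm)
qed

lemma linear_map_comp:
  assumes "g \<in> linear_maps R N P" "f \<in> linear_maps R M N"
  shows "(\<lambda>x. g (f x)) \<in> linear_maps R M P"
  by (rule linear_mapsI) (simp_all add: linear_mapsD[OF assms(1)] linear_mapsD[OF assms(2)])

lemma bilinear_map_comp:
  assumes "bilinear_map R M' N' P b" "f \<in> linear_maps R M M'" "g \<in> linear_maps R N N'"
  shows "bilinear_map R M N P (\<lambda>x y. b (f x) (g y))"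
  by (intro bilinear_mapI linear_map_comp[OF bilinear_mapD(1)[OF assms(1)] assms(2)]
      linear_map_comp[OF bilinear_mapD(2)[OF assms(1)] assms(3)]
      linear_mapsD(1)[OF assms(2)] linear_mapsD(1)[OF assms(3)])

lemma linear_map_cong:
  assumes "module R M" "f \<in> linear_maps R M N" "\<And>x. x \<in> carrier M \<Longrightarrow> f x = g x"
  shows "g \<in> linear_maps R M N"
proof -
  interpret M: module R M by fact
  show ?thesis
    by (rule linear_mapsI) (simp_all add: assms(3)[symmetric] linear_mapsD[OF assms(2)])
qed

lemma bilinear_map_cong:
  assumes "module R M" "module R N" "bilinear_map R M N P b"
    and "\<And>x y. \<lbrakk>x \<in> carrier M; y \<in> carrier N\<rbrakk> \<Longrightarrow> b x y = b' x y"
  shows "bilinear_map R M N P b'"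
  by (rule bilinear_mapI)
    (rule linear_map_cong[OF assms(1) bilinear_mapD(1)[OF assms(3)] assms(4)]
      linear_map_cong[OF assms(2) bilinear_mapD(2)[OF assms(3)] assms(4)]; assumption)+


section \<open>Sums over formal sums\<close>

definition formal_sum :: "('p, 'f) ring_scheme \<Rightarrow> ('m \<Rightarrow> 'n \<Rightarrow> 'p) \<Rightarrow> ('m \<times> 'n) list \<Rightarrow> 'p" where
  "formal_sum P b xs = foldr (\<lambda>(x, y) s. b x y \<oplus>\<^sub>P s) xs \<zero>\<^bsub>P\<^esub>"

lemma formal_sum_simps [simp]:
  "formal_sum P b [] = \<zero>\<^bsub>P\<^esub>"
  "formal_sum P b ((x, y) # xs) = b x y \<oplus>\<^sub>P formal_sum P b xs"
  by (simp_all add: formal_sum_def)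

lemma formal_sum_map:
  "formal_sum P b (map (\<lambda>(x, y). (f x y, g x y)) xs) = formal_sum P (\<lambda>x y. b (f x y) (g x y)) xs"
  by (induction xs) (simp_all add: formal_sum_def split: prod.split)

lemma formal_sum_cong:
  assumes "xs \<in> lists (A \<times> B)" "\<And>x y. \<lbrakk>x \<in> A; y \<in> B\<rbrakk> \<Longrightarrow> b x y = b' x y"
  shows "formal_sum P b xs = formal_sum P b' xs"
  using assms(1)
proof (induction xs)
  case (Cons p xs)
  then show ?case by (cases p) (simp add: assms(2))
qed simp

context abelian_monoid
begin

lemma formal_sum_closed:
  assumes "xs \<in> lists (A \<times> B)" "\<And>x y. \<lbrakk>x \<in> A; y \<in> B\<rbrakk> \<Longrightarrow> b x y \<in> carrier G"
  shows "formal_sum G b xs \<in> carrier G"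
  using assms(1)
proof (induction xs)
  case (Cons p xs)
  then show ?case by (cases p) (simp add: assms(2))
qed simp

lemma formal_sum_append:
  assumes "xs \<in> lists (A \<times> B)" "ys \<in> lists (A \<times> B)"
    and "\<And>x y. \<lbrakk>x \<in> A; y \<in> B\<rbrakk> \<Longrightarrow> b x y \<in> carrier G"
  shows "formal_sum G b (xs @ ys) = formal_sum G b xs \<oplus> formal_sum G b ys"
proof -
  have ys: "formal_sum G b ys \<in> carrier G"
    using assms(2,3) by (rule formal_sum_closed)
  show ?thesis
    using assms(1)
  proof (induction xs)
    case Nil
    then show ?case using ys by simp
  next
    case (Cons p xs)
    obtain x y where p: "p = (x, y)" by (cases p)
    have xy: "x \<in> A" "y \<in> B" and xs: "xs \<in> lists (A \<times> B)"
      using Cons.hyps by (simp_all add: p)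
    have "formal_sum G b xs \<in> carrier G"
      by (rule formal_sum_closed[OF xs assms(3)])
    then show ?case
      using Cons.IH ys assms(3)[OF xy] by (simp add: p a_assoc)
  qed
qed

lemma formal_sum_add:
  assumes "xs \<in> lists (A \<times> B)" "\<And>x y. \<lbrakk>x \<in> A; y \<in> B\<rbrakk> \<Longrightarrow> b x y \<in> carrier G"
    and "\<And>x y. \<lbrakk>x \<in> A; y \<in> B\<rbrakk> \<Longrightarrow> b' x y \<in> carrier G"
  shows "formal_sum G (\<lambda>x y. b x y \<oplus> b' x y) xs = formal_sum G b xs \<oplus> formal_sum G b' xs"
  using assms(1)
proof (induction xs)
  case (Cons p xs)
  obtain x y where p: "p = (x, y)" by (cases p)
  have xy: "x \<in> A" "y \<in> B" and xs: "xs \<in> lists (A \<times> B)"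
    using Cons.hyps by (simp_all add: p)
  note closed = formal_sum_closed[OF xs assms(2)] formal_sum_closed[OF xs assms(3)]
  show ?case
    using closed Cons.IH assms(2)[OF xy] assms(3)[OF xy] by (simp add: p a_ac)
qed simp

lemma formal_sum_zero: "formal_sum G (\<lambda>x y. \<zero>) xs = \<zero>"
  by (induction xs) auto

lemma formal_sum_swap:
  assumes "xs \<in> lists (A \<times> B)" "ys \<in> lists (C \<times> D)"
    and f: "\<And>a b c d. \<lbrakk>a \<in> A; b \<in> B; c \<in> C; d \<in> D\<rbrakk> \<Longrightarrow> f a b c d \<in> carrier G"
  shows "formal_sum G (\<lambda>a b. formal_sum G (\<lambda>c d. f a b c d) ys) xs =
    formal_sum G (\<lambda>c d. formal_sum G (\<lambda>a b. f a b c d) xs) ys"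
  using assms(1)
proof (induction xs)
  case Nil
  then show ?case by (simp add: formal_sum_zero)
next
  case (Cons p xs)
  obtain a b where p: "p = (a, b)" by (cases p)
  have ab: "a \<in> A" "b \<in> B" "xs \<in> lists (A \<times> B)"
    using Cons.hyps by (simp_all add: p)
  have "formal_sum G (\<lambda>c d. formal_sum G (\<lambda>a b. f a b c d) (p # xs)) ys =
      formal_sum G (\<lambda>c d. f a b c d \<oplus> formal_sum G (\<lambda>a b. f a b c d) xs) ys"
    by (simp only: p formal_sum_simps)
  also have "\<dots> = formal_sum G (f a b) ys \<oplus> formal_sum G (\<lambda>c d. formal_sum G (\<lambda>a b. f a b c d) xs) ys"
  proof (rule formal_sum_add[OF assms(2)])
    fix c d assume "c \<in> C" "d \<in> D"
    then have "f a b c d \<in> carrier G" if "a \<in> A" "b \<in> B" for a b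
      using that f by blast
    then show "f a b c d \<in> carrier G" "formal_sum G (\<lambda>a b. f a b c d) xs \<in> carrier G"
      using ab formal_sum_closed[OF ab(3), of "\<lambda>a b. f a b c d"] by blast+
  qed
  finally show ?case by (simp only: p formal_sum_simps Cons.IH)
qed

end

lemma linear_map_formal_sum:
  assumes "module R N" "module R P" "g \<in> linear_maps R N P" "xs \<in> lists (A \<times> B)"
    and b: "\<And>x y. \<lbrakk>x \<in> A; y \<in> B\<rbrakk> \<Longrightarrow> b x y \<in> carrier N"
  shows "g (formal_sum N b xs) = formal_sum P (\<lambda>x y. g (b x y)) xs"
proof -
  interpret N: module R N by fact
  show ?thesis
    using assms(4)
  proof (induction xs)
    case Nil
    then show ?case by (simp add: linear_map_zero[OF assms(1-3)])
  next
    case (Cons p xs)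
    obtain x y where p: "p = (x, y)" by (cases p)
    have xy: "x \<in> A" "y \<in> B" "xs \<in> lists (A \<times> B)"
      using Cons.hyps by (simp_all add: p)
    have "formal_sum N b xs \<in> carrier N"
      by (rule N.formal_sum_closed[OF xy(3) b])
    with b[OF xy(1,2)] have "g (b x y \<oplus>\<^sub>N formal_sum N b xs) = g (b x y) \<oplus>\<^sub>P g (formal_sum N b xs)"
      by (rule linear_mapsD(2)[OF assms(3)])
    then show ?case using Cons.IH by (simp add: p)
  qed
qed


section \<open>The tensor product as a module\<close>

lemma tensor_rel_lists:
  assumes "module R M" "module R N" "(xs, ys) \<in> tensor_rel R M N"
  shows "xs \<in> lists (carrier M \<times> carrier N) \<and> ys \<in> lists (carrier M \<times> carrier N)"
proof -
  interpret M: module R M by fact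
  interpret N: module R N by fact
  show ?thesis using assms(3) by (induction rule: tensor_rel.induct) simp_all
qed

text \<open>A bilinear map sends each generator of the congruence to an equation. This makes
  \<^const>\<open>tensor_lift\<close> well defined and is the universal property of the tensor product.\<close>

lemma tensor_rel_formal_sum:
  assumes "module R M" "module R N" "module R P" "bilinear_map R M N P b"
    and "(xs, ys) \<in> tensor_rel R M N"
  shows "formal_sum P b xs = formal_sum P b ys"
proof -
  interpret M: module R M by fact
  interpret N: module R N by fact
  interpret P: module R P by fact
  note b = bilinear_mapD[OF assms(4)]
  note lists = tensor_rel_lists[OF assms(1,2)]
  note app = P.formal_sum_append[where A = "carrier M" and B = "carrier N" and b = b, OF _ _ b(3)]
  show ?thesis using assms(5)
  proof (induction rule: tensor_rel.induct)
    case (append xs xs' ys ys')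
    then show ?case
      using lists[OF append.hyps(1)] lists[OF append.hyps(2)] by (simp only: app)
  next
    case (commute xs ys)
    then show ?case
      by (simp only: app P.a_comm
          P.formal_sum_closed[where A = "carrier M" and B = "carrier N" and b = b, OF _ b(3)])
  next
    case (zero y)
    then show ?case
      using linear_map_zero[OF assms(1,3) b(1)[of y]] by simp
  next
    case (add_left x x' y)
    then show ?case using linear_mapsD(2)[OF b(1)[of y], of x x'] b(3) by simp
  next
    case (add_right x y y')
    then show ?case using linear_mapsD(2)[OF b(2)[of x], of y y'] b(3) by simp
  next
    case (balanced r x y)
    then show ?case
      using linear_mapsD(3)[OF b(1)[of y], of r x] linear_mapsD(3)[OF b(2)[of x], of r y] by simp
  qed simp_all
qed

lemma tensor_rel_smult:
  assumes "module R M" "module R N" "r \<in> carrier R" "(xs, ys) \<in> tensor_rel R M N"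
  shows "(map (\<lambda>(a, b). (r \<odot>\<^sub>M a, b)) xs, map (\<lambda>(a, b). (r \<odot>\<^sub>M a, b)) ys) \<in> tensor_rel R M N"
proof -
  interpret M: module R M by fact
  interpret N: module R N by fact
  let ?f = "map (\<lambda>(a, b). (r \<odot>\<^sub>M a, b))"
  have f: "?f xs \<in> lists (carrier M \<times> carrier N)" if "xs \<in> lists (carrier M \<times> carrier N)" for xs
    using that assms(3) by (induction xs) auto
  show ?thesis using assms(4)
  proof (induction rule: tensor_rel.induct)
    case (refl xs) then show ?case using f by (simp add: tensor_rel.refl)
  next
    case (sym xs ys) from sym.IH show ?case by (rule tensor_rel.sym)
  next
    case (trans xs ys zs) then show ?case by (blast intro: tensor_rel.trans)
  next
    case (append xs xs' ys ys') then show ?case by (auto intro: tensor_rel.append)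
  next
    case (commute xs ys) then show ?case using f by (auto intro: tensor_rel.commute)
  next
    case (add_left x x' y) then show ?case
      using assms(3) by (auto simp: M.smult_r_distr intro: tensor_rel.add_left)
  next
    case (add_right x y y') then show ?case
      using assms(3) by (auto intro: tensor_rel.add_right)
  next
    case (balanced s x y)
    have "r \<odot>\<^sub>M (s \<odot>\<^sub>M x) = s \<odot>\<^sub>M (r \<odot>\<^sub>M x)"
      using balanced assms(3) by (metis M.smult_assoc1 M.R.m_comm)
    then show ?case using balanced assms(3) by (auto intro: tensor_rel.balanced)
  next
    case (zero y) then show ?case using assms(3) by (auto intro: tensor_rel.zero)
  qed
qed

locale two_modules = M: module R M + N: module R N
  for R (structure) and M :: "('k, 'm, 'd) module_scheme" and N :: "('k, 'n, 'e) module_scheme"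
begin

abbreviation formal :: "('m \<times> 'n) list set" where
  "formal \<equiv> lists (carrier M \<times> carrier N)"

abbreviation T :: "('k, ('m \<times> 'n) list set) module" where
  "T \<equiv> tensor R M N"

abbreviation cls :: "('m \<times> 'n) list \<Rightarrow> ('m \<times> 'n) list set" where
  "cls \<equiv> tensor_class R M N"

lemma rel_lists:
  assumes "(xs, ys) \<in> tensor_rel R M N"
  shows "xs \<in> formal" "ys \<in> formal"
  using tensor_rel_lists[OF M.module_axioms N.module_axioms assms] by auto

lemma equiv_tensor_rel: "equiv formal (tensor_rel R M N)"
  by (rule equivI)
    (auto simp: refl_on_def sym_def trans_def simp del: in_lists_conv_set dest: rel_lists
      intro: tensor_rel.refl tensor_rel.sym tensor_rel.trans)

lemma class_eq_iff:
  assumes "xs \<in> formal" "ys \<in> formal"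
  shows "cls xs = cls ys \<longleftrightarrow> (xs, ys) \<in> tensor_rel R M N"
  unfolding tensor_class_def using eq_equiv_class_iff[OF equiv_tensor_rel assms] .

lemma class_eqI: "(xs, ys) \<in> tensor_rel R M N \<Longrightarrow> cls xs = cls ys"
  using class_eq_iff rel_lists by blast

lemma mem_class_iff: "ys \<in> cls xs \<longleftrightarrow> (xs, ys) \<in> tensor_rel R M N"
  by (simp add: tensor_class_def)

lemma self_in_class: "xs \<in> formal \<Longrightarrow> xs \<in> cls xs"
  by (simp add: mem_class_iff tensor_rel.refl)

lemma class_in_carrier [simp]: "xs \<in> formal \<Longrightarrow> cls xs \<in> carrier T"
  by (simp add: tensor_def tensor_class_def quotientI)

lemma carrier_tensorE:
  assumes "X \<in> carrier T"
  obtains xs where "xs \<in> formal" "X = cls xs"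
  using assms by (auto simp: tensor_def tensor_class_def elim!: quotientE)

lemma UN_class:
  assumes "xs \<in> formal" "\<And>xs'. (xs, xs') \<in> tensor_rel R M N \<Longrightarrow> F xs' = F xs"
  shows "(\<Union>xs'\<in>cls xs. F xs') = F xs"
  using assms(2) self_in_class[OF assms(1)] unfolding mem_class_iff[symmetric] by blast

lemma zero_tensor: "\<zero>\<^bsub>T\<^esub> = cls []"
  by (simp add: tensor_def)

lemma add_tensor:
  assumes "xs \<in> formal" "ys \<in> formal"
  shows "cls xs \<oplus>\<^sub>T cls ys = cls (xs @ ys)"
proof -
  have "(\<Union>ys'\<in>cls ys. cls (xs' @ ys')) = cls (xs' @ ys)" if "xs' \<in> formal" for xs'
    using that assms by (intro UN_class class_eqI tensor_rel.append tensor_rel.refl)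
      (auto intro: tensor_rel.sym)
  then have "cls xs \<oplus>\<^sub>T cls ys = (\<Union>xs'\<in>cls xs. cls (xs' @ ys))"
    by (auto simp: tensor_def mem_class_iff rel_lists)
  also have "\<dots> = cls (xs @ ys)"
    using assms by (intro UN_class class_eqI tensor_rel.append tensor_rel.refl)
      (auto intro: tensor_rel.sym)
  finally show ?thesis .
qed

lemma smult_tensor:
  assumes "r \<in> carrier R" "xs \<in> formal"
  shows "r \<odot>\<^sub>T cls xs = cls (map (\<lambda>(a, b). (r \<odot>\<^sub>M a, b)) xs)"
proof -
  have "(\<Union>xs'\<in>cls xs. cls (map (\<lambda>(a, b). (r \<odot>\<^sub>M a, b)) xs')) =
      cls (map (\<lambda>(a, b). (r \<odot>\<^sub>M a, b)) xs)"
    using assms tensor_rel_smult[OF M.module_axioms N.module_axioms assms(1)]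
    by (intro UN_class class_eqI) (auto intro: tensor_rel.sym)
  then show ?thesis
    by (simp add: tensor_def)
qed

lemma scaled_formal:
  "\<lbrakk>r \<in> carrier R; xs \<in> formal\<rbrakk> \<Longrightarrow> map (\<lambda>(a, b). (r \<odot>\<^sub>M a, b)) xs \<in> formal"
  by (induction xs) auto

lemma cls_Cons:
  assumes "x \<in> carrier M" "y \<in> carrier N" "xs \<in> formal"
  shows "cls ((x, y) # xs) = cls [(x, y)] \<oplus>\<^sub>T cls xs"
  using assms by (simp add: add_tensor)

lemma add_tensor_comm:
  "\<lbrakk>X \<in> carrier T; Y \<in> carrier T\<rbrakk> \<Longrightarrow> X \<oplus>\<^sub>T Y = Y \<oplus>\<^sub>T X"
  by (elim carrier_tensorE) (simp add: add_tensor class_eqI tensor_rel.commute)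

lemma abelian_monoid_tensor: "abelian_monoid T"
proof (rule abelian_monoidI)
  fix X Y Z assume "X \<in> carrier T" "Y \<in> carrier T" "Z \<in> carrier T"
  then show "X \<oplus>\<^sub>T Y \<oplus>\<^sub>T Z = X \<oplus>\<^sub>T (Y \<oplus>\<^sub>T Z)"
    by (elim carrier_tensorE) (simp add: add_tensor)
next
  show "\<zero>\<^bsub>T\<^esub> \<in> carrier T" by (simp add: zero_tensor)
  fix X assume X: "X \<in> carrier T"
  then show "\<zero>\<^bsub>T\<^esub> \<oplus>\<^sub>T X = X" by (elim carrier_tensorE) (simp add: zero_tensor add_tensor)
  fix Y assume "Y \<in> carrier T"
  with X show "X \<oplus>\<^sub>T Y \<in> carrier T" by (elim carrier_tensorE) (simp add: add_tensor)
  show "X \<oplus>\<^sub>T Y = Y \<oplus>\<^sub>T X" by (rule add_tensor_comm) fact+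
qed

lemma tensor_induct [consumes 1, case_names zero add pure]:
  assumes "X \<in> carrier T"
    and "Q \<zero>\<^bsub>T\<^esub>" "\<And>X Y. \<lbrakk>X \<in> carrier T; Y \<in> carrier T; Q X; Q Y\<rbrakk> \<Longrightarrow> Q (X \<oplus>\<^sub>T Y)"
    and "\<And>x y. \<lbrakk>x \<in> carrier M; y \<in> carrier N\<rbrakk> \<Longrightarrow> Q (cls [(x, y)])"
  shows "Q X"
proof -
  obtain xs where xs: "xs \<in> formal" "X = cls xs" using assms(1) by (rule carrier_tensorE)
  from xs(1) have "Q (cls xs)"
  proof (induction xs)
    case Nil then show ?case using assms(2) by (simp add: zero_tensor)
  next
    case (Cons p xs)
    obtain x y where p: "p = (x, y)" by (cases p)
    have xy: "x \<in> carrier M" "y \<in> carrier N" and l: "xs \<in> formal"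
      using Cons.hyps by (simp_all add: p)
    have "Q (cls [(x, y)] \<oplus>\<^sub>T cls xs)"
      by (rule assms(3)[OF _ _ assms(4)[OF xy] Cons.IH]) (use xy l in simp_all)
    then show ?case by (simp add: p cls_Cons[OF xy l])
  qed
  with xs show ?thesis by simp
qed

text \<open>Identities between module operations are checked on pure tensors. The generators of the
  congruence say nothing about negatives; the rule for zero gives \<open>0 X = 0\<close>, so \<open>(- 1) X\<close> is the
  negative of \<open>X\<close>.\<close>

lemma module_tensor: "module R T"
proof (rule moduleI)
  interpret T: abelian_monoid T by (rule abelian_monoid_tensor)
  show "cring R" by (rule M.R.is_cring)
  have smult_closed: "r \<odot>\<^sub>T X \<in> carrier T" if "r \<in> carrier R" "X \<in> carrier T" for r X
    using that(2) by (elim carrier_tensorE)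
      (simp add: smult_tensor that(1) class_in_carrier[OF scaled_formal] del: in_lists_conv_set)
  have smult_add: "r \<odot>\<^sub>T (X \<oplus>\<^sub>T Y) = r \<odot>\<^sub>T X \<oplus>\<^sub>T r \<odot>\<^sub>T Y"
    if "r \<in> carrier R" "X \<in> carrier T" "Y \<in> carrier T" for r X Y
    using that(2,3) by (elim carrier_tensorE)
      (simp add: smult_tensor scaled_formal add_tensor that(1) append_in_lists_conv del: in_lists_conv_set)
  have smult_zero: "r \<odot>\<^sub>T \<zero>\<^bsub>T\<^esub> = \<zero>\<^bsub>T\<^esub>" if "r \<in> carrier R" for r
    using that by (simp add: zero_tensor smult_tensor)
  have add_smult: "(r \<oplus> s) \<odot>\<^sub>T X = r \<odot>\<^sub>T X \<oplus>\<^sub>T s \<odot>\<^sub>T X"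
    if "r \<in> carrier R" "s \<in> carrier R" "X \<in> carrier T" for r s X
    using that(3)
  proof (induction rule: tensor_induct)
    case zero then show ?case using that by (simp add: smult_zero)
  next
    case (add X Y) then show ?case using that by (simp add: smult_add smult_closed T.a_ac)
  next
    case (pure x y) then show ?case using that
      by (simp add: smult_tensor add_tensor M.smult_l_distr class_eqI tensor_rel.add_left)
  qed
  have mult_smult: "(r \<otimes> s) \<odot>\<^sub>T X = r \<odot>\<^sub>T (s \<odot>\<^sub>T X)"
    if "r \<in> carrier R" "s \<in> carrier R" "X \<in> carrier T" for r s X
    using that(3)
    by (induction rule: tensor_induct)
      (use that in \<open>simp_all add: smult_zero smult_add smult_closed smult_tensor M.smult_assoc1\<close>)
  have one_smult: "\<one> \<odot>\<^sub>T X = X" if "X \<in> carrier T" for X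
    using that by (induction rule: tensor_induct)
      (simp_all add: smult_zero smult_add smult_closed smult_tensor)
  show "abelian_group T"
  proof (rule abelian_groupI)
    fix X assume X: "X \<in> carrier T"
    have "\<zero> \<odot>\<^sub>T X = \<zero>\<^bsub>T\<^esub>"
      using X
      by (induction rule: tensor_induct)
        (simp_all add: smult_zero smult_add smult_tensor zero_tensor[symmetric]
          tensor_rel.zero class_eqI[where ys = "[]"])
    then have "(\<ominus> \<one>) \<odot>\<^sub>T X \<oplus>\<^sub>T X = \<zero>\<^bsub>T\<^esub>"
      using add_smult[of "\<ominus> \<one>" \<one> X] X by (simp add: one_smult M.R.l_neg)
    then show "\<exists>Y\<in>carrier T. Y \<oplus>\<^sub>T X = \<zero>\<^bsub>T\<^esub>"
      using X smult_closed by (meson M.R.a_inv_closed M.R.one_closed)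
  qed (auto simp: T.a_ac T.a_closed)
  show "\<And>r X. \<lbrakk>r \<in> carrier R; X \<in> carrier T\<rbrakk> \<Longrightarrow> r \<odot>\<^sub>T X \<in> carrier T" by (rule smult_closed)
  show "\<And>r s X. \<lbrakk>r \<in> carrier R; s \<in> carrier R; X \<in> carrier T\<rbrakk> \<Longrightarrow>
      (r \<oplus> s) \<odot>\<^sub>T X = r \<odot>\<^sub>T X \<oplus>\<^sub>T s \<odot>\<^sub>T X" by (rule add_smult)
  show "\<And>r X Y. \<lbrakk>r \<in> carrier R; X \<in> carrier T; Y \<in> carrier T\<rbrakk> \<Longrightarrow>
      r \<odot>\<^sub>T (X \<oplus>\<^sub>T Y) = r \<odot>\<^sub>T X \<oplus>\<^sub>T r \<odot>\<^sub>T Y" by (rule smult_add)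
  show "\<And>r s X. \<lbrakk>r \<in> carrier R; s \<in> carrier R; X \<in> carrier T\<rbrakk> \<Longrightarrow>
      (r \<otimes> s) \<odot>\<^sub>T X = r \<odot>\<^sub>T (s \<odot>\<^sub>T X)" by (rule mult_smult)
  show "\<And>X. X \<in> carrier T \<Longrightarrow> \<one> \<odot>\<^sub>T X = X" by (rule one_smult)
qed

sublocale T: module R T
  by (rule module_tensor)

lemma bilinear_tens: "bilinear_map R M N T (tens R M N)"
proof (rule bilinear_mapI; rule linear_mapsI)
  fix r x y assume "r \<in> carrier R" "x \<in> carrier M" "y \<in> carrier N"
  then show "tens R M N x (r \<odot>\<^sub>N y) = r \<odot>\<^sub>T tens R M N x y"
    by (simp add: tens_def smult_tensor) (metis class_eqI tensor_rel.balanced)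
qed (simp_all add: tens_def add_tensor smult_tensor class_eqI tensor_rel.add_left tensor_rel.add_right)



lemma formal_sum_tens: "xs \<in> formal \<Longrightarrow> formal_sum T (tens R M N) xs = cls xs"
proof (induction xs)
  case Nil
  then show ?case by (simp add: zero_tensor)
next
  case (Cons p xs)
  obtain x y where p: "p = (x, y)" by (cases p)
  have xy: "x \<in> carrier M" "y \<in> carrier N" "xs \<in> formal" using Cons.prems by (simp_all add: p)
  have "formal_sum T (tens R M N) (p # xs) = cls [(x, y)] \<oplus>\<^sub>T formal_sum T (tens R M N) xs"
    unfolding p formal_sum_simps tens_def ..
  then show ?case
    unfolding Cons.IH[OF xy(3)] cls_Cons[OF xy, symmetric] p .
qed

lemma tensor_lift_class:
  assumes "module R P" "bilinear_map R M N P b" "xs \<in> formal"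
  shows "tensor_lift P b (cls xs) = formal_sum P b xs"
proof -
  have "formal_sum P b xs' = formal_sum P b xs" if "xs' \<in> cls xs" for xs'
    using tensor_rel_formal_sum[OF M.module_axioms N.module_axioms assms(1,2), of xs xs'] that
    by (simp only: mem_class_iff)
  then have "formal_sum P b ` cls xs = {formal_sum P b xs}"
    using self_in_class[OF assms(3)] by blast
  then show ?thesis
    unfolding tensor_lift_def formal_sum_def by simp
qed

lemma tensor_lift_tens:
  assumes "module R P" "bilinear_map R M N P b" "x \<in> carrier M" "y \<in> carrier N"
  shows "tensor_lift P b (tens R M N x y) = b x y"
proof -
  interpret P: module R P by fact
  show ?thesis
    using tensor_lift_class[OF assms(1,2), of "[(x, y)]"] assms(3,4) bilinear_mapD(3)[OF assms(2)]
    by (simp add: tens_def)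
qed

lemma linear_tensor_lift:
  assumes "module R P" "bilinear_map R M N P b"
  shows "tensor_lift P b \<in> linear_maps R T P"
proof -
  interpret P: module R P by fact
  note b = bilinear_mapD(3)[OF assms(2)]
  note lift = tensor_lift_class[OF assms]
  note closed = P.formal_sum_closed[where A = "carrier M" and B = "carrier N" and b = b, OF _ b]
  have smult: "formal_sum P (\<lambda>x y. b (r \<odot>\<^sub>M x) y) xs = r \<odot>\<^sub>P formal_sum P b xs"
    if r: "r \<in> carrier R" and xs: "xs \<in> formal" for r xs
  proof -
    have "formal_sum P (\<lambda>x y. b (r \<odot>\<^sub>M x) y) xs = formal_sum P (\<lambda>x y. r \<odot>\<^sub>P b x y) xs"
      by (rule formal_sum_cong[OF xs], rule linear_mapsD(3)[OF bilinear_mapD(1)[OF assms(2)] r])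
    also have "\<dots> = r \<odot>\<^sub>P formal_sum P b xs"
      by (rule linear_map_formal_sum[OF assms(1,1) linear_map_smult[OF assms(1) r] xs b, symmetric])
    finally show ?thesis .
  qed
  show ?thesis
  proof (rule linear_mapsI)
    fix X Y assume "X \<in> carrier T" "Y \<in> carrier T"
    then show "tensor_lift P b (X \<oplus>\<^sub>T Y) = tensor_lift P b X \<oplus>\<^sub>P tensor_lift P b Y"
      by (elim carrier_tensorE) (simp add: add_tensor lift
          P.formal_sum_append[where A = "carrier M" and B = "carrier N" and b = b, OF _ _ b])
  next
    fix r X assume "r \<in> carrier R" "X \<in> carrier T"
    then show "tensor_lift P b (r \<odot>\<^sub>T X) = r \<odot>\<^sub>P tensor_lift P b X"
      by (elim carrier_tensorE) (simp add: smult_tensor lift[OF scaled_formal] lift smult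
          formal_sum_map[where f = "\<lambda>x y. r \<odot>\<^sub>M x" and g = "\<lambda>x y. y"] del: in_lists_conv_set)
  next
    fix X assume "X \<in> carrier T"
    then show "tensor_lift P b X \<in> carrier P"
      by (elim carrier_tensorE) (simp add: lift closed)
  qed
qed

end


section \<open>Maps out of tensor products\<close>

text \<open>A lift depends linearly on the bilinear map that is lifted. With the linearity of a lift in the
  tensor this makes lifts of trilinear maps bilinear, so that lifts can be nested.\<close>

lemma linear_parametric_lift:
  assumes "module R M" "module R N" "module R L" "module R P" "X \<in> carrier (tensor R M N)"
    and f: "\<And>z. z \<in> carrier L \<Longrightarrow> bilinear_map R M N P (\<lambda>x y. f x y z)"
    and lin: "\<And>x y. \<lbrakk>x \<in> carrier M; y \<in> carrier N\<rbrakk> \<Longrightarrow> (\<lambda>z. f x y z) \<in> linear_maps R L P"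
  shows "(\<lambda>z. tensor_lift P (\<lambda>x y. f x y z) X) \<in> linear_maps R L P"
proof -
  interpret MN: two_modules R M N using assms(1,2) by (simp add: two_modules_def)
  interpret P: module R P by fact
  interpret L: module R L by fact
  obtain xs where xs: "xs \<in> lists (carrier M \<times> carrier N)" "X = tensor_class R M N xs"
    using assms(5) by (rule MN.carrier_tensorE)
  have lift: "tensor_lift P (\<lambda>x y. f x y z) X = formal_sum P (\<lambda>x y. f x y z) xs"
    if "z \<in> carrier L" for z
    using MN.tensor_lift_class[OF assms(4) f[OF that] xs(1)] xs(2) by simp
  have closed: "f x y z \<in> carrier P" if "x \<in> carrier M" "y \<in> carrier N" "z \<in> carrier L" for x y z
    using bilinear_mapD(3)[OF f[OF that(3)] that(1,2)] .
  show ?thesis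
  proof (rule linear_mapsI)
    fix z assume z: "z \<in> carrier L"
    show "tensor_lift P (\<lambda>x y. f x y z) X \<in> carrier P"
      unfolding lift[OF z] by (rule P.formal_sum_closed[OF xs(1) closed[OF _ _ z]])
    fix z' assume z': "z' \<in> carrier L"
    have "formal_sum P (\<lambda>x y. f x y (z \<oplus>\<^sub>L z')) xs =
        formal_sum P (\<lambda>x y. f x y z \<oplus>\<^sub>P f x y z') xs"
      by (rule formal_sum_cong[OF xs(1)], rule linear_mapsD(2)[OF lin z z'])
    also have "\<dots> = formal_sum P (\<lambda>x y. f x y z) xs \<oplus>\<^sub>P formal_sum P (\<lambda>x y. f x y z') xs"
      by (rule P.formal_sum_add[OF xs(1) closed[OF _ _ z] closed[OF _ _ z']])
    finally show "tensor_lift P (\<lambda>x y. f x y (z \<oplus>\<^sub>L z')) X =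
        tensor_lift P (\<lambda>x y. f x y z) X \<oplus>\<^sub>P tensor_lift P (\<lambda>x y. f x y z') X"
      unfolding lift[OF z] lift[OF z'] lift[OF L.M.add.m_closed[OF z z']] .
  next
    fix r z assume r: "r \<in> carrier R" and z: "z \<in> carrier L"
    have "formal_sum P (\<lambda>x y. f x y (r \<odot>\<^sub>L z)) xs = formal_sum P (\<lambda>x y. r \<odot>\<^sub>P f x y z) xs"
      by (rule formal_sum_cong[OF xs(1)], rule linear_mapsD(3)[OF lin r z])
    also have "\<dots> = r \<odot>\<^sub>P formal_sum P (\<lambda>x y. f x y z) xs"
      by (rule linear_map_formal_sum[OF assms(4,4) linear_map_smult[OF assms(4) r] xs(1)
            closed[OF _ _ z], symmetric])
    finally show "tensor_lift P (\<lambda>x y. f x y (r \<odot>\<^sub>L z)) X =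
        r \<odot>\<^sub>P tensor_lift P (\<lambda>x y. f x y z) X"
      unfolding lift[OF z] lift[OF L.smult_closed[OF r z]] .
  qed
qed

lemma bilinear_lift_left:
  assumes "module R L" "module R M" "module R N" "module R P" "trilinear_map R L M N P f"
  shows "bilinear_map R (tensor R L M) N P (\<lambda>X z. tensor_lift P (\<lambda>x y. f x y z) X)"
proof (rule bilinear_mapI)
  interpret LM: two_modules R L M using assms(1,2) by (simp add: two_modules_def)
  show "tensor_lift P (\<lambda>x y. f x y z) \<in> linear_maps R (tensor R L M) P" if "z \<in> carrier N" for z
    using LM.linear_tensor_lift[OF assms(4) trilinear_mapD(5)[OF assms(5) that]] .
  show "(\<lambda>z. tensor_lift P (\<lambda>x y. f x y z) X) \<in> linear_maps R N P"
    if "X \<in> carrier (tensor R L M)" for X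
    using linear_parametric_lift[OF assms(1,2,3,4) that trilinear_mapD(5)[OF assms(5)]
        trilinear_mapD(3)[OF assms(5)]] .
qed

lemma bilinear_lift_right:
  assumes "module R L" "module R M" "module R N" "module R P" "trilinear_map R L M N P f"
  shows "bilinear_map R L (tensor R M N) P (\<lambda>x Y. tensor_lift P (\<lambda>y z. f x y z) Y)"
proof (rule bilinear_mapI)
  interpret MN: two_modules R M N using assms(2,3) by (simp add: two_modules_def)
  show "tensor_lift P (\<lambda>y z. f x y z) \<in> linear_maps R (tensor R M N) P" if "x \<in> carrier L" for x
    using MN.linear_tensor_lift[OF assms(4) trilinear_mapD(6)[OF assms(5) that]] .
  show "(\<lambda>x. tensor_lift P (\<lambda>y z. f x y z) Y) \<in> linear_maps R L P"
    if "Y \<in> carrier (tensor R M N)" for Y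
    using linear_parametric_lift[OF assms(2,3,1,4) that, where f = "\<lambda>y z x. f x y z",
        OF trilinear_mapD(6)[OF assms(5)] trilinear_mapD(1)[OF assms(5)]] .
qed

lemma trilinear_tens_right:
  assumes "module R L" "module R M" "module R N"
  shows "trilinear_map R L M N (tensor R L (tensor R M N))
    (\<lambda>x y z. tens R L (tensor R M N) x (tens R M N y z))"
proof -
  interpret MN: two_modules R M N using assms(2,3) by (simp add: two_modules_def)
  interpret LMN: two_modules R L "tensor R M N"
    using assms(1) MN.module_tensor by (simp add: two_modules_def)
  note i = MN.bilinear_tens and o = LMN.bilinear_tens
  show ?thesis
    by (intro trilinear_mapI linear_map_comp[OF bilinear_mapD(2)[OF o] bilinear_mapD(1)[OF i]]
        linear_map_comp[OF bilinear_mapD(2)[OF o] bilinear_mapD(2)[OF i]]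
        bilinear_mapD(1)[OF o] bilinear_mapD(3)[OF i])
qed

lemma trilinear_tens_left:
  assumes "module R L" "module R M" "module R N"
  shows "trilinear_map R L M N (tensor R (tensor R L M) N)
    (\<lambda>x y z. tens R (tensor R L M) N (tens R L M x y) z)"
proof -
  interpret LM: two_modules R L M using assms(1,2) by (simp add: two_modules_def)
  interpret LMN: two_modules R "tensor R L M" N
    using assms(3) LM.module_tensor by (simp add: two_modules_def)
  note i = LM.bilinear_tens and o = LMN.bilinear_tens
  show ?thesis
    by (intro trilinear_mapI linear_map_comp[OF bilinear_mapD(1)[OF o] bilinear_mapD(1)[OF i]]
        linear_map_comp[OF bilinear_mapD(1)[OF o] bilinear_mapD(2)[OF i]]
        bilinear_mapD(2)[OF o] bilinear_mapD(3)[OF i])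
qed

context two_modules
begin

lemma linear_map_tensor_lift:
  assumes "module R P" "module R Q" "bilinear_map R M N P b" "g \<in> linear_maps R P Q"
    and "X \<in> carrier T"
  shows "g (tensor_lift P b X) = tensor_lift Q (\<lambda>x y. g (b x y)) X"
proof -
  obtain xs where xs: "xs \<in> formal" "X = cls xs" using assms(5) by (rule carrier_tensorE)
  have "bilinear_map R M N Q (\<lambda>x y. g (b x y))"
    by (intro bilinear_mapI linear_map_comp[OF assms(4)] bilinear_mapD[OF assms(3)])
  then show ?thesis
    using linear_map_formal_sum[OF assms(1,2,4) xs(1) bilinear_mapD(3)[OF assms(3)]]
    by (simp only: xs(2) tensor_lift_class[OF assms(1,3) xs(1)] tensor_lift_class[OF assms(2) _ xs(1)])
qed

lemma tensor_lift_cong: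
  assumes "module R P" "bilinear_map R M N P b" "X \<in> carrier T"
    and eq: "\<And>x y. \<lbrakk>x \<in> carrier M; y \<in> carrier N\<rbrakk> \<Longrightarrow> b x y = b' x y"
  shows "tensor_lift P b X = tensor_lift P b' X"
proof -
  obtain xs where xs: "xs \<in> formal" "X = cls xs" using assms(3) by (rule carrier_tensorE)
  have "bilinear_map R M N P b'"
    using bilinear_map_cong[OF M.module_axioms N.module_axioms assms(2) eq] .
  then show ?thesis
    using formal_sum_cong[OF xs(1) eq]
    by (simp only: xs(2) tensor_lift_class[OF assms(1,2) xs(1)] tensor_lift_class[OF assms(1) _ xs(1)])
qed

lemma bilinear_tens_flip: "bilinear_map R M N (tensor R N M) (\<lambda>x y. tens R N M y x)"
proof -
  interpret NM: two_modules R N M by unfold_locales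
  show ?thesis
    by (intro bilinear_mapI bilinear_mapD[OF NM.bilinear_tens])
qed

lemma tensor_lift_flip:
  assumes "module R P" "bilinear_map R N M P b" "X \<in> carrier T"
  shows "tensor_lift P b (tensor_flip R M N X) = tensor_lift P (\<lambda>x y. b y x) X"
proof -
  interpret NM: two_modules R N M by unfold_locales
  have "tensor_lift P b (tensor_flip R M N X) =
      tensor_lift P (\<lambda>x y. tensor_lift P b (tens R N M y x)) X"
    unfolding tensor_flip_def
    by (rule linear_map_tensor_lift[OF NM.module_tensor assms(1) bilinear_tens_flip
          NM.linear_tensor_lift[OF assms(1,2)] assms(3)])
  also have "\<dots> = tensor_lift P (\<lambda>x y. b y x) X"
  proof -
    have "bilinear_map R M N P (\<lambda>x y. b y x)"
      by (intro bilinear_mapI bilinear_mapD[OF assms(2)])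
    moreover have "b y x = tensor_lift P b (tens R N M y x)"
      if "x \<in> carrier M" "y \<in> carrier N" for x y
      using NM.tensor_lift_tens[OF assms(1,2) that(2,1)] by simp
    ultimately show ?thesis
      by (rule tensor_lift_cong[OF assms(1) _ assms(3), symmetric])
  qed
  finally show ?thesis .
qed

end


section \<open>Sweedler notation\<close>

text \<open>Sweedler sums are evaluated on a chosen representing formal sum instead of by
  \<^const>\<open>tensor_lift\<close>, so that congruence, interchange of sums and linearity hold for arbitrary
  summands. Only the laws that change the element, such as coassociativity, require
  multilinear summands.\<close>

definition sweedler_rep ::
  "('k, 'c) ring_scheme \<Rightarrow> ('k, 'h, 'd) module_scheme \<Rightarrow> ('h \<Rightarrow> ('h \<times> 'h) list set) \<Rightarrow> 'h \<Rightarrow>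
    ('h \<times> 'h) list"
where
  "sweedler_rep R C \<Delta> c =
    (SOME xs. xs \<in> lists (carrier C \<times> carrier C) \<and> \<Delta> c = tensor_class R C C xs)"

definition sweedler ::
  "('k, 'c) ring_scheme \<Rightarrow> ('k, 'h, 'd) module_scheme \<Rightarrow> ('h \<Rightarrow> ('h \<times> 'h) list set) \<Rightarrow>
    ('k, 'p, 'f) module_scheme \<Rightarrow> ('h \<Rightarrow> 'h \<Rightarrow> 'p) \<Rightarrow> 'h \<Rightarrow> 'p"
where
  "sweedler R C \<Delta> P b c = formal_sum P b (sweedler_rep R C \<Delta> c)"

text \<open>This lemma and \<open>tensor_map_comult\<close> below bring the two sides of coassociativity into the form of
  nested lifts along the comultiplication, on which trilinear maps can be evaluated.\<close>

lemma tensor_assoc_comult: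
  assumes "module R C" "\<Delta> \<in> linear_maps R C (tensor R C C)" "X \<in> carrier (tensor R C C)"
  defines "T \<equiv> tensor R C (tensor R C C)"
  shows "tensor_assoc R C C C (tensor_map R (tensor R C C) C \<Delta> (\<lambda>x. x) X) =
    tensor_lift T (\<lambda>a b. tensor_lift T (\<lambda>x y. tens R C (tensor R C C) x (tens R C C y b)) (\<Delta> a)) X"
proof -
  interpret CC: two_modules R C C using assms(1) by (simp add: two_modules_def)
  interpret TL: two_modules R "tensor R C C" C
    using assms(1) CC.module_tensor by (simp add: two_modules_def)
  interpret TR: two_modules R C "tensor R C C"
    using assms(1) CC.module_tensor by (simp add: two_modules_def)
  note mT = TR.module_tensor[folded T_def]
  let ?g = "\<lambda>X z. tensor_lift T (\<lambda>x y. tens R C (tensor R C C) x (tens R C C y z)) X"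
  have bg: "bilinear_map R (tensor R C C) C T ?g"
    using bilinear_lift_left[OF assms(1,1,1) mT trilinear_tens_right[OF assms(1,1,1), folded T_def]] .
  note lg = TL.linear_tensor_lift[OF mT bg]
  have bt: "bilinear_map R C C TL.T (\<lambda>x y. tens R (tensor R C C) C (\<Delta> x) y)"
    by (rule bilinear_map_comp[OF TL.bilinear_tens assms(2) linear_map_id])
  have "tensor_assoc R C C C (tensor_map R (tensor R C C) C \<Delta> (\<lambda>x. x) X) =
      tensor_lift T (\<lambda>x y. tensor_lift T ?g (tens R (tensor R C C) C (\<Delta> x) y)) X"
    unfolding tensor_assoc_def tensor_map_def Let_def T_def[symmetric]
    by (rule CC.linear_map_tensor_lift[OF TL.module_tensor mT bt lg assms(3)])
  also have "\<dots> = tensor_lift T (\<lambda>x y. ?g (\<Delta> x) y) X"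
  proof (rule CC.tensor_lift_cong[OF mT _ assms(3)])
    show "bilinear_map R C C T (\<lambda>x y. tensor_lift T ?g (tens R (tensor R C C) C (\<Delta> x) y))"
      by (intro bilinear_mapI linear_map_comp[OF lg] bilinear_mapD[OF bt])
    show "tensor_lift T ?g (tens R (tensor R C C) C (\<Delta> x) y) = ?g (\<Delta> x) y"
      if "x \<in> carrier C" "y \<in> carrier C" for x y
      by (rule TL.tensor_lift_tens[OF mT bg linear_mapsD(1)[OF assms(2) that(1)] that(2)])
  qed
  finally show ?thesis .
qed

lemma tens_tensor_lift:
  assumes "module R L" "module R M" "module R N" "x \<in> carrier L" "Y \<in> carrier (tensor R M N)"
  shows "tens R L (tensor R M N) x Y =
    tensor_lift (tensor R L (tensor R M N))
      (\<lambda>y z. tens R L (tensor R M N) x (tens R M N y z)) Y"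
proof -
  interpret MN: two_modules R M N using assms(2,3) by (simp add: two_modules_def)
  interpret LMN: two_modules R L "tensor R M N"
    using assms(1) MN.module_tensor by (simp add: two_modules_def)
  have "Y = tensor_lift MN.T (tens R M N) Y"
    using assms(5)
    by (elim MN.carrier_tensorE)
      (simp only: MN.tensor_lift_class[OF MN.module_tensor MN.bilinear_tens] MN.formal_sum_tens)
  then show ?thesis
    using MN.linear_map_tensor_lift[OF MN.module_tensor LMN.module_tensor MN.bilinear_tens
        bilinear_mapD(2)[OF LMN.bilinear_tens assms(4)] assms(5)]
    by simp
qed

lemma tensor_map_comult:
  assumes "module R C" "\<Delta> \<in> linear_maps R C (tensor R C C)" "X \<in> carrier (tensor R C C)"
  defines "T \<equiv> tensor R C (tensor R C C)"
  shows "tensor_map R C (tensor R C C) (\<lambda>x. x) \<Delta> X =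
    tensor_lift T (\<lambda>a b. tensor_lift T (\<lambda>x y. tens R C (tensor R C C) a (tens R C C x y)) (\<Delta> b)) X"
proof -
  interpret CC: two_modules R C C using assms(1) by (simp add: two_modules_def)
  interpret TR: two_modules R C "tensor R C C"
    using assms(1) CC.module_tensor by (simp add: two_modules_def)
  show ?thesis
    unfolding tensor_map_def T_def
    by (rule CC.tensor_lift_cong[OF TR.module_tensor
          bilinear_map_comp[OF TR.bilinear_tens linear_map_id assms(2)] assms(3)])
      (rule tens_tensor_lift[OF assms(1,1,1) _ linear_mapsD(1)[OF assms(2)]])
qed

lemma bilinear_lift_comult_left:
  assumes "module R C" "module R P" "\<Delta> \<in> linear_maps R C (tensor R C C)"
    and "trilinear_map R C C C P f"
  shows "bilinear_map R C C P (\<lambda>a b. tensor_lift P (\<lambda>x y. f x y b) (\<Delta> a))"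
  by (rule bilinear_map_comp[OF bilinear_lift_left[OF assms(1,1,1,2,4)] assms(3) linear_map_id])

lemma bilinear_lift_comult_right:
  assumes "module R C" "module R P" "\<Delta> \<in> linear_maps R C (tensor R C C)"
    and "trilinear_map R C C C P f"
  shows "bilinear_map R C C P (\<lambda>a b. tensor_lift P (\<lambda>x y. f a x y) (\<Delta> b))"
  by (rule bilinear_map_comp[OF bilinear_lift_right[OF assms(1,1,1,2,4)] linear_map_id assms(3)])

sublocale coalgebra \<subseteq> CC: two_modules R C C
  by unfold_locales

context coalgebra
begin

abbreviation sw :: "('a, 'p, 'f) module_scheme \<Rightarrow> ('b \<Rightarrow> 'b \<Rightarrow> 'p) \<Rightarrow> 'b \<Rightarrow> 'p" where
  "sw \<equiv> sweedler R C \<Delta>"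

lemma comult_closed: "c \<in> carrier C \<Longrightarrow> \<Delta> c \<in> carrier (tensor R C C)"
  by (rule linear_mapsD(1)[OF comult_linear])

lemma counit_closed [simp]: "c \<in> carrier C \<Longrightarrow> \<epsilon> c \<in> carrier R"
  using linear_mapsD(1)[OF counit_linear] by (simp add: regular_module_def)

lemma counit_add: "\<lbrakk>c \<in> carrier C; d \<in> carrier C\<rbrakk> \<Longrightarrow> \<epsilon> (c \<oplus>\<^sub>C d) = \<epsilon> c \<oplus> \<epsilon> d"
  using linear_mapsD(2)[OF counit_linear] by (simp add: regular_module_def)

lemma counit_smult: "\<lbrakk>r \<in> carrier R; c \<in> carrier C\<rbrakk> \<Longrightarrow> \<epsilon> (r \<odot>\<^sub>C c) = r \<otimes> \<epsilon> c"
  using linear_mapsD(3)[OF counit_linear] by (simp add: regular_module_def)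

lemma sweedler_rep:
  assumes "c \<in> carrier C"
  shows "sweedler_rep R C \<Delta> c \<in> CC.formal" "\<Delta> c = CC.cls (sweedler_rep R C \<Delta> c)"
proof -
  have "\<exists>xs. xs \<in> CC.formal \<and> \<Delta> c = CC.cls xs"
    using comult_closed[OF assms] by (rule CC.carrier_tensorE) blast
  from someI_ex[OF this]
  show "sweedler_rep R C \<Delta> c \<in> CC.formal" "\<Delta> c = CC.cls (sweedler_rep R C \<Delta> c)"
    by (simp_all only: sweedler_rep_def)
qed

lemma tensor_lift_comult:
  "\<lbrakk>module R P; bilinear_map R C C P b; c \<in> carrier C\<rbrakk> \<Longrightarrow> tensor_lift P b (\<Delta> c) = sw P b c"
  using CC.tensor_lift_class[OF _ _ sweedler_rep(1)] sweedler_rep(2)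
  by (simp only: sweedler_def)

lemma sw_cong:
  assumes "c \<in> carrier C" "\<And>x y. \<lbrakk>x \<in> carrier C; y \<in> carrier C\<rbrakk> \<Longrightarrow> b x y = b' x y"
  shows "sw P b c = sw P b' c"
  unfolding sweedler_def by (rule formal_sum_cong[OF sweedler_rep(1)[OF assms(1)] assms(2)])

lemma sw_closed:
  assumes "module R P" "c \<in> carrier C"
    and "\<And>x y. \<lbrakk>x \<in> carrier C; y \<in> carrier C\<rbrakk> \<Longrightarrow> b x y \<in> carrier P"
  shows "sw P b c \<in> carrier P"
proof -
  interpret P: module R P by fact
  show ?thesis
    unfolding sweedler_def by (rule P.formal_sum_closed[OF sweedler_rep(1)[OF assms(2)] assms(3)])
qed

lemma sw_swap:
  assumes "module R P" "c \<in> carrier C" "d \<in> carrier C"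
    and "\<And>x y z w. \<lbrakk>x \<in> carrier C; y \<in> carrier C; z \<in> carrier C; w \<in> carrier C\<rbrakk>
      \<Longrightarrow> f x y z w \<in> carrier P"
  shows "sw P (\<lambda>x y. sw P (\<lambda>z w. f x y z w) d) c = sw P (\<lambda>z w. sw P (\<lambda>x y. f x y z w) c) d"
proof -
  interpret P: module R P by fact
  show ?thesis
    unfolding sweedler_def
    by (rule P.formal_sum_swap[OF sweedler_rep(1)[OF assms(2)] sweedler_rep(1)[OF assms(3)] assms(4)])
qed

lemma linear_map_sw:
  assumes "module R N" "module R P" "g \<in> linear_maps R N P" "c \<in> carrier C"
    and "\<And>x y. \<lbrakk>x \<in> carrier C; y \<in> carrier C\<rbrakk> \<Longrightarrow> b x y \<in> carrier N"
  shows "g (sw N b c) = sw P (\<lambda>x y. g (b x y)) c"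
  unfolding sweedler_def by (rule linear_map_formal_sum[OF assms(1-3) sweedler_rep(1)[OF assms(4)] assms(5)])

lemma smult_sw:
  assumes "module R P" "r \<in> carrier R" "c \<in> carrier C"
    and "\<And>x y. \<lbrakk>x \<in> carrier C; y \<in> carrier C\<rbrakk> \<Longrightarrow> b x y \<in> carrier P"
  shows "sw P (\<lambda>x y. r \<odot>\<^sub>P b x y) c = r \<odot>\<^sub>P sw P b c"
  by (rule linear_map_sw[OF assms(1,1) linear_map_smult[OF assms(1,2)] assms(3,4), symmetric])

lemma linear_sw:
  assumes "module R M" "module R P" "bilinear_map R C C P b" "g \<in> linear_maps R M C"
  shows "(\<lambda>x. sw P b (g x)) \<in> linear_maps R M P"
  using linear_map_comp[OF linear_map_comp[OF CC.linear_tensor_lift[OF assms(2,3)] comult_linear] assms(4)]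
  by (rule linear_map_cong[OF assms(1)])
    (rule tensor_lift_comult[OF assms(2,3) linear_mapsD(1)[OF assms(4)]])

lemma linear_sw_param:
  assumes "module R M" "module R P" "c \<in> carrier C"
    and f: "\<And>a b. \<lbrakk>a \<in> carrier C; b \<in> carrier C\<rbrakk> \<Longrightarrow> (\<lambda>x. f x a b) \<in> linear_maps R M P"
  shows "(\<lambda>x. sw P (f x) c) \<in> linear_maps R M P"
proof -
  interpret M: module R M by fact
  interpret P: module R P by fact
  note rep = sweedler_rep(1)[OF assms(3)]
  note closed = linear_mapsD(1)[OF f]
  show ?thesis
  proof (rule linear_mapsI)
    fix x assume x: "x \<in> carrier M"
    show "sw P (f x) c \<in> carrier P"
      by (rule sw_closed[OF assms(2,3)]) (rule closed[OF _ _ x])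
    fix y assume y: "y \<in> carrier M"
    have "sw P (f (x \<oplus>\<^sub>M y)) c = sw P (\<lambda>a b. f x a b \<oplus>\<^sub>P f y a b) c"
      by (rule sw_cong[OF assms(3)]) (rule linear_mapsD(2)[OF f x y])
    also have "\<dots> = sw P (f x) c \<oplus>\<^sub>P sw P (f y) c"
      unfolding sweedler_def by (rule P.formal_sum_add[OF rep]) (rule closed[OF _ _ x] closed[OF _ _ y]; assumption)+
    finally show "sw P (f (x \<oplus>\<^sub>M y)) c = sw P (f x) c \<oplus>\<^sub>P sw P (f y) c" .
  next
    fix r x assume r: "r \<in> carrier R" and x: "x \<in> carrier M"
    have "sw P (f (r \<odot>\<^sub>M x)) c = sw P (\<lambda>a b. r \<odot>\<^sub>P f x a b) c"
      by (rule sw_cong[OF assms(3)]) (rule linear_mapsD(3)[OF f r x])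
    also have "\<dots> = r \<odot>\<^sub>P sw P (f x) c"
      by (rule smult_sw[OF assms(2) r assms(3)]) (rule closed[OF _ _ x])
    finally show "sw P (f (r \<odot>\<^sub>M x)) c = r \<odot>\<^sub>P sw P (f x) c" .
  qed
qed

lemma linear_counit:
  assumes "module R M" "module R P" "v \<in> carrier P" "g \<in> linear_maps R M C"
  shows "(\<lambda>x. \<epsilon> (g x) \<odot>\<^sub>P v) \<in> linear_maps R M P"
proof -
  interpret M: module R M by fact
  interpret P: module R P by fact
  show ?thesis
    by (rule linear_mapsI)
      (simp_all add: linear_mapsD[OF assms(4)] assms(3) counit_add counit_smult
        P.smult_l_distr P.smult_assoc1)
qed

lemma linear_smult:
  assumes "module R P" "r \<in> carrier R" "g \<in> linear_maps R M P"
  shows "(\<lambda>x. r \<odot>\<^sub>P g x) \<in> linear_maps R M P"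
  by (rule linear_map_comp[OF linear_map_smult[OF assms(1,2)] assms(3)])

lemma lift_lift_left_eq_sw:
  assumes "module R P" "trilinear_map R C C C P f" "c \<in> carrier C"
  shows "tensor_lift P (\<lambda>a b. tensor_lift P (\<lambda>x y. f x y b) (\<Delta> a)) (\<Delta> c) =
    sw P (\<lambda>a b. sw P (\<lambda>x y. f x y b) a) c"
  unfolding tensor_lift_comult[OF assms(1) bilinear_lift_comult_left[OF module_axioms assms(1)
      comult_linear assms(2)] assms(3)]
  by (rule sw_cong[OF assms(3)], rule tensor_lift_comult[OF assms(1) trilinear_mapD(5)[OF assms(2)]])

lemma lift_lift_right_eq_sw:
  assumes "module R P" "trilinear_map R C C C P f" "c \<in> carrier C"
  shows "tensor_lift P (\<lambda>a b. tensor_lift P (\<lambda>x y. f a x y) (\<Delta> b)) (\<Delta> c) =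
    sw P (\<lambda>a b. sw P (\<lambda>x y. f a x y) b) c"
  unfolding tensor_lift_comult[OF assms(1) bilinear_lift_comult_right[OF module_axioms assms(1)
      comult_linear assms(2)] assms(3)]
  by (rule sw_cong[OF assms(3)], rule tensor_lift_comult[OF assms(1) trilinear_mapD(6)[OF assms(2)]])

lemma linear_map_sw_sw:
  assumes "module R N" "module R P" "F \<in> linear_maps R N P" "x \<in> carrier C"
    and g: "\<And>a b u v. \<lbrakk>a \<in> carrier C; b \<in> carrier C; u \<in> carrier C; v \<in> carrier C\<rbrakk>
      \<Longrightarrow> g a b u v \<in> carrier N \<and> F (g a b u v) = g' a b u v"
    and c: "\<And>a b. \<lbrakk>a \<in> carrier C; b \<in> carrier C\<rbrakk> \<Longrightarrow> c a b \<in> carrier C"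
  shows "F (sw N (\<lambda>a b. sw N (g a b) (c a b)) x) = sw P (\<lambda>a b. sw P (g' a b) (c a b)) x"
proof -
  have "F (sw N (\<lambda>a b. sw N (g a b) (c a b)) x) = sw P (\<lambda>a b. F (sw N (g a b) (c a b))) x"
    by (rule linear_map_sw[OF assms(1-4)]) (intro sw_closed[OF assms(1)] c, simp_all add: g)
  also have "\<dots> = sw P (\<lambda>a b. sw P (\<lambda>u v. F (g a b u v)) (c a b)) x"
    by (rule sw_cong[OF assms(4)], rule linear_map_sw[OF assms(1-3)]) (simp_all add: g c)
  also have "\<dots> = sw P (\<lambda>a b. sw P (g' a b) (c a b)) x"
    by (rule sw_cong[OF assms(4)], rule sw_cong[OF c]) (simp_all add: g)
  finally show ?thesis .
qed

text \<open>Coassociativity is an equation in \<open>C \<otimes> (C \<otimes> C)\<close>, and every trilinear map factors through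
  \<open>(x, y, z) \<mapsto> x \<otimes> (y \<otimes> z)\<close>.\<close>

lemma sw_coassoc:
  assumes "module R P" "trilinear_map R C C C P f" "c \<in> carrier C"
  shows "sw P (\<lambda>a b. sw P (\<lambda>x y. f x y b) a) c = sw P (\<lambda>a b. sw P (\<lambda>x y. f a x y) b) c"
proof -
  interpret TR: two_modules R C "tensor R C C"
    by (rule two_modules.intro) unfold_locales
  note mC = module_axioms and mT = TR.module_tensor
  let ?t = "\<lambda>x y z. tens R C (tensor R C C) x (tens R C C y z)"
  let ?b = "\<lambda>x Y. tensor_lift P (\<lambda>y z. f x y z) Y"
  let ?F = "tensor_lift P ?b"
  have b: "bilinear_map R C (tensor R C C) P ?b"
    by (rule bilinear_lift_right[OF mC mC mC assms(1,2)])
  have F: "?F \<in> linear_maps R TR.T P"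
    by (rule TR.linear_tensor_lift[OF assms(1) b])
  have Ft: "?F (?t x y z) = f x y z" if "x \<in> carrier C" "y \<in> carrier C" "z \<in> carrier C" for x y z
    by (simp only: TR.tensor_lift_tens[OF assms(1) b that(1) bilinear_mapD(3)[OF CC.bilinear_tens that(2,3)]]
        CC.tensor_lift_tens[OF assms(1) trilinear_mapD(6)[OF assms(2) that(1)] that(2,3)])
  note t = trilinear_tens_right[OF mC mC mC] and X = comult_closed[OF assms(3)]
  have "sw TR.T (\<lambda>a b. sw TR.T (\<lambda>x y. ?t x y b) a) c = sw TR.T (\<lambda>a b. sw TR.T (\<lambda>x y. ?t a x y) b) c"
    using coassoc[OF assms(3)]
    by (simp only: tensor_assoc_comult[OF mC comult_linear X] tensor_map_comult[OF mC comult_linear X]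
        lift_lift_left_eq_sw[OF mT t assms(3)] lift_lift_right_eq_sw[OF mT t assms(3)])
  then have "?F (sw TR.T (\<lambda>a b. sw TR.T (\<lambda>x y. ?t x y b) a) c) =
      ?F (sw TR.T (\<lambda>a b. sw TR.T (\<lambda>x y. ?t a x y) b) c)"
    by simp
  then show ?thesis
    using linear_map_sw_sw[OF mT assms(1) F assms(3), of "\<lambda>a b x y. ?t x y b" "\<lambda>a b x y. f x y b" "\<lambda>a b. a"]
      linear_map_sw_sw[OF mT assms(1) F assms(3), of "\<lambda>a b x y. ?t a x y" "\<lambda>a b x y. f a x y" "\<lambda>a b. b"]
    by (simp add: Ft trilinear_mapD(4)[OF t])
qed

lemma sw_counit_left:
  assumes "module R P" "g \<in> linear_maps R C P" "c \<in> carrier C"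
  shows "sw P (\<lambda>x y. \<epsilon> x \<odot>\<^sub>P g y) c = g c"
proof -
  note mC = module_axioms
  have b: "bilinear_map R C C C (\<lambda>x y. \<epsilon> x \<odot>\<^sub>C y)"
    by (intro bilinear_mapI linear_counit[OF mC mC] linear_smult[OF mC] linear_map_id) simp_all
  have "c = sw C (\<lambda>x y. \<epsilon> x \<odot>\<^sub>C y) c"
    using counit_left[OF assms(3)] by (simp only: tensor_lift_comult[OF mC b assms(3)])
  then have "g c = g (sw C (\<lambda>x y. \<epsilon> x \<odot>\<^sub>C y) c)" by simp
  also have "\<dots> = sw P (\<lambda>x y. g (\<epsilon> x \<odot>\<^sub>C y)) c"
    by (rule linear_map_sw[OF mC assms(1,2,3)]) simp
  also have "\<dots> = sw P (\<lambda>x y. \<epsilon> x \<odot>\<^sub>P g y) c"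
    by (rule sw_cong[OF assms(3)]) (rule linear_mapsD(3)[OF assms(2)]; simp)
  finally show ?thesis ..
qed

lemma sw_counit_right:
  assumes "module R P" "g \<in> linear_maps R C P" "c \<in> carrier C"
  shows "sw P (\<lambda>x y. \<epsilon> y \<odot>\<^sub>P g x) c = g c"
proof -
  note mC = module_axioms
  have b: "bilinear_map R C C C (\<lambda>x y. \<epsilon> y \<odot>\<^sub>C x)"
    by (intro bilinear_mapI linear_counit[OF mC mC] linear_smult[OF mC] linear_map_id) simp_all
  have "c = sw C (\<lambda>x y. \<epsilon> y \<odot>\<^sub>C x) c"
    using counit_right[OF assms(3)] by (simp only: tensor_lift_comult[OF mC b assms(3)])
  then have "g c = g (sw C (\<lambda>x y. \<epsilon> y \<odot>\<^sub>C x) c)" by simp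
  also have "\<dots> = sw P (\<lambda>x y. g (\<epsilon> y \<odot>\<^sub>C x)) c"
    by (rule linear_map_sw[OF mC assms(1,2,3)]) simp
  also have "\<dots> = sw P (\<lambda>x y. \<epsilon> y \<odot>\<^sub>P g x) c"
    by (rule sw_cong[OF assms(3)]) (rule linear_mapsD(3)[OF assms(2)]; simp)
  finally show ?thesis ..
qed

end


section \<open>The opposite and the co-opposite\<close>

text \<open>The tensor product as a module and all lifts depend only on the part of the records that is
  compared here, so they do not change when an algebra is replaced by its opposite.\<close>

definition same_module ::
  "('k, 'm, 'd) module_scheme \<Rightarrow> ('k, 'm, 'e) module_scheme \<Rightarrow> bool"
where
  "same_module M M' \<longleftrightarrow> carrier M = carrier M' \<and> add M = add M' \<and> zero M = zero M' \<and> smult M = smult M'"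

lemma tensor_rel_mono:
  assumes "same_module M M'" "same_module N N'" "(xs, ys) \<in> tensor_rel R M N"
  shows "(xs, ys) \<in> tensor_rel R M' N'"
proof -
  have eqs: "carrier M = carrier M'" "add M = add M'" "zero M = zero M'" "smult M = smult M'"
    "carrier N = carrier N'" "add N = add N'" "zero N = zero N'" "smult N = smult N'"
    using assms(1,2) by (auto simp: same_module_def)
  show ?thesis using assms(3)
  proof (induction rule: tensor_rel.induct)
    case (refl xs) then show ?case by (simp only: eqs tensor_rel.refl)
  next
    case (sym xs ys) from sym.IH show ?case by (rule tensor_rel.sym)
  next
    case (trans xs ys zs) from trans.IH show ?case by (rule tensor_rel.trans)
  next
    case (append xs xs' ys ys') from append.IH show ?case by (rule tensor_rel.append)
  next
    case (commute xs ys) then show ?case by (simp only: eqs tensor_rel.commute)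
  next
    case (add_left x x' y) then show ?case by (simp only: eqs tensor_rel.add_left)
  next
    case (add_right x y y') then show ?case by (simp only: eqs tensor_rel.add_right)
  next
    case (balanced r x y) then show ?case by (simp only: eqs tensor_rel.balanced)
  next
    case (zero y) then show ?case by (simp only: eqs tensor_rel.zero)
  qed
qed

lemma same_module_sym: "same_module M M' \<Longrightarrow> same_module M' M"
  by (simp add: same_module_def)

lemma tensor_rel_cong:
  assumes "same_module M M'" "same_module N N'"
  shows "tensor_rel R M N = tensor_rel R M' N'"
  using tensor_rel_mono[OF assms] tensor_rel_mono[OF assms[THEN same_module_sym]] by auto

lemma tensor_class_cong:
  assumes "same_module M M'" "same_module N N'"
  shows "tensor_class R M N = tensor_class R M' N'"
  by (simp add: fun_eq_iff tensor_class_def tensor_rel_cong[OF assms])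

lemma tens_cong:
  assumes "same_module M M'" "same_module N N'"
  shows "tens R M N = tens R M' N'"
  by (simp add: fun_eq_iff tens_def tensor_class_cong[OF assms])

lemma same_module_tensor:
  assumes "same_module M M'" "same_module N N'"
  shows "same_module (tensor R M N) (tensor R M' N')"
  using assms unfolding same_module_def
  by (simp add: tensor_def tensor_class_cong[OF assms] tensor_rel_cong[OF assms])

lemma formal_sum_target_cong:
  "same_module P P' \<Longrightarrow> formal_sum P b xs = formal_sum P' b xs"
  by (induction xs) (auto simp: same_module_def)

lemma tensor_lift_target_cong: "same_module P P' \<Longrightarrow> tensor_lift P = tensor_lift P'"
  by (simp add: fun_eq_iff tensor_lift_def same_module_def)

lemma linear_maps_cong:
  "\<lbrakk>same_module M M'; same_module N N'\<rbrakk> \<Longrightarrow> linear_maps R M N = linear_maps R M' N'"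
  by (simp add: linear_maps_def same_module_def)

definition opposite :: "('k, 'h, 'd) module_scheme \<Rightarrow> ('k, 'h, 'd) module_scheme" where
  "opposite H = H\<lparr>mult := \<lambda>x y. mult H y x\<rparr>"

lemma opposite_simps [simp]:
  "carrier (opposite H) = carrier H" "add (opposite H) = add H" "zero (opposite H) = zero H"
  "smult (opposite H) = smult H" "one (opposite H) = one H" "mult (opposite H) x y = mult H y x"
  by (simp_all add: opposite_def)

lemma same_module_opposite: "same_module (opposite H) H"
  by (simp add: same_module_def)

lemma coalgebra_opposite:
  assumes "coalgebra R C \<Delta> \<epsilon>"
  shows "coalgebra R (opposite C) \<Delta> \<epsilon>"
proof -
  interpret C: coalgebra R C \<Delta> \<epsilon> by fact
  let ?O = "opposite C"
  note O = same_module_opposite[of C]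
  note TO = same_module_tensor[OF O O] and TTO = same_module_tensor[OF O same_module_tensor[OF O O]]
    and TOT = same_module_tensor[OF same_module_tensor[OF O O] O]
  have "module R ?O"
    by (rule moduleI)
      (auto intro!: C.R.is_cring abelian_groupI C.M.a_assoc C.M.a_comm C.M.l_neg
        C.smult_l_distr C.smult_r_distr C.smult_assoc1)
  moreover have "\<Delta> \<in> linear_maps R ?O (tensor R ?O ?O)"
    using C.comult_linear by (simp add: linear_maps_cong[OF O TO])
  moreover have "\<epsilon> \<in> linear_maps R ?O (regular_module R)"
    using C.counit_linear by (simp add: linear_maps_def)
  moreover have "tensor_assoc R ?O ?O ?O (tensor_map R (tensor R ?O ?O) ?O \<Delta> (\<lambda>x. x) (\<Delta> c)) =
      tensor_map R ?O (tensor R ?O ?O) (\<lambda>x. x) \<Delta> (\<Delta> c)" if "c \<in> carrier C" for c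
    using C.coassoc[OF that]
    by (simp only: tensor_assoc_def tensor_map_def Let_def tens_cong[OF TO O] tens_cong[OF O TO]
        tens_cong[OF O O] tensor_lift_target_cong[OF TTO] tensor_lift_target_cong[OF TOT])
  ultimately show ?thesis
    using C.counit_left C.counit_right
    by (auto intro!: coalgebra.intro coalgebra_axioms.intro simp: tensor_lift_target_cong[OF O])
qed

definition coopposite ::
  "('k, 'c) ring_scheme \<Rightarrow> ('k, 'h, 'd) module_scheme \<Rightarrow> ('h \<Rightarrow> ('h \<times> 'h) list set) \<Rightarrow>
    'h \<Rightarrow> ('h \<times> 'h) list set"
where
  "coopposite R H \<Delta> = (\<lambda>h. tensor_flip R H H (\<Delta> h))"

text \<open>Coassociativity of the flipped comultiplication is that of \<open>\<Delta>\<close> read backwards: it is the image of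
  the latter under the trilinear map \<open>(x, y, z) \<mapsto> z \<otimes> (y \<otimes> x)\<close>.\<close>

lemma coalgebra_coopposite:
  assumes "coalgebra R C \<Delta> \<epsilon>"
  shows "coalgebra R C (coopposite R C \<Delta>) \<epsilon>"
proof -
  interpret C: coalgebra R C \<Delta> \<epsilon> by fact
  note mC = C.module_axioms
  interpret TR: two_modules R C "tensor R C C"
    by (rule two_modules.intro) unfold_locales
  note mT = TR.module_tensor
  let ?T = "tensor R C (tensor R C C)"
  let ?D = "\<lambda>c. tensor_flip R C C (\<Delta> c)"
  have lin: "?D \<in> linear_maps R C (tensor R C C)"
    unfolding tensor_flip_def
    by (rule linear_map_comp[OF C.CC.linear_tensor_lift[OF C.CC.module_tensor C.CC.bilinear_tens_flip]
          C.comult_linear])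
  let ?t = "\<lambda>x y z. tens R C (tensor R C C) x (tens R C C y z)"
  note t = trilinear_tens_right[OF mC mC mC]
  have t': "trilinear_map R C C C ?T (\<lambda>x y z. ?t z y x)"
    by (intro trilinear_mapI trilinear_mapD[OF t])
  note flip = C.CC.tensor_lift_flip[OF _ _ C.comult_closed]
  have coassoc: "tensor_assoc R C C C (tensor_map R (tensor R C C) C ?D (\<lambda>x. x) (?D c)) =
      tensor_map R C (tensor R C C) (\<lambda>x. x) ?D (?D c)" if c: "c \<in> carrier C" for c
  proof -
    note X = C.comult_closed[OF c] and DX = linear_mapsD(1)[OF lin c]
    note left = bilinear_lift_comult_left[OF mC mT lin t]
    note right = bilinear_lift_comult_right[OF mC mT lin t]
    have "tensor_assoc R C C C (tensor_map R (tensor R C C) C ?D (\<lambda>x. x) (?D c)) =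
        tensor_lift ?T (\<lambda>a b. tensor_lift ?T (\<lambda>x y. ?t x y b) (?D a)) (?D c)"
      by (rule tensor_assoc_comult[OF mC lin DX])
    also have "\<dots> = tensor_lift ?T (\<lambda>a b. tensor_lift ?T (\<lambda>x y. ?t x y a) (?D b)) (\<Delta> c)"
      by (rule flip[OF mT left c])
    also have "\<dots> = tensor_lift ?T (\<lambda>a b. tensor_lift ?T (\<lambda>x y. ?t y x a) (\<Delta> b)) (\<Delta> c)"
    proof (rule C.CC.tensor_lift_cong[OF mT _ X])
      show "bilinear_map R C C ?T (\<lambda>a b. tensor_lift ?T (\<lambda>x y. ?t x y a) (?D b))"
        by (intro bilinear_mapI bilinear_mapD[OF left])
    qed (rule flip[OF mT trilinear_mapD(5)[OF t]])
    also have "\<dots> = tensor_lift ?T (\<lambda>a b. tensor_lift ?T (\<lambda>x y. ?t b y x) (\<Delta> a)) (\<Delta> c)"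
      using C.sw_coassoc[OF mT t' c]
      by (simp only: C.lift_lift_left_eq_sw[OF mT t' c]
          C.lift_lift_right_eq_sw[OF mT t' c])
    also have "\<dots> = tensor_lift ?T (\<lambda>a b. tensor_lift ?T (\<lambda>x y. ?t b x y) (?D a)) (\<Delta> c)"
    proof (rule C.CC.tensor_lift_cong[OF mT _ X, symmetric])
      show "bilinear_map R C C ?T (\<lambda>a b. tensor_lift ?T (\<lambda>x y. ?t b x y) (?D a))"
        by (intro bilinear_mapI bilinear_mapD[OF right])
    qed (rule flip[OF mT trilinear_mapD(6)[OF t]])
    also have "\<dots> = tensor_lift ?T (\<lambda>a b. tensor_lift ?T (\<lambda>x y. ?t a x y) (?D b)) (?D c)"
      by (rule flip[OF mT right c, symmetric])
    also have "\<dots> = tensor_map R C (tensor R C C) (\<lambda>x. x) ?D (?D c)"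
      by (rule tensor_map_comult[OF mC lin DX, symmetric])
    finally show ?thesis .
  qed
  have bl: "bilinear_map R C C C (\<lambda>x y. \<epsilon> x \<odot>\<^sub>C y)" and br: "bilinear_map R C C C (\<lambda>x y. \<epsilon> y \<odot>\<^sub>C x)"
    by (intro bilinear_mapI C.linear_counit[OF mC mC] C.linear_smult[OF mC] linear_map_id; simp)+
  show ?thesis
    unfolding coopposite_def
  proof (intro coalgebra.intro coalgebra_axioms.intro mC lin C.counit_linear coassoc)
    fix c assume c: "c \<in> carrier C"
    show "tensor_lift C (\<lambda>x y. \<epsilon> x \<odot>\<^sub>C y) (?D c) = c"
      using C.counit_right[OF c] by (simp only: flip[OF mC bl c])
    show "tensor_lift C (\<lambda>x y. \<epsilon> y \<odot>\<^sub>C x) (?D c) = c"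
      using C.counit_left[OF c] by (simp only: flip[OF mC br c])
  qed
qed

context assoc_algebra
begin

lemma linear_mult_left:
  assumes "a \<in> carrier A" "g \<in> linear_maps R M A" "module R M"
  shows "(\<lambda>x. a \<otimes>\<^sub>A g x) \<in> linear_maps R M A"
proof -
  interpret M: module R M by fact
  show ?thesis
    by (rule linear_mapsI) (simp_all add: linear_mapsD[OF assms(2)] assms(1) r_distr smult_mult_right)
qed

lemma linear_mult_right:
  assumes "a \<in> carrier A" "g \<in> linear_maps R M A" "module R M"
  shows "(\<lambda>x. g x \<otimes>\<^sub>A a) \<in> linear_maps R M A"
proof -
  interpret M: module R M by fact
  show ?thesis
    by (rule linear_mapsI) (simp_all add: linear_mapsD[OF assms(2)] assms(1) l_distr smult_mult_left)
qed

lemma bilinear_tens_mult: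
  assumes "a \<in> carrier A" "b \<in> carrier A"
  shows "bilinear_map R A A (tensor R A A) (\<lambda>c d. tens R A A (a \<otimes>\<^sub>A c) (b \<otimes>\<^sub>A d))"
proof -
  interpret AA: two_modules R A A by (rule two_modules.intro) unfold_locales
  show ?thesis
    by (rule bilinear_map_comp[OF AA.bilinear_tens];
        rule linear_mult_left[OF _ linear_map_id]; (fact | unfold_locales))
qed


text \<open>The product of formal sums is a nested sum, bilinear in either factor, hence independent of the
  chosen representatives.\<close>

lemma mult_tensor_class:
  assumes "xs \<in> lists (carrier A \<times> carrier A)" "ys \<in> lists (carrier A \<times> carrier A)"
  shows "tensor_class R A A xs \<otimes>\<^bsub>tensor R A A\<^esub> tensor_class R A A ys =
    formal_sum (tensor R A A) (\<lambda>a b. formal_sum (tensor R A A)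
      (\<lambda>c d. tens R A A (a \<otimes>\<^sub>A c) (b \<otimes>\<^sub>A d)) ys) xs"
proof -
  interpret AA: two_modules R A A by (rule two_modules.intro) unfold_locales
  note mA = module_axioms and mT = AA.module_tensor
  let ?p = "\<lambda>xs ys. [(a \<otimes>\<^sub>A c, b \<otimes>\<^sub>A d). (a, b) \<leftarrow> xs, (c, d) \<leftarrow> ys]"
  let ?i = "\<lambda>ys a b. formal_sum AA.T (\<lambda>c d. tens R A A (a \<otimes>\<^sub>A c) (b \<otimes>\<^sub>A d)) ys"
  have inner: "?i ys a b = AA.cls (map (\<lambda>(c, d). (a \<otimes>\<^sub>A c, b \<otimes>\<^sub>A d)) ys)"
    and inner_formal: "map (\<lambda>(c, d). (a \<otimes>\<^sub>A c, b \<otimes>\<^sub>A d)) ys \<in> AA.formal"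
    if "ys \<in> AA.formal" "a \<in> carrier A" "b \<in> carrier A" for ys a b
  proof -
    show l: "map (\<lambda>(c, d). (a \<otimes>\<^sub>A c, b \<otimes>\<^sub>A d)) ys \<in> AA.formal"
      using that(1) by (induction ys) (use that(2,3) in auto)
    show "?i ys a b = AA.cls (map (\<lambda>(c, d). (a \<otimes>\<^sub>A c, b \<otimes>\<^sub>A d)) ys)"
      using AA.formal_sum_tens[OF l]
      by (simp only: formal_sum_map[where f = "\<lambda>c d. a \<otimes>\<^sub>A c" and g = "\<lambda>c d. b \<otimes>\<^sub>A d"])
  qed
  have product: "AA.cls (?p xs ys) = formal_sum AA.T (?i ys) xs"
    if xs: "xs \<in> AA.formal" and ys: "ys \<in> AA.formal" for xs ys
  proof -
    have "AA.cls (?p xs ys) = formal_sum AA.T (?i ys) xs \<and> ?p xs ys \<in> AA.formal"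
      using xs
    proof (induction xs)
      case Nil
      then show ?case by (simp add: AA.zero_tensor)
    next
      case (Cons q xs)
      obtain a b where q: "q = (a, b)" by (cases q)
      have ab: "a \<in> carrier A" "b \<in> carrier A" using Cons.hyps by (simp_all add: q)
      let ?m = "map (\<lambda>(c, d). (a \<otimes>\<^sub>A c, b \<otimes>\<^sub>A d)) ys"
      have p: "?p (q # xs) ys = ?m @ ?p xs ys" by (simp add: q)
      note IH = Cons.IH[THEN conjunct1] Cons.IH[THEN conjunct2]
      have "formal_sum AA.T (?i ys) (q # xs) = AA.cls ?m \<oplus>\<^bsub>AA.T\<^esub> AA.cls (?p xs ys)"
        by (simp only: q formal_sum_simps inner[OF ys ab] IH(1))
      also have "\<dots> = AA.cls (?p (q # xs) ys)"
        unfolding p by (rule AA.add_tensor[OF inner_formal[OF ys ab] IH(2)])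
      finally have "AA.cls (?p (q # xs) ys) = formal_sum AA.T (?i ys) (q # xs)" ..
      moreover have "?p (q # xs) ys \<in> AA.formal"
        unfolding p append_in_lists_conv using inner_formal[OF ys ab] IH(2) by blast
      ultimately show ?case ..
    qed
    then show ?thesis ..
  qed
  have inner_cong: "?i ys' a b = ?i ys a b"
    if "(ys, ys') \<in> tensor_rel R A A" "a \<in> carrier A" "b \<in> carrier A" for ys ys' a b
    using tensor_rel_formal_sum[OF mA mA mT bilinear_tens_mult[OF that(2,3)] that(1)] by simp
  have outer: "bilinear_map R A A AA.T (?i ys)" if ys: "ys \<in> AA.formal" for ys
  proof -
    let ?L = "\<lambda>a b. tensor_lift AA.T (\<lambda>c d. tens R A A (a \<otimes>\<^sub>A c) (b \<otimes>\<^sub>A d)) (AA.cls ys)"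
    note t = AA.bilinear_tens and Y = AA.class_in_carrier[OF ys]
    have "bilinear_map R A A AA.T ?L"
    proof (rule bilinear_mapI)
      fix b assume b: "b \<in> carrier A"
      show "(\<lambda>a. ?L a b) \<in> linear_maps R A AA.T"
        by (rule linear_parametric_lift[OF mA mA mA mT Y bilinear_tens_mult[OF _ b]])
          (assumption | rule linear_map_comp[OF bilinear_mapD(1)[OF t]] linear_mult_right linear_map_id
            mA m_closed b)+
      show "(\<lambda>a. ?L b a) \<in> linear_maps R A AA.T"
        by (rule linear_parametric_lift[OF mA mA mA mT Y bilinear_tens_mult[OF b]])
          (assumption | rule linear_map_comp[OF bilinear_mapD(2)[OF t]] linear_mult_right linear_map_id
            mA m_closed b)+
    qed
    then show ?thesis
      by (rule bilinear_map_cong[OF mA mA])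
        (rule AA.tensor_lift_class[OF mT bilinear_tens_mult ys])
  qed
  have *: "AA.cls (?p xs' ys') = formal_sum AA.T (?i ys) xs"
    if "xs' \<in> AA.cls xs" "ys' \<in> AA.cls ys" for xs' ys'
  proof -
    have x: "(xs, xs') \<in> tensor_rel R A A" and y: "(ys, ys') \<in> tensor_rel R A A"
      using that by (simp_all only: AA.mem_class_iff)
    have "AA.cls (?p xs' ys') = formal_sum AA.T (?i ys') xs'"
      by (rule product[OF AA.rel_lists(2)[OF x] AA.rel_lists(2)[OF y]])
    also have "\<dots> = formal_sum AA.T (?i ys) xs'"
      by (rule formal_sum_cong[OF AA.rel_lists(2)[OF x]]) (rule inner_cong[OF y])
    also have "\<dots> = formal_sum AA.T (?i ys) xs"
      by (rule tensor_rel_formal_sum[OF mA mA mT outer[OF assms(2)] x, symmetric])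
    finally show ?thesis .
  qed
  have "AA.cls xs \<otimes>\<^bsub>AA.T\<^esub> AA.cls ys = (\<Union>xs'\<in>AA.cls xs. \<Union>ys'\<in>AA.cls ys. AA.cls (?p xs' ys'))"
    by (simp add: tensor_def)
  also have "\<dots> = (\<Union>xs'\<in>AA.cls xs. \<Union>ys'\<in>AA.cls ys. formal_sum AA.T (?i ys) xs)"
    using * by blast
  also have "\<dots> = formal_sum AA.T (?i ys) xs"
    using AA.self_in_class[OF assms(1)] AA.self_in_class[OF assms(2)] by blast
  finally show ?thesis .
qed

end

lemma assoc_algebra_opposite:
  assumes "assoc_algebra R A"
  shows "assoc_algebra R (opposite A)"
proof -
  interpret A: assoc_algebra R A by fact
  have ab: "abelian_group (opposite A)"
    by (rule abelian_groupI)
      (use A.l_neg A.a_inv_closed in \<open>auto simp: A.a_assoc intro: A.a_comm\<close>)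
  have "module R (opposite A)"
    by (rule moduleI)
      (simp_all add: A.R.is_cring ab A.smult_l_distr A.smult_r_distr A.smult_assoc1)
  moreover have "ring (opposite A)"
  proof (rule ringI)
    show "monoid (opposite A)"
      by (rule monoidI) (simp_all add: A.m_assoc)
  qed (simp_all add: ab A.l_distr A.r_distr)
  ultimately show ?thesis
    by (intro assoc_algebra.intro assoc_algebra_axioms.intro)
      (simp_all add: A.smult_mult_left A.smult_mult_right)
qed

lemma prebialgebra_opposite:
  assumes "prebialgebra R H \<Delta> \<epsilon>"
  shows "prebialgebra R (opposite H) \<Delta> \<epsilon>"
proof -
  interpret H: prebialgebra R H \<Delta> \<epsilon> by fact
  interpret O: assoc_algebra R "opposite H"
    by (rule assoc_algebra_opposite) unfold_locales
  note O = same_module_opposite[of H]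
  have "\<Delta> (k \<otimes>\<^sub>H h) = \<Delta> h \<otimes>\<^bsub>tensor R (opposite H) (opposite H)\<^esub> \<Delta> k"
    if h: "h \<in> carrier H" and k: "k \<in> carrier H" for h k
  proof -
    note h' = H.sweedler_rep[OF h] and k' = H.sweedler_rep[OF k]
    let ?x = "sweedler_rep R H \<Delta> h" and ?y = "sweedler_rep R H \<Delta> k"
    have t: "tens R H H (c \<otimes>\<^sub>H a) (d \<otimes>\<^sub>H b) \<in> carrier (tensor R H H)"
      if "a \<in> carrier H" "b \<in> carrier H" "c \<in> carrier H" "d \<in> carrier H" for a b c d
      by (rule bilinear_mapD(3)[OF H.CC.bilinear_tens]) (use that in simp_all)
    have "\<Delta> h \<otimes>\<^bsub>tensor R (opposite H) (opposite H)\<^esub> \<Delta> k =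
        formal_sum (tensor R H H) (\<lambda>a b. formal_sum (tensor R H H)
          (\<lambda>c d. tens R H H (c \<otimes>\<^sub>H a) (d \<otimes>\<^sub>H b)) ?y) ?x"
      using O.mult_tensor_class[of ?x ?y] h'(1) k'(1)
      by (simp only: h'(2) k'(2) tensor_class_cong[OF O O] tens_cong[OF O O] opposite_simps
          formal_sum_target_cong[OF same_module_tensor[OF O O]])
    also have "\<dots> = formal_sum (tensor R H H) (\<lambda>c d. formal_sum (tensor R H H)
          (\<lambda>a b. tens R H H (c \<otimes>\<^sub>H a) (d \<otimes>\<^sub>H b)) ?x) ?y"
      by (rule H.CC.T.formal_sum_swap[OF h'(1) k'(1) t])
    also have "\<dots> = \<Delta> k \<otimes>\<^bsub>tensor R H H\<^esub> \<Delta> h"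
      using H.mult_tensor_class[OF k'(1) h'(1)] by (simp only: h'(2) k'(2))
    finally show ?thesis
      by (simp only: H.comult_mult[OF k h])
  qed
  then have "prebialgebra_axioms R (opposite H) \<Delta>"
    unfolding prebialgebra_axioms_def opposite_simps by blast
  moreover have "coalgebra R (opposite H) \<Delta> \<epsilon>"
    by (rule coalgebra_opposite) unfold_locales
  ultimately show ?thesis
    by (intro prebialgebra.intro O.assoc_algebra_axioms)
qed

lemma prebialgebra_coopposite:
  assumes "prebialgebra R H \<Delta> \<epsilon>"
  shows "prebialgebra R H (coopposite R H \<Delta>) \<epsilon>"
proof -
  interpret H: prebialgebra R H \<Delta> \<epsilon> by fact
  note mT = H.CC.module_tensor
  let ?flip = "tensor_flip R H H"
  have lin: "?flip \<in> linear_maps R (tensor R H H) (tensor R H H)"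
    unfolding tensor_flip_def by (rule H.CC.linear_tensor_lift[OF mT H.CC.bilinear_tens_flip])
  have flip_tens: "?flip (tens R H H x y) = tens R H H y x"
    if "x \<in> carrier H" "y \<in> carrier H" for x y
    unfolding tensor_flip_def by (rule H.CC.tensor_lift_tens[OF mT H.CC.bilinear_tens_flip that])
  let ?s = "map (\<lambda>(x, y). (y, x))"
  have swap_formal: "?s xs \<in> H.CC.formal" if "xs \<in> H.CC.formal" for xs
    using that by auto
  have flip_class: "?flip (H.CC.cls xs) = H.CC.cls (?s xs)" if xs: "xs \<in> H.CC.formal" for xs
  proof -
    have "?flip (H.CC.cls xs) = formal_sum (tensor R H H) (\<lambda>x y. tens R H H y x) xs"
      unfolding tensor_flip_def by (rule H.CC.tensor_lift_class[OF mT H.CC.bilinear_tens_flip xs])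
    also have "\<dots> = H.CC.cls (?s xs)"
      using H.CC.formal_sum_tens[OF swap_formal[OF xs]]
      by (simp only: formal_sum_map[where f = "\<lambda>x y. y" and g = "\<lambda>x y. x"])
    finally show ?thesis .
  qed
  have "?flip (\<Delta> (h \<otimes>\<^sub>H l)) = ?flip (\<Delta> h) \<otimes>\<^bsub>tensor R H H\<^esub> ?flip (\<Delta> l)"
    if h: "h \<in> carrier H" and l: "l \<in> carrier H" for h l
  proof -
    note h' = H.sweedler_rep[OF h] and l' = H.sweedler_rep[OF l]
    let ?x = "sweedler_rep R H \<Delta> h" and ?y = "sweedler_rep R H \<Delta> l"
    let ?sum = "\<lambda>f. formal_sum (tensor R H H) (\<lambda>a b. formal_sum (tensor R H H) (f a b) ?y) ?x"
    have t: "tens R H H (a \<otimes>\<^sub>H c) (b \<otimes>\<^sub>H d) \<in> carrier (tensor R H H)"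
      if "a \<in> carrier H" "b \<in> carrier H" "c \<in> carrier H" "d \<in> carrier H" for a b c d
      by (rule bilinear_mapD(3)[OF H.CC.bilinear_tens]) (use that in simp_all)
    have "?flip (\<Delta> (h \<otimes>\<^sub>H l)) = ?flip (?sum (\<lambda>a b c d. tens R H H (a \<otimes>\<^sub>H c) (b \<otimes>\<^sub>H d)))"
      using H.mult_tensor_class[OF h'(1) l'(1)] by (simp only: H.comult_mult[OF h l] h'(2) l'(2))
    also have "\<dots> = formal_sum (tensor R H H) (\<lambda>a b. ?flip (formal_sum (tensor R H H)
        (\<lambda>c d. tens R H H (a \<otimes>\<^sub>H c) (b \<otimes>\<^sub>H d)) ?y)) ?x"
      by (rule linear_map_formal_sum[OF mT mT lin h'(1)])
        (rule H.CC.T.formal_sum_closed[OF l'(1) t])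
    also have "\<dots> = ?sum (\<lambda>a b c d. ?flip (tens R H H (a \<otimes>\<^sub>H c) (b \<otimes>\<^sub>H d)))"
      by (rule formal_sum_cong[OF h'(1)]) (rule linear_map_formal_sum[OF mT mT lin l'(1) t])
    also have "\<dots> = ?sum (\<lambda>a b c d. tens R H H (b \<otimes>\<^sub>H d) (a \<otimes>\<^sub>H c))"
      by (rule formal_sum_cong[OF h'(1)], rule formal_sum_cong[OF l'(1)], rule flip_tens; simp)
    also have "\<dots> = formal_sum (tensor R H H) (\<lambda>a b. formal_sum (tensor R H H)
        (\<lambda>c d. tens R H H (a \<otimes>\<^sub>H c) (b \<otimes>\<^sub>H d)) (?s ?y)) (?s ?x)"
      by (simp only: formal_sum_map[where f = "\<lambda>x y. y" and g = "\<lambda>x y. x"])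
    also have "\<dots> = H.CC.cls (?s ?x) \<otimes>\<^bsub>tensor R H H\<^esub> H.CC.cls (?s ?y)"
      by (rule H.mult_tensor_class[OF swap_formal[OF h'(1)] swap_formal[OF l'(1)], symmetric])
    also have "\<dots> = ?flip (\<Delta> h) \<otimes>\<^bsub>tensor R H H\<^esub> ?flip (\<Delta> l)"
      by (simp only: h'(2) l'(2) flip_class[OF h'(1)] flip_class[OF l'(1)])
    finally show ?thesis .
  qed
  then have "prebialgebra_axioms R H (coopposite R H \<Delta>)"
    unfolding prebialgebra_axioms_def coopposite_def by blast
  moreover have "coalgebra R H (coopposite R H \<Delta>) \<epsilon>"
    by (rule coalgebra_coopposite) unfold_locales
  ultimately show ?thesis
    by (intro prebialgebra.intro H.assoc_algebra_axioms)
qed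

context prebialgebra
begin

lemma sw_mult:
  assumes "module R P" "bilinear_map R H H P f" "h \<in> carrier H" "k \<in> carrier H"
  shows "sw P f (h \<otimes>\<^sub>H k) =
    sw P (\<lambda>a b. sw P (\<lambda>c d. f (a \<otimes>\<^sub>H c) (b \<otimes>\<^sub>H d)) k) h"
proof -
  note h' = sweedler_rep[OF assms(3)] and k' = sweedler_rep[OF assms(4)]
  let ?x = "sweedler_rep R H \<Delta> h" and ?y = "sweedler_rep R H \<Delta> k"
  note mT = CC.module_tensor and L = CC.linear_tensor_lift[OF assms(1,2)]
  have t: "tens R H H (a \<otimes>\<^sub>H c) (b \<otimes>\<^sub>H d) \<in> carrier (tensor R H H)"
    if "a \<in> carrier H" "b \<in> carrier H" "c \<in> carrier H" "d \<in> carrier H" for a b c d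
    by (rule bilinear_mapD(3)[OF CC.bilinear_tens]) (use that in simp_all)
  let ?f = "\<lambda>a b. formal_sum (tensor R H H) (\<lambda>c d. tens R H H (a \<otimes>\<^sub>H c) (b \<otimes>\<^sub>H d)) ?y"
  have "sw P f (h \<otimes>\<^sub>H k) = tensor_lift P f (\<Delta> (h \<otimes>\<^sub>H k))"
    by (rule tensor_lift_comult[OF assms(1,2), symmetric]) (simp add: assms(3,4))
  also have "\<dots> = tensor_lift P f (formal_sum (tensor R H H) ?f ?x)"
    using mult_tensor_class[OF h'(1) k'(1)] by (simp only: comult_mult[OF assms(3,4)] h'(2) k'(2))
  also have "\<dots> = formal_sum P (\<lambda>a b. tensor_lift P f (?f a b)) ?x"
    by (rule linear_map_formal_sum[OF mT assms(1) L h'(1)])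
      (rule CC.T.formal_sum_closed[OF k'(1) t])
  also have "\<dots> = formal_sum P (\<lambda>a b. formal_sum P
      (\<lambda>c d. tensor_lift P f (tens R H H (a \<otimes>\<^sub>H c) (b \<otimes>\<^sub>H d))) ?y) ?x"
    by (rule formal_sum_cong[OF h'(1)]) (rule linear_map_formal_sum[OF mT assms(1) L k'(1) t])
  also have "\<dots> = formal_sum P (\<lambda>a b. formal_sum P
      (\<lambda>c d. f (a \<otimes>\<^sub>H c) (b \<otimes>\<^sub>H d)) ?y) ?x"
    by (rule formal_sum_cong[OF h'(1)], rule formal_sum_cong[OF k'(1)],
        rule CC.tensor_lift_tens[OF assms(1,2)]; simp)
  finally show ?thesis by (simp only: sweedler_def)
qed

end


section \<open>The axioms in Sweedler notation\<close>

lemma module_regular: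
  assumes "cring R"
  shows "module R (regular_module R)"
proof -
  interpret R: cring R by fact
  show ?thesis
  proof (rule moduleI)
    show "abelian_group (regular_module R)"
      by (rule abelian_groupI)
        (use R.l_neg R.a_inv_closed in \<open>auto simp: regular_module_def R.a_assoc intro: R.a_comm\<close>)
  qed (simp_all add: regular_module_def R.is_cring R.l_distr R.r_distr R.m_assoc)
qed

text \<open>Sums with values in the ring \<open>R\<close> are treated as sums in the regular module.\<close>

lemma tensor_lift_regular: "tensor_lift R b = tensor_lift (regular_module R) b"
  by (simp add: fun_eq_iff tensor_lift_def regular_module_def)

lemma sweedler_opposite: "sweedler R (opposite H) \<Delta> P b h = sweedler R H \<Delta> P b h"
  by (simp add: sweedler_def sweedler_rep_def
      tensor_class_cong[OF same_module_opposite same_module_opposite])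

lemma linear_maps_opposite [simp]:
  "linear_maps R (opposite M) N = linear_maps R M N"
  "linear_maps R M (opposite N) = linear_maps R M N"
  by (simp_all add: linear_maps_def)

lemma bilinear_map_opposite [simp]:
  "bilinear_map R (opposite M) (opposite N) P = bilinear_map R M N P"
  by (simp add: fun_eq_iff bilinear_map_def)

lemma trilinear_map_opposite [simp]:
  "trilinear_map R (opposite L) (opposite M) (opposite N) P = trilinear_map R L M N P"
  by (simp add: fun_eq_iff trilinear_map_def)

lemma (in coalgebra) sw_coopposite:
  assumes "module R P" "bilinear_map R C C P b" "c \<in> carrier C"
  shows "sweedler R C (coopposite R C \<Delta>) P b c = sw P (\<lambda>x y. b y x) c"
proof -
  interpret O: coalgebra R C "coopposite R C \<Delta>" \<epsilon>
    by (rule coalgebra_coopposite) unfold_locales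
  have "bilinear_map R C C P (\<lambda>x y. b y x)"
    by (intro bilinear_mapI bilinear_mapD[OF assms(2)])
  from tensor_lift_comult[OF assms(1) this assms(3)] show ?thesis
    unfolding O.tensor_lift_comult[OF assms, symmetric]
    unfolding coopposite_def CC.tensor_lift_flip[OF assms(1,2) comult_closed[OF assms(3)]] .
qed

context prebialgebra
begin

lemma module_H: "module R H"
  by unfold_locales

lemmas linear_intros =
  linear_map_id linear_counit[OF module_H] linear_counit[OF _ module_H]
  linear_smult linear_mult_left[OF _ _ module_H] linear_mult_right[OF _ _ module_H]
  linear_sw_param[OF module_H] linear_sw[OF module_H] module_H

lemma bilinear_rm:
  assumes "h \<in> carrier H" "l \<in> carrier H"
  shows "bilinear_map R H H (regular_module R) (\<lambda>a b. \<epsilon> (h \<otimes>\<^sub>H b) \<otimes> \<epsilon> (a \<otimes>\<^sub>H l))"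
proof -
  note mR = module_regular[OF R.is_cring]
  have eq: "r \<odot>\<^bsub>regular_module R\<^esub> s = r \<otimes> s" for r s
    by (simp add: regular_module_def)
  have g: "(\<lambda>x. \<epsilon> (g x)) \<in> linear_maps R H (regular_module R)" if "g \<in> linear_maps R H H" for g
    by (rule linear_map_comp[OF counit_linear that])
  show ?thesis
  proof (rule bilinear_mapI)
    fix y assume y: "y \<in> carrier H"
    show "(\<lambda>x. \<epsilon> (h \<otimes>\<^sub>H y) \<otimes> \<epsilon> (x \<otimes>\<^sub>H l)) \<in> linear_maps R H (regular_module R)"
      unfolding eq[symmetric]
      by (rule linear_smult[OF mR _ g[OF linear_mult_right[OF assms(2) linear_map_id module_H]]])
        (use assms y in simp)
    have "(\<lambda>x. \<epsilon> (y \<otimes>\<^sub>H l) \<otimes> \<epsilon> (h \<otimes>\<^sub>H x)) \<in> linear_maps R H (regular_module R)"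
      unfolding eq[symmetric]
      by (rule linear_smult[OF mR _ g[OF linear_mult_left[OF assms(1) linear_map_id module_H]]])
        (use assms y in simp)
    then show "(\<lambda>x. \<epsilon> (h \<otimes>\<^sub>H x) \<otimes> \<epsilon> (y \<otimes>\<^sub>H l)) \<in> linear_maps R H (regular_module R)"
      by (rule linear_map_cong[OF module_H]) (use assms y in \<open>simp add: R.m_comm\<close>)
  qed
qed

lemma axiom_rm_iff:
  "axiom_rm R H \<Delta> \<epsilon> \<longleftrightarrow>
    (\<forall>h\<in>carrier H. \<forall>k\<in>carrier H. \<forall>l\<in>carrier H. \<epsilon> (h \<otimes>\<^sub>H k \<otimes>\<^sub>H l) =
      sw (regular_module R) (\<lambda>a b. \<epsilon> (h \<otimes>\<^sub>H b) \<otimes> \<epsilon> (a \<otimes>\<^sub>H l)) k)"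
  unfolding axiom_rm_def tensor_lift_regular[of R]
  by (intro ball_cong HOL.refl) (simp only: tensor_lift_comult[OF module_regular[OF R.is_cring] bilinear_rm])

text \<open>Multiplying (rm) with a vector \<open>v\<close> makes it applicable inside Sweedler sums with values in any
  module.\<close>

lemma rm_sw:
  assumes "axiom_rm R H \<Delta> \<epsilon>" "module R P" "v \<in> carrier P"
    and "h \<in> carrier H" "k \<in> carrier H" "l \<in> carrier H"
  shows "\<epsilon> (h \<otimes>\<^sub>H k \<otimes>\<^sub>H l) \<odot>\<^sub>P v =
    sw P (\<lambda>a b. \<epsilon> (a \<otimes>\<^sub>H l) \<odot>\<^sub>P (\<epsilon> (h \<otimes>\<^sub>H b) \<odot>\<^sub>P v)) k"
proof -
  interpret P: module R P by fact
  have lin: "(\<lambda>r. r \<odot>\<^sub>P v) \<in> linear_maps R (regular_module R) P"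
    using assms(3)
    by (intro linear_mapsI) (simp_all add: regular_module_def P.smult_l_distr P.smult_assoc1)
  have "\<epsilon> (h \<otimes>\<^sub>H k \<otimes>\<^sub>H l) \<odot>\<^sub>P v =
      sw (regular_module R) (\<lambda>a b. \<epsilon> (h \<otimes>\<^sub>H b) \<otimes> \<epsilon> (a \<otimes>\<^sub>H l)) k \<odot>\<^sub>P v"
    using assms(1,4-6) unfolding axiom_rm_iff by simp
  also have "\<dots> = sw P (\<lambda>a b. (\<epsilon> (h \<otimes>\<^sub>H b) \<otimes> \<epsilon> (a \<otimes>\<^sub>H l)) \<odot>\<^sub>P v) k"
    by (rule linear_map_sw[OF module_regular[OF R.is_cring] assms(2) lin assms(5)])
      (use assms(4,6) in \<open>simp add: regular_module_def\<close>)
  also have "\<dots> = sw P (\<lambda>a b. \<epsilon> (a \<otimes>\<^sub>H l) \<odot>\<^sub>P (\<epsilon> (h \<otimes>\<^sub>H b) \<odot>\<^sub>P v)) k"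
    by (rule sw_cong[OF assms(5)])
      (use assms(3,4,6) in \<open>simp add: P.smult_assoc1[symmetric] R.m_comm\<close>)
  finally show ?thesis .
qed

lemma bilinear_rc:
  assumes "module R P" "trilinear_map R H H H P f"
  shows "bilinear_map R H H P (\<lambda>a b. sw P (\<lambda>c d. f a (c \<otimes>\<^sub>H b) d) \<one>\<^sub>H)"
    and "\<lbrakk>a \<in> carrier H; b \<in> carrier H\<rbrakk> \<Longrightarrow> bilinear_map R H H P (\<lambda>c d. f a (c \<otimes>\<^sub>H b) d)"
  by (intro bilinear_mapI linear_sw_param[OF module_H assms(1)] trilinear_mapD[OF assms(2)]
      linear_map_comp[OF trilinear_mapD(2)[OF assms(2)]] linear_intros; simp)+

text \<open>The instance of (rc) for the universal trilinear map into \<open>(H \<otimes> H) \<otimes> H\<close> is equivalent to (rc);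
  this is how (rc) is established for other prebialgebras.\<close>

lemma axiom_rc_iff:
  "axiom_rc R H \<Delta> \<longleftrightarrow>
    (let T = tensor R (tensor R H H) H; t = \<lambda>x y z. tens R (tensor R H H) H (tens R H H x y) z
     in sw T (\<lambda>a b. sw T (\<lambda>x y. t x y b) a) \<one>\<^sub>H =
       sw T (\<lambda>a b. sw T (\<lambda>c d. t a (c \<otimes>\<^sub>H b) d) \<one>\<^sub>H) \<one>\<^sub>H)"
proof -
  interpret TL: two_modules R "tensor R H H" H
    by (rule two_modules.intro) unfold_locales
  note mT = TL.module_tensor
  let ?T = "TL.T" and ?t = "\<lambda>x y z. tens R (tensor R H H) H (tens R H H x y) z"
  have t: "trilinear_map R H H H ?T ?t"
    by (rule trilinear_tens_left; rule module_H)
  have one: "\<one>\<^sub>H \<in> carrier H" by simp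
  have bl: "bilinear_map R H H ?T (\<lambda>x y. tens R (tensor R H H) H (\<Delta> x) y)"
    by (rule bilinear_map_comp[OF TL.bilinear_tens comult_linear linear_map_id])
  have "tens R (tensor R H H) H X y = tensor_lift ?T (\<lambda>u v. ?t u v y) X"
    if X: "X \<in> carrier (tensor R H H)" and y: "y \<in> carrier H" for X y
  proof -
    have "X = tensor_lift CC.T (tens R H H) X"
      using X by (elim CC.carrier_tensorE)
        (simp only: CC.tensor_lift_class[OF CC.module_tensor CC.bilinear_tens] CC.formal_sum_tens)
    then show ?thesis
      using CC.linear_map_tensor_lift[OF CC.module_tensor mT CC.bilinear_tens
          bilinear_mapD(1)[OF TL.bilinear_tens y] X] by simp
  qed
  then have "tensor_map R (tensor R H H) H \<Delta> (\<lambda>x. x) (\<Delta> \<one>\<^sub>H) =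
      tensor_lift ?T (\<lambda>a b. tensor_lift ?T (\<lambda>x y. ?t x y b) (\<Delta> a)) (\<Delta> \<one>\<^sub>H)"
    unfolding tensor_map_def
    by (intro CC.tensor_lift_cong[OF mT bl comult_closed[OF one]]) (blast intro: comult_closed)
  also have "\<dots> = sw ?T (\<lambda>a b. sw ?T (\<lambda>x y. ?t x y b) a) \<one>\<^sub>H"
    by (rule lift_lift_left_eq_sw[OF mT t one])
  finally have left: "tensor_map R (tensor R H H) H \<Delta> (\<lambda>x. x) (\<Delta> \<one>\<^sub>H) = \<dots>" .
  have "tensor_lift ?T (\<lambda>a b. tensor_lift ?T (\<lambda>c d. ?t a (c \<otimes>\<^sub>H b) d) (\<Delta> \<one>\<^sub>H)) (\<Delta> \<one>\<^sub>H) =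
      tensor_lift ?T (\<lambda>a b. sw ?T (\<lambda>c d. ?t a (c \<otimes>\<^sub>H b) d) \<one>\<^sub>H) (\<Delta> \<one>\<^sub>H)"
    by (rule CC.tensor_lift_cong[OF mT bilinear_rc(1)[OF mT t] comult_closed[OF one], symmetric])
      (rule tensor_lift_comult[OF mT bilinear_rc(2)[OF mT t] one, symmetric])
  also have "\<dots> = sw ?T (\<lambda>a b. sw ?T (\<lambda>c d. ?t a (c \<otimes>\<^sub>H b) d) \<one>\<^sub>H) \<one>\<^sub>H"
    by (rule tensor_lift_comult[OF mT bilinear_rc(1)[OF mT t] one])
  finally show ?thesis
    unfolding axiom_rc_def Let_def left by simp
qed

text \<open>Every trilinear map factors through the universal one of \<open>axiom_rc_iff\<close>.\<close>

lemma rc_sw: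
  assumes "axiom_rc R H \<Delta>" "module R P" "trilinear_map R H H H P f"
  shows "sw P (\<lambda>a b. sw P (\<lambda>c d. f a (c \<otimes>\<^sub>H b) d) \<one>\<^sub>H) \<one>\<^sub>H =
    sw P (\<lambda>a b. sw P (\<lambda>x y. f x y b) a) \<one>\<^sub>H"
proof -
  interpret TL: two_modules R "tensor R H H" H
    by (rule two_modules.intro) unfold_locales
  note mT = TL.module_tensor
  let ?T = "TL.T" and ?t = "\<lambda>x y z. tens R (tensor R H H) H (tens R H H x y) z"
  have t: "trilinear_map R H H H ?T ?t"
    by (rule trilinear_tens_left; rule module_H)
  have one: "\<one>\<^sub>H \<in> carrier H" by simp
  let ?b = "\<lambda>X z. tensor_lift P (\<lambda>x y. f x y z) X"
  let ?F = "tensor_lift P ?b"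
  have b: "bilinear_map R (tensor R H H) H P ?b"
    by (rule bilinear_lift_left[OF module_H module_H module_H assms(2,3)])
  have F: "?F \<in> linear_maps R ?T P"
    by (rule TL.linear_tensor_lift[OF assms(2) b])
  have Ft: "?F (?t x y z) = f x y z" if "x \<in> carrier H" "y \<in> carrier H" "z \<in> carrier H" for x y z
    by (simp only: TL.tensor_lift_tens[OF assms(2) b bilinear_mapD(3)[OF CC.bilinear_tens that(1,2)] that(3)]
        CC.tensor_lift_tens[OF assms(2) trilinear_mapD(5)[OF assms(3) that(3)] that(1,2)])
  note tc = trilinear_mapD(4)[OF t]
  have "?F (sw ?T (\<lambda>a b. sw ?T (\<lambda>x y. ?t x y b) a) \<one>\<^sub>H) =
      ?F (sw ?T (\<lambda>a b. sw ?T (\<lambda>c d. ?t a (c \<otimes>\<^sub>H b) d) \<one>\<^sub>H) \<one>\<^sub>H)"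
    using assms(1) unfolding axiom_rc_iff Let_def by simp
  then show ?thesis
    using linear_map_sw_sw[OF mT assms(2) F one, of "\<lambda>a b x y. ?t x y b" "\<lambda>a b x y. f x y b" "\<lambda>a b. a"]
      linear_map_sw_sw[OF mT assms(2) F one, of "\<lambda>a b c d. ?t a (c \<otimes>\<^sub>H b) d"
        "\<lambda>a b c d. f a (c \<otimes>\<^sub>H b) d" "\<lambda>a b. \<one>\<^sub>H"]
    by (simp add: Ft tc)
qed

end


section \<open>Symmetries of the axioms\<close>

lemma opposite_opposite [simp]: "opposite (opposite H) = H"
  by (simp add: opposite_def)

lemma coopposite_opposite: "coopposite R (opposite H) \<Delta> = coopposite R H \<Delta>"
  unfolding coopposite_def tensor_flip_def
    tensor_lift_target_cong[OF same_module_tensor[OF same_module_opposite same_module_opposite]]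
    tens_cong[OF same_module_opposite same_module_opposite] ..

lemma axiom_rc_opposite: "axiom_rc R (opposite H) \<Delta> \<longleftrightarrow> axiom_lc R H \<Delta>"
proof -
  note O = same_module_opposite[of H]
  note TO = same_module_tensor[OF O O]
  show ?thesis
    unfolding axiom_rc_def axiom_lc_def Let_def tensor_map_def opposite_simps
      tensor_lift_target_cong[OF same_module_tensor[OF TO O]] tens_cong[OF TO O] tens_cong[OF O O] ..
qed

lemma axiom_lc_opposite: "axiom_lc R (opposite H) \<Delta> \<longleftrightarrow> axiom_rc R H \<Delta>"
  using axiom_rc_opposite[of R "opposite H" \<Delta>] by simp

lemma axiom_rm_opposite:
  assumes "prebialgebra R H \<Delta> \<epsilon>"
  shows "axiom_rm R (opposite H) \<Delta> \<epsilon> \<longleftrightarrow> axiom_lm R H \<Delta> \<epsilon>"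
proof -
  interpret H: prebialgebra R H \<Delta> \<epsilon> by fact
  interpret O: prebialgebra R "opposite H" \<Delta> \<epsilon>
    by (rule prebialgebra_opposite) fact
  note mR = module_regular[OF H.R.is_cring]
  have lift: "tensor_lift R (\<lambda>a b. \<epsilon> (b \<otimes>\<^sub>H h) \<otimes>\<^sub>R \<epsilon> (l \<otimes>\<^sub>H a)) (\<Delta> k) =
      tensor_lift R (\<lambda>a b. \<epsilon> (l \<otimes>\<^sub>H a) \<otimes>\<^sub>R \<epsilon> (b \<otimes>\<^sub>H h)) (\<Delta> k)"
    if "h \<in> carrier H" "k \<in> carrier H" "l \<in> carrier H" for h k l
    unfolding tensor_lift_regular[of R]
  proof (rule H.CC.tensor_lift_cong[OF mR _ H.comult_closed])
    show "bilinear_map R H H (regular_module R) (\<lambda>a b. \<epsilon> (b \<otimes>\<^sub>H h) \<otimes>\<^sub>R \<epsilon> (l \<otimes>\<^sub>H a))"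
      using O.bilinear_rm[of h l] that by simp
  qed (use that in \<open>simp_all add: H.R.m_comm\<close>)
  have "axiom_rm R (opposite H) \<Delta> \<epsilon> \<longleftrightarrow>
      (\<forall>h\<in>carrier H. \<forall>k\<in>carrier H. \<forall>l\<in>carrier H. \<epsilon> (l \<otimes>\<^sub>H (k \<otimes>\<^sub>H h)) =
        tensor_lift R (\<lambda>a b. \<epsilon> (b \<otimes>\<^sub>H h) \<otimes>\<^sub>R \<epsilon> (l \<otimes>\<^sub>H a)) (\<Delta> k))"
    by (simp add: axiom_rm_def)
  also have "\<dots> \<longleftrightarrow> (\<forall>h\<in>carrier H. \<forall>k\<in>carrier H. \<forall>l\<in>carrier H. \<epsilon> (l \<otimes>\<^sub>H k \<otimes>\<^sub>H h) =
        tensor_lift R (\<lambda>a b. \<epsilon> (l \<otimes>\<^sub>H a) \<otimes>\<^sub>R \<epsilon> (b \<otimes>\<^sub>H h)) (\<Delta> k))"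
    by (intro ball_cong HOL.refl) (simp add: lift H.m_assoc)
  also have "\<dots> \<longleftrightarrow> axiom_lm R H \<Delta> \<epsilon>"
    unfolding axiom_lm_def by blast
  finally show ?thesis .
qed

lemma axiom_lm_opposite:
  assumes "prebialgebra R H \<Delta> \<epsilon>"
  shows "axiom_lm R (opposite H) \<Delta> \<epsilon> \<longleftrightarrow> axiom_rm R H \<Delta> \<epsilon>"
  using axiom_rm_opposite[OF prebialgebra_opposite[OF assms]] by simp

lemma axiom_rm_opposite_coopposite:
  assumes "prebialgebra R H \<Delta> \<epsilon>" "axiom_rm R H \<Delta> \<epsilon>"
  shows "axiom_rm R (opposite H) (coopposite R H \<Delta>) \<epsilon>"
proof -
  interpret H: prebialgebra R H \<Delta> \<epsilon> by fact
  interpret O: prebialgebra R "opposite H" "coopposite R H \<Delta>" \<epsilon>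
    by (intro prebialgebra_opposite prebialgebra_coopposite assms(1))
  note mR = module_regular[OF H.R.is_cring]
  show ?thesis
    unfolding O.axiom_rm_iff
  proof (intro ballI)
    fix h k l assume "h \<in> carrier (opposite H)" "k \<in> carrier (opposite H)" "l \<in> carrier (opposite H)"
    then have hkl: "h \<in> carrier H" "k \<in> carrier H" "l \<in> carrier H" by simp_all
    have bil: "bilinear_map R H H (regular_module R) (\<lambda>a b. \<epsilon> (b \<otimes>\<^sub>H h) \<otimes>\<^sub>R \<epsilon> (l \<otimes>\<^sub>H a))"
      using O.bilinear_rm[of h l] hkl by simp
    have "sweedler R (opposite H) (coopposite R H \<Delta>) (regular_module R)
        (\<lambda>a b. \<epsilon> (h \<otimes>\<^bsub>opposite H\<^esub> b) \<otimes>\<^sub>R \<epsilon> (a \<otimes>\<^bsub>opposite H\<^esub> l)) k =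
        H.sw (regular_module R) (\<lambda>a b. \<epsilon> (a \<otimes>\<^sub>H h) \<otimes>\<^sub>R \<epsilon> (l \<otimes>\<^sub>H b)) k"
      by (simp add: sweedler_opposite H.sw_coopposite[OF mR bil hkl(2)])
    also have "\<dots> = H.sw (regular_module R) (\<lambda>a b. \<epsilon> (l \<otimes>\<^sub>H b) \<otimes>\<^sub>R \<epsilon> (a \<otimes>\<^sub>H h)) k"
      by (rule H.sw_cong[OF hkl(2)]) (simp add: hkl H.R.m_comm)
    also have "\<dots> = \<epsilon> (l \<otimes>\<^sub>H k \<otimes>\<^sub>H h)"
      using assms(2) hkl unfolding H.axiom_rm_iff by simp
    finally show "\<epsilon> (h \<otimes>\<^bsub>opposite H\<^esub> k \<otimes>\<^bsub>opposite H\<^esub> l) = sweedler R (opposite H) (coopposite R H \<Delta>)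
        (regular_module R) (\<lambda>a b. \<epsilon> (h \<otimes>\<^bsub>opposite H\<^esub> b) \<otimes>\<^sub>R \<epsilon> (a \<otimes>\<^bsub>opposite H\<^esub> l)) k"
      by (simp add: hkl H.m_assoc)
  qed
qed

text \<open>Reversing both structures preserves (rc), as the two sides of (rc) are then read from right to
  left: apply (rc) to the universal trilinear map with its arguments reversed.\<close>

lemma axiom_rc_opposite_coopposite:
  assumes "prebialgebra R H \<Delta> \<epsilon>" "axiom_rc R H \<Delta>"
  shows "axiom_rc R (opposite H) (coopposite R H \<Delta>)"
proof -
  interpret H: prebialgebra R H \<Delta> \<epsilon> by fact
  interpret C: prebialgebra R H "coopposite R H \<Delta>" \<epsilon>
    by (rule prebialgebra_coopposite[OF assms(1)])
  interpret O: prebialgebra R "opposite H" "coopposite R H \<Delta>" \<epsilon>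
    by (intro prebialgebra_opposite prebialgebra_coopposite assms(1))
  interpret TL: two_modules R "tensor R (opposite H) (opposite H)" "opposite H"
    by (rule two_modules.intro) (rule O.CC.module_tensor O.module_H)+
  note mT = TL.module_tensor
  let ?T = "TL.T"
  let ?t = "\<lambda>x y z. tens R (tensor R (opposite H) (opposite H)) (opposite H)
    (tens R (opposite H) (opposite H) x y) z"
  have "trilinear_map R (opposite H) (opposite H) (opposite H) ?T ?t"
    by (rule trilinear_tens_left; rule O.module_H)
  then have t: "trilinear_map R H H H ?T ?t" by simp
  have t': "trilinear_map R H H H ?T (\<lambda>x y z. ?t z y x)"
    by (intro trilinear_mapI trilinear_mapD[OF t])
  let ?sw = "H.sw ?T" and ?cw = "sweedler R H (coopposite R H \<Delta>) ?T" and ?one = "\<one>\<^sub>H"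
  have one: "?one \<in> carrier H" by simp
  note tc = trilinear_mapD(4)[OF t]
  note flip = H.sw_coopposite[OF mT]
  have inner: "bilinear_map R H H ?T (\<lambda>a b. ?cw (\<lambda>x y. ?t x y b) a)"
    by (rule bilinear_mapI)
      (rule C.linear_sw[OF H.module_H mT trilinear_mapD(5)[OF t] linear_map_id]
        C.linear_sw_param[OF H.module_H mT _ trilinear_mapD(3)[OF t]]; assumption)+
  have b: "bilinear_map R H H ?T (\<lambda>a b. ?cw (\<lambda>c d. ?t a (b \<otimes>\<^sub>H c) d) ?one)"
    "\<And>a b. \<lbrakk>a \<in> carrier H; b \<in> carrier H\<rbrakk> \<Longrightarrow> bilinear_map R H H ?T (\<lambda>c d. ?t a (b \<otimes>\<^sub>H c) d)"
    using O.bilinear_rc[OF mT] t by (simp_all add: sweedler_opposite)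
  have "?cw (\<lambda>a b. ?cw (\<lambda>x y. ?t x y b) a) ?one = ?sw (\<lambda>a b. ?cw (\<lambda>x y. ?t x y a) b) ?one"
    by (rule flip[OF inner one])
  also have "\<dots> = ?sw (\<lambda>a b. ?sw (\<lambda>x y. ?t y x a) b) ?one"
    by (rule H.sw_cong[OF one], rule flip[OF trilinear_mapD(5)[OF t]])
  also have "\<dots> = ?sw (\<lambda>a b. ?sw (\<lambda>x y. ?t b y x) a) ?one"
    by (rule H.sw_coassoc[OF mT t' one, symmetric])
  also have "\<dots> = ?sw (\<lambda>a b. ?sw (\<lambda>c d. ?t d (c \<otimes>\<^sub>H b) a) ?one) ?one"
    by (rule H.rc_sw[OF assms(2) mT t', symmetric])
  also have "\<dots> = ?sw (\<lambda>c d. ?sw (\<lambda>a b. ?t d (c \<otimes>\<^sub>H b) a) ?one) ?one"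
    by (rule H.sw_swap[OF mT one one]) (simp add: tc)
  also have "\<dots> = ?sw (\<lambda>c d. ?cw (\<lambda>b a. ?t d (c \<otimes>\<^sub>H b) a) ?one) ?one"
    by (rule H.sw_cong[OF one], rule flip[OF b(2) one, symmetric])
  also have "\<dots> = ?cw (\<lambda>d c. ?cw (\<lambda>b a. ?t d (c \<otimes>\<^sub>H b) a) ?one) ?one"
    by (rule flip[OF b(1) one, symmetric])
  finally show ?thesis
    unfolding O.axiom_rc_iff Let_def by (simp add: sweedler_opposite)
qed

lemma eps_opposite:
  "eps_t (opposite H) \<Delta> \<epsilon> h = bar_eps_t H \<Delta> \<epsilon> h"
  "eps_s (opposite H) \<Delta> \<epsilon> h = bar_eps_s H \<Delta> \<epsilon> h"
  "bar_eps_t (opposite H) \<Delta> \<epsilon> h = eps_t H \<Delta> \<epsilon> h"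
  "bar_eps_s (opposite H) \<Delta> \<epsilon> h = eps_s H \<Delta> \<epsilon> h"
  by (simp_all add: eps_t_def eps_s_def bar_eps_t_def bar_eps_s_def
      tensor_lift_target_cong[OF same_module_opposite])

context prebialgebra
begin

lemma bilinear_eps:
  assumes "module R P" "h \<in> carrier H"
    and "g \<in> linear_maps R H P"
  shows "bilinear_map R H H P (\<lambda>a b. \<epsilon> (a \<otimes>\<^sub>H h) \<odot>\<^sub>P g b)"
    and "bilinear_map R H H P (\<lambda>a b. \<epsilon> (h \<otimes>\<^sub>H a) \<odot>\<^sub>P g b)"
    and "bilinear_map R H H P (\<lambda>a b. \<epsilon> (b \<otimes>\<^sub>H h) \<odot>\<^sub>P g a)"
    and "bilinear_map R H H P (\<lambda>a b. \<epsilon> (h \<otimes>\<^sub>H b) \<odot>\<^sub>P g a)"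
  by (rule bilinear_mapI; intro linear_intros assms; simp add: assms linear_mapsD(1)[OF assms(3)])+

lemma eps_sw:
  assumes "h \<in> carrier H"
  shows "eps_t H \<Delta> \<epsilon> h = sw H (\<lambda>a b. \<epsilon> (a \<otimes>\<^sub>H h) \<odot>\<^sub>H b) \<one>\<^sub>H"
    and "eps_s H \<Delta> \<epsilon> h = sw H (\<lambda>a b. \<epsilon> (h \<otimes>\<^sub>H b) \<odot>\<^sub>H a) \<one>\<^sub>H"
    and "bar_eps_t H \<Delta> \<epsilon> h = sw H (\<lambda>a b. \<epsilon> (h \<otimes>\<^sub>H a) \<odot>\<^sub>H b) \<one>\<^sub>H"
    and "bar_eps_s H \<Delta> \<epsilon> h = sw H (\<lambda>a b. \<epsilon> (b \<otimes>\<^sub>H h) \<odot>\<^sub>H a) \<one>\<^sub>H"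
  unfolding eps_t_def eps_s_def bar_eps_t_def bar_eps_s_def
  by (rule tensor_lift_comult[OF module_H], rule bilinear_eps[OF module_H assms linear_map_id], simp)+

end

lemma eps_coopposite:
  assumes "prebialgebra R H \<Delta> \<epsilon>" "h \<in> carrier H"
  shows "eps_t H (coopposite R H \<Delta>) \<epsilon> h = bar_eps_s H \<Delta> \<epsilon> h"
    and "bar_eps_s H (coopposite R H \<Delta>) \<epsilon> h = eps_t H \<Delta> \<epsilon> h"
    and "eps_s H (coopposite R H \<Delta>) \<epsilon> h = bar_eps_t H \<Delta> \<epsilon> h"
    and "bar_eps_t H (coopposite R H \<Delta>) \<epsilon> h = eps_s H \<Delta> \<epsilon> h"
proof -
  interpret H: prebialgebra R H \<Delta> \<epsilon> by fact
  interpret C: prebialgebra R H "coopposite R H \<Delta>" \<epsilon>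
    by (rule prebialgebra_coopposite[OF assms(1)])
  show "eps_t H (coopposite R H \<Delta>) \<epsilon> h = bar_eps_s H \<Delta> \<epsilon> h"
    "bar_eps_s H (coopposite R H \<Delta>) \<epsilon> h = eps_t H \<Delta> \<epsilon> h"
    "eps_s H (coopposite R H \<Delta>) \<epsilon> h = bar_eps_t H \<Delta> \<epsilon> h"
    "bar_eps_t H (coopposite R H \<Delta>) \<epsilon> h = eps_s H \<Delta> \<epsilon> h"
    unfolding H.eps_sw[OF assms(2)] C.eps_sw[OF assms(2)]
    by (rule H.sw_coopposite[OF H.module_H],
        rule H.bilinear_eps[OF H.module_H assms(2) linear_map_id], simp)+
qed


section \<open>The four maps\<close>

context prebialgebra
begin

abbreviation et where "et \<equiv> eps_t H \<Delta> \<epsilon>"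
abbreviation es where "es \<equiv> eps_s H \<Delta> \<epsilon>"
abbreviation bt where "bt \<equiv> bar_eps_t H \<Delta> \<epsilon>"
abbreviation bs where "bs \<equiv> bar_eps_s H \<Delta> \<epsilon>"

lemma linear_eps:
  "et \<in> linear_maps R H H" "es \<in> linear_maps R H H"
  "bt \<in> linear_maps R H H" "bs \<in> linear_maps R H H"
proof -
  note param = linear_sw_param[OF module_H module_H one_closed]
  note c = linear_counit[OF module_H module_H] and l = linear_mult_left[OF _ linear_map_id module_H]
    and r = linear_mult_right[OF _ linear_map_id module_H]
  show "et \<in> linear_maps R H H"
    by (rule linear_map_cong[OF module_H param eps_sw(1)[symmetric]]) (assumption | rule c l)+
  show "es \<in> linear_maps R H H"
    by (rule linear_map_cong[OF module_H param eps_sw(2)[symmetric]]) (assumption | rule c r)+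
  show "bt \<in> linear_maps R H H"
    by (rule linear_map_cong[OF module_H param eps_sw(3)[symmetric]]) (assumption | rule c r)+
  show "bs \<in> linear_maps R H H"
    by (rule linear_map_cong[OF module_H param eps_sw(4)[symmetric]]) (assumption | rule c l)+
qed

lemma eps_closed [simp]:
  assumes "h \<in> carrier H"
  shows "et h \<in> carrier H" "es h \<in> carrier H" "bt h \<in> carrier H" "bs h \<in> carrier H"
  by (rule linear_mapsD(1)[OF linear_eps(1) assms] linear_mapsD(1)[OF linear_eps(2) assms]
      linear_mapsD(1)[OF linear_eps(3) assms] linear_mapsD(1)[OF linear_eps(4) assms])+

lemma linear_map_eps:
  assumes "module R P" "g \<in> linear_maps R H P" "h \<in> carrier H"
  shows "g (et h) = sw P (\<lambda>a b. \<epsilon> (a \<otimes>\<^sub>H h) \<odot>\<^sub>P g b) \<one>\<^sub>H" (is ?th1)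
    and "g (es h) = sw P (\<lambda>a b. \<epsilon> (h \<otimes>\<^sub>H b) \<odot>\<^sub>P g a) \<one>\<^sub>H" (is ?th2)
    and "g (bt h) = sw P (\<lambda>a b. \<epsilon> (h \<otimes>\<^sub>H a) \<odot>\<^sub>P g b) \<one>\<^sub>H" (is ?th3)
    and "g (bs h) = sw P (\<lambda>a b. \<epsilon> (b \<otimes>\<^sub>H h) \<odot>\<^sub>P g a) \<one>\<^sub>H" (is ?th4)
proof -
  have "g (sw H (\<lambda>a b. s a b \<odot>\<^sub>H u a b) \<one>\<^sub>H) = sw P (\<lambda>a b. s a b \<odot>\<^sub>P g (u a b)) \<one>\<^sub>H"
    if "\<And>a b. \<lbrakk>a \<in> carrier H; b \<in> carrier H\<rbrakk> \<Longrightarrow> s a b \<in> carrier R"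
      "\<And>a b. \<lbrakk>a \<in> carrier H; b \<in> carrier H\<rbrakk> \<Longrightarrow> u a b \<in> carrier H" for s u
  proof -
    have "g (sw H (\<lambda>a b. s a b \<odot>\<^sub>H u a b) \<one>\<^sub>H) = sw P (\<lambda>a b. g (s a b \<odot>\<^sub>H u a b)) \<one>\<^sub>H"
      by (rule linear_map_sw[OF module_H assms(1,2)]) (simp_all add: that)
    also have "\<dots> = sw P (\<lambda>a b. s a b \<odot>\<^sub>P g (u a b)) \<one>\<^sub>H"
      by (rule sw_cong, simp) (rule linear_mapsD(3)[OF assms(2) that]; assumption)
    finally show ?thesis .
  qed
  note push = this
  show ?th1
    unfolding eps_sw[OF assms(3)] by (rule push) (simp_all add: assms(3))
  show ?th2
    unfolding eps_sw[OF assms(3)] by (rule push) (simp_all add: assms(3))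
  show ?th3
    unfolding eps_sw[OF assms(3)] by (rule push) (simp_all add: assms(3))
  show ?th4
    unfolding eps_sw[OF assms(3)] by (rule push) (simp_all add: assms(3))
qed

lemma module_R: "module R (regular_module R)"
  by (rule module_regular[OF R.is_cring])

lemma regular_simps:
  "carrier (regular_module R) = carrier R" "r \<odot>\<^bsub>regular_module R\<^esub> s = r \<otimes> s"
  by (simp_all add: regular_module_def)

lemma linear_counit_comp:
  assumes "g \<in> linear_maps R H H"
  shows "(\<lambda>x. \<epsilon> (g x)) \<in> linear_maps R H (regular_module R)"
  by (rule linear_map_comp[OF counit_linear assms])

lemma counit_eps_t:
  assumes "h \<in> carrier H"
  shows "\<epsilon> (et h) = \<epsilon> h"
proof -
  have "\<epsilon> (et h) = sw (regular_module R) (\<lambda>a b. \<epsilon> (a \<otimes>\<^sub>H h) \<odot>\<^bsub>regular_module R\<^esub> \<epsilon> b) \<one>\<^sub>H"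
    by (rule linear_map_eps(1)[OF module_R counit_linear assms])
  also have "\<dots> = sw (regular_module R) (\<lambda>a b. \<epsilon> b \<odot>\<^bsub>regular_module R\<^esub> \<epsilon> (a \<otimes>\<^sub>H h)) \<one>\<^sub>H"
    by (rule sw_cong) (simp_all add: assms regular_simps R.m_comm)
  also have "\<dots> = \<epsilon> (\<one>\<^sub>H \<otimes>\<^sub>H h)"
    by (rule sw_counit_right[OF module_R linear_counit_comp])
      (simp_all add: linear_mult_right[OF assms linear_map_id module_H])
  finally show ?thesis using assms by simp
qed

lemma eps_t_one: "et \<one>\<^sub>H = \<one>\<^sub>H"
proof -
  have "et \<one>\<^sub>H = sw H (\<lambda>a b. \<epsilon> a \<odot>\<^sub>H b) \<one>\<^sub>H"
    unfolding eps_sw[OF one_closed] by (rule sw_cong) simp_all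
  also have "\<dots> = \<one>\<^sub>H"
    by (rule sw_counit_left[OF module_H linear_map_id]) simp
  finally show ?thesis .
qed


section \<open>Consequences of (rm)\<close>

text \<open>\<open>\<epsilon>(y \<epsilon>\<^sub>t(h)) = \<epsilon>(1\<^sub>1 h) \<epsilon>(y 1\<^sub>2)\<close>, which is the right-hand side of (rm) for the product \<open>y 1 h\<close>.\<close>

lemma rm_absorb:
  assumes "axiom_rm R H \<Delta> \<epsilon>" "y \<in> carrier H" "h \<in> carrier H"
  shows "\<epsilon> (y \<otimes>\<^sub>H et h) = \<epsilon> (y \<otimes>\<^sub>H h)"
proof -
  have "\<epsilon> (y \<otimes>\<^sub>H et h) = sw (regular_module R)
      (\<lambda>a b. \<epsilon> (a \<otimes>\<^sub>H h) \<odot>\<^bsub>regular_module R\<^esub> \<epsilon> (y \<otimes>\<^sub>H b)) \<one>\<^sub>H"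
    by (rule linear_map_eps(1)[OF module_R linear_counit_comp assms(3)])
      (rule linear_mult_left[OF assms(2) linear_map_id module_H])
  also have "\<dots> = sw (regular_module R) (\<lambda>a b. \<epsilon> (a \<otimes>\<^sub>H h) \<odot>\<^bsub>regular_module R\<^esub>
      (\<epsilon> (y \<otimes>\<^sub>H b) \<odot>\<^bsub>regular_module R\<^esub> \<one>)) \<one>\<^sub>H"
    by (rule sw_cong) (simp_all add: assms regular_simps)
  also have "\<dots> = \<epsilon> (y \<otimes>\<^sub>H \<one>\<^sub>H \<otimes>\<^sub>H h) \<odot>\<^bsub>regular_module R\<^esub> \<one>"
    by (rule rm_sw[OF assms(1) module_R, symmetric]) (simp_all add: assms regular_simps)
  finally show ?thesis using assms by (simp add: regular_simps)
qed

lemma rm_eps_t_absorb: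
  assumes "axiom_rm R H \<Delta> \<epsilon>" "x \<in> carrier H" "h \<in> carrier H"
  shows "et (x \<otimes>\<^sub>H et h) = et (x \<otimes>\<^sub>H h)"
  unfolding eps_sw[OF m_closed[OF assms(2) eps_closed(1)[OF assms(3)]]] eps_sw[OF m_closed[OF assms(2,3)]]
  by (rule sw_cong) (simp_all add: m_assoc[symmetric] rm_absorb assms)

lemma rm_bar_eps_s_absorb:
  assumes "axiom_rm R H \<Delta> \<epsilon>" "x \<in> carrier H" "h \<in> carrier H"
  shows "bs (x \<otimes>\<^sub>H et h) = bs (x \<otimes>\<^sub>H h)"
  unfolding eps_sw[OF m_closed[OF assms(2) eps_closed(1)[OF assms(3)]]] eps_sw[OF m_closed[OF assms(2,3)]]
  by (rule sw_cong) (simp_all add: m_assoc[symmetric] rm_absorb assms)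

lemma sw_closed_H [simp]:
  assumes "c \<in> carrier H" "\<And>x y. \<lbrakk>x \<in> carrier H; y \<in> carrier H\<rbrakk> \<Longrightarrow> b x y \<in> carrier H"
  shows "sw H b c \<in> carrier H"
  using module_H assms by (rule sw_closed)

text \<open>In \<open>\<epsilon>(x\<^sub>1 k) x\<^sub>2 = \<epsilon>(x\<^sub>1 1\<^sub>1 k) x\<^sub>2 1\<^sub>2\<close> the axiom (rm) splits \<open>1\<^sub>1\<close>; by coassociativity the sum
  becomes \<open>\<epsilon>(1\<^sub>1 k) \<epsilon>(x\<^sub>1 1\<^sub>2) x\<^sub>2 1\<^sub>3\<close>, where \<open>\<epsilon>(x\<^sub>1 1\<^sub>2) x\<^sub>2 1\<^sub>3 = x 1\<^sub>2\<close> by the counit law. The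
  calculation below runs in the opposite direction.\<close>

lemma rm_mult_eps_t:
  assumes rm: "axiom_rm R H \<Delta> \<epsilon>" and x: "x \<in> carrier H" and k: "k \<in> carrier H"
  shows "sw H (\<lambda>a b. \<epsilon> (a \<otimes>\<^sub>H k) \<odot>\<^sub>H b) x = x \<otimes>\<^sub>H et k"
proof -
  have one: "\<one>\<^sub>H \<in> carrier H" by simp
  have mult: "sw H (\<lambda>u v. \<epsilon> u \<odot>\<^sub>H v) (x \<otimes>\<^sub>H q) =
      sw H (\<lambda>a b. sw H (\<lambda>f d. \<epsilon> (a \<otimes>\<^sub>H f) \<odot>\<^sub>H (b \<otimes>\<^sub>H d)) q) x" if "q \<in> carrier H" for q
    by (rule sw_mult[OF module_H _ x that]) (intro bilinear_mapI linear_intros; simp)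
  have "x \<otimes>\<^sub>H et k = sw H (\<lambda>r q. \<epsilon> (r \<otimes>\<^sub>H k) \<odot>\<^sub>H (x \<otimes>\<^sub>H q)) \<one>\<^sub>H"
    by (rule linear_map_eps(1)[OF module_H _ k]) (rule linear_mult_left[OF x linear_map_id module_H])
  also have "\<dots> = sw H (\<lambda>r q. \<epsilon> (r \<otimes>\<^sub>H k) \<odot>\<^sub>H
      sw H (\<lambda>u v. \<epsilon> u \<odot>\<^sub>H v) (x \<otimes>\<^sub>H q)) \<one>\<^sub>H"
    by (rule sw_cong[OF one]) (simp add: sw_counit_left[OF module_H linear_map_id] x)
  also have "\<dots> = sw H (\<lambda>r q. \<epsilon> (r \<otimes>\<^sub>H k) \<odot>\<^sub>H
      sw H (\<lambda>a b. sw H (\<lambda>f d. \<epsilon> (a \<otimes>\<^sub>H f) \<odot>\<^sub>H (b \<otimes>\<^sub>H d)) q) x) \<one>\<^sub>H"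
    by (rule sw_cong[OF one]) (simp only: mult)
  also have "\<dots> = sw H (\<lambda>r q. \<epsilon> (r \<otimes>\<^sub>H k) \<odot>\<^sub>H
      sw H (\<lambda>f d. sw H (\<lambda>a b. \<epsilon> (a \<otimes>\<^sub>H f) \<odot>\<^sub>H (b \<otimes>\<^sub>H d)) x) q) \<one>\<^sub>H"
    by (rule sw_cong[OF one], subst sw_swap[OF module_H x]) simp_all
  also have "\<dots> = sw H (\<lambda>r q. sw H (\<lambda>f d. \<epsilon> (r \<otimes>\<^sub>H k) \<odot>\<^sub>H
      sw H (\<lambda>a b. \<epsilon> (a \<otimes>\<^sub>H f) \<odot>\<^sub>H (b \<otimes>\<^sub>H d)) x) q) \<one>\<^sub>H"
    by (rule sw_cong[OF one], rule smult_sw[OF module_H, symmetric]) (simp_all add: x k)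
  also have "\<dots> = sw H (\<lambda>c d. sw H (\<lambda>r f. \<epsilon> (r \<otimes>\<^sub>H k) \<odot>\<^sub>H
      sw H (\<lambda>a b. \<epsilon> (a \<otimes>\<^sub>H f) \<odot>\<^sub>H (b \<otimes>\<^sub>H d)) x) c) \<one>\<^sub>H"
    by (rule sw_coassoc[OF module_H _ one, symmetric])
      (intro trilinear_mapI linear_intros; simp add: x k)
  also have "\<dots> = sw H (\<lambda>c d. sw H (\<lambda>r f. sw H (\<lambda>a b. \<epsilon> (r \<otimes>\<^sub>H k) \<odot>\<^sub>H
      (\<epsilon> (a \<otimes>\<^sub>H f) \<odot>\<^sub>H (b \<otimes>\<^sub>H d))) x) c) \<one>\<^sub>H"
    by (rule sw_cong[OF one], rule sw_cong, assumption, rule smult_sw[OF module_H, symmetric])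
      (simp_all add: x k)
  also have "\<dots> = sw H (\<lambda>c d. sw H (\<lambda>a b. sw H (\<lambda>r f. \<epsilon> (r \<otimes>\<^sub>H k) \<odot>\<^sub>H
      (\<epsilon> (a \<otimes>\<^sub>H f) \<odot>\<^sub>H (b \<otimes>\<^sub>H d))) c) x) \<one>\<^sub>H"
    by (rule sw_cong[OF one], rule sw_swap[OF module_H]) (simp_all add: x k)
  also have "\<dots> = sw H (\<lambda>c d. sw H (\<lambda>a b. \<epsilon> (a \<otimes>\<^sub>H c \<otimes>\<^sub>H k) \<odot>\<^sub>H (b \<otimes>\<^sub>H d)) x) \<one>\<^sub>H"
    by (rule sw_cong[OF one], rule sw_cong[OF x], rule rm_sw[OF rm module_H, symmetric])
      (simp_all add: x k)
  also have "\<dots> = sw H (\<lambda>a b. sw H (\<lambda>c d. \<epsilon> (a \<otimes>\<^sub>H c \<otimes>\<^sub>H k) \<odot>\<^sub>H (b \<otimes>\<^sub>H d)) \<one>\<^sub>H) x"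
    by (rule sw_swap[OF module_H one x]) (simp_all add: k)
  also have "\<dots> = sw H (\<lambda>a b. \<epsilon> (a \<otimes>\<^sub>H k) \<odot>\<^sub>H b) (x \<otimes>\<^sub>H \<one>\<^sub>H)"
    by (rule sw_mult[OF module_H _ x one, symmetric]) (intro bilinear_mapI linear_intros; simp add: k)
  finally show ?thesis using x by simp
qed

text \<open>\<open>\<epsilon>\<^sub>t(b d) = \<epsilon>\<^sub>t(b \<epsilon>\<^sub>t(d))\<close>, and \<open>b \<epsilon>\<^sub>t(d) = \<epsilon>(b\<^sub>1 d) b\<^sub>2\<close>. Linearity is assumed
  for the composite of \<open>g\<close> with \<open>\<epsilon>\<^sub>t\<close>, because in the applications \<open>g\<close> forms tensors over the
  submodule \<open>H\<^sub>t\<close>, which are meaningful only for elements of \<open>H\<^sub>t\<close>.\<close>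

lemma rm_sw_eps_t:
  assumes rm: "axiom_rm R H \<Delta> \<epsilon>" and "module R P" "(\<lambda>x. g (et x)) \<in> linear_maps R H P"
    and b: "b \<in> carrier H" and d: "d \<in> carrier H"
  shows "g (et (b \<otimes>\<^sub>H d)) = sw P (\<lambda>p q. \<epsilon> (p \<otimes>\<^sub>H d) \<odot>\<^sub>P g (et q)) b"
proof -
  have "g (et (b \<otimes>\<^sub>H d)) = g (et (sw H (\<lambda>p q. \<epsilon> (p \<otimes>\<^sub>H d) \<odot>\<^sub>H q) b))"
    by (simp only: rm_eps_t_absorb[OF rm b d, symmetric] rm_mult_eps_t[OF rm b d])
  also have "\<dots> = sw P (\<lambda>p q. g (et (\<epsilon> (p \<otimes>\<^sub>H d) \<odot>\<^sub>H q))) b"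
    by (rule linear_map_sw[OF module_H assms(2,3) b]) (simp add: d)
  also have "\<dots> = sw P (\<lambda>p q. \<epsilon> (p \<otimes>\<^sub>H d) \<odot>\<^sub>P g (et q)) b"
    by (rule sw_cong[OF b], rule linear_mapsD(3)[OF assms(3)]) (simp_all add: d)
  finally show ?thesis .
qed

lemma rm_counit_eps_t_mid:
  assumes rm: "axiom_rm R H \<Delta> \<epsilon>" and "module R P" and v: "v \<in> carrier P"
    and b: "b \<in> carrier H" and h: "h \<in> carrier H" and k: "k \<in> carrier H"
  shows "\<epsilon> (b \<otimes>\<^sub>H et h \<otimes>\<^sub>H k) \<odot>\<^sub>P v =
    sw P (\<lambda>a p. \<epsilon> (a \<otimes>\<^sub>H h) \<odot>\<^sub>P (\<epsilon> (p \<otimes>\<^sub>H k) \<odot>\<^sub>P v)) b"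
proof -
  have g: "(\<lambda>x. \<epsilon> (x \<otimes>\<^sub>H k) \<odot>\<^sub>P v) \<in> linear_maps R H P"
    by (intro linear_intros assms(2) v k)
  have "\<epsilon> (b \<otimes>\<^sub>H et h \<otimes>\<^sub>H k) \<odot>\<^sub>P v =
      \<epsilon> (sw H (\<lambda>a p. \<epsilon> (a \<otimes>\<^sub>H h) \<odot>\<^sub>H p) b \<otimes>\<^sub>H k) \<odot>\<^sub>P v"
    by (simp only: rm_mult_eps_t[OF rm b h])
  also have "\<dots> = sw P (\<lambda>a p. \<epsilon> ((\<epsilon> (a \<otimes>\<^sub>H h) \<odot>\<^sub>H p) \<otimes>\<^sub>H k) \<odot>\<^sub>P v) b"
    by (rule linear_map_sw[OF module_H assms(2) g b]) (simp add: h)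
  also have "\<dots> = sw P (\<lambda>a p. \<epsilon> (a \<otimes>\<^sub>H h) \<odot>\<^sub>P (\<epsilon> (p \<otimes>\<^sub>H k) \<odot>\<^sub>P v)) b"
    by (rule sw_cong[OF b], rule linear_mapsD(3)[OF g]) (simp_all add: h)
  finally show ?thesis .
qed

text \<open>Expanding \<open>\<epsilon>\<^sub>t(h)\<close>, the product is \<open>\<epsilon>(1\<^sub>1 h) 1\<^sub>2 \<epsilon>\<^sub>t(k)\<close>, and \<open>1\<^sub>2 \<epsilon>\<^sub>t(k) = \<epsilon>(1\<^sub>2 k) 1\<^sub>3\<close> by
  \<open>rm_mult_eps_t\<close>. The second equation shows that \<open>H\<^sub>t\<close> is closed under multiplication.\<close>

lemma rm_eps_t_mult:
  assumes rm: "axiom_rm R H \<Delta> \<epsilon>" and h: "h \<in> carrier H" and k: "k \<in> carrier H"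
  shows "et h \<otimes>\<^sub>H et k =
      sw H (\<lambda>a b. sw H (\<lambda>p q. \<epsilon> (a \<otimes>\<^sub>H h) \<odot>\<^sub>H (\<epsilon> (p \<otimes>\<^sub>H k) \<odot>\<^sub>H q)) b) \<one>\<^sub>H"
    and "et h \<otimes>\<^sub>H et k = et (et h \<otimes>\<^sub>H k)"
proof -
  have one: "\<one>\<^sub>H \<in> carrier H" by simp
  have "et h \<otimes>\<^sub>H et k = sw H (\<lambda>a b. \<epsilon> (a \<otimes>\<^sub>H h) \<odot>\<^sub>H (b \<otimes>\<^sub>H et k)) \<one>\<^sub>H"
    by (rule linear_map_eps(1)[OF module_H _ h])
      (rule linear_mult_right[OF eps_closed(1)[OF k] linear_map_id module_H])
  also have "\<dots> = sw H (\<lambda>a b. \<epsilon> (a \<otimes>\<^sub>H h) \<odot>\<^sub>H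
      sw H (\<lambda>p q. \<epsilon> (p \<otimes>\<^sub>H k) \<odot>\<^sub>H q) b) \<one>\<^sub>H"
    by (rule sw_cong[OF one]) (simp only: rm_mult_eps_t[OF rm _ k])
  also have "\<dots> = sw H (\<lambda>a b. sw H (\<lambda>p q. \<epsilon> (a \<otimes>\<^sub>H h) \<odot>\<^sub>H
      (\<epsilon> (p \<otimes>\<^sub>H k) \<odot>\<^sub>H q)) b) \<one>\<^sub>H"
    by (rule sw_cong[OF one], rule smult_sw[OF module_H, symmetric]) (simp_all add: h k)
  finally show 1: "et h \<otimes>\<^sub>H et k = \<dots>" .
  note 1
  also have "sw H (\<lambda>a b. sw H (\<lambda>p q. \<epsilon> (a \<otimes>\<^sub>H h) \<odot>\<^sub>H
      (\<epsilon> (p \<otimes>\<^sub>H k) \<odot>\<^sub>H q)) b) \<one>\<^sub>H =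
      sw H (\<lambda>b q. sw H (\<lambda>a p. \<epsilon> (a \<otimes>\<^sub>H h) \<odot>\<^sub>H (\<epsilon> (p \<otimes>\<^sub>H k) \<odot>\<^sub>H q)) b) \<one>\<^sub>H"
    by (rule sw_coassoc[OF module_H _ one, symmetric]) (intro trilinear_mapI linear_intros; simp add: h k)
  also have "\<dots> = sw H (\<lambda>b q. \<epsilon> (b \<otimes>\<^sub>H et h \<otimes>\<^sub>H k) \<odot>\<^sub>H q) \<one>\<^sub>H"
    by (rule sw_cong[OF one], rule rm_counit_eps_t_mid[OF rm module_H, symmetric]) (simp_all add: h k)
  also have "\<dots> = et (et h \<otimes>\<^sub>H k)"
    unfolding eps_sw[OF m_closed[OF eps_closed(1)[OF h] k]]
    by (rule sw_cong[OF one]) (simp add: m_assoc h k)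
  finally show "et h \<otimes>\<^sub>H et k = et (et h \<otimes>\<^sub>H k)" .
qed

lemma rm_bar_eps_s_eps_t_mult:
  assumes rm: "axiom_rm R H \<Delta> \<epsilon>" and h: "h \<in> carrier H" and k: "k \<in> carrier H"
  shows "bs (et h \<otimes>\<^sub>H et k) =
    sw H (\<lambda>q b. sw H (\<lambda>a p. \<epsilon> (a \<otimes>\<^sub>H h) \<odot>\<^sub>H (\<epsilon> (p \<otimes>\<^sub>H k) \<odot>\<^sub>H q)) b) \<one>\<^sub>H"
proof -
  have "bs (et h \<otimes>\<^sub>H et k) = sw H (\<lambda>q b. \<epsilon> (b \<otimes>\<^sub>H (et h \<otimes>\<^sub>H k)) \<odot>\<^sub>H q) \<one>\<^sub>H"
    unfolding rm_bar_eps_s_absorb[OF rm eps_closed(1)[OF h] k]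
    by (rule eps_sw) (simp add: h k)
  also have "\<dots> = sw H (\<lambda>q b. sw H (\<lambda>a p. \<epsilon> (a \<otimes>\<^sub>H h) \<odot>\<^sub>H
      (\<epsilon> (p \<otimes>\<^sub>H k) \<odot>\<^sub>H q)) b) \<one>\<^sub>H"
    by (rule sw_cong) (simp_all add: rm_counit_eps_t_mid[OF rm module_H, symmetric] m_assoc h k)
  finally show ?thesis .
qed

end

context prebialgebra
begin


section \<open>Consequences of (rc)\<close>

text \<open>Applying \<open>\<epsilon>\<close> to the middle factor of (rc) gives \<open>\<Delta>(1) = 1\<^sub>1 \<otimes> \<epsilon>\<^sub>t(1\<^sub>2)\<close>, and likewise
  \<open>\<Delta>(1) = \<epsilon>\<^sub>s(1\<^sub>1) \<otimes> 1\<^sub>2\<close>, depending on which copy of \<open>\<Delta>(1)\<close> is summed first.\<close>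

lemma rc_one_eps_t:
  assumes rc: "axiom_rc R H \<Delta>" and P: "module R P" and f: "bilinear_map R H H P f"
  shows "sw P (\<lambda>a b. f a (et b)) \<one>\<^sub>H = sw P f \<one>\<^sub>H"
proof -
  have one: "\<one>\<^sub>H \<in> carrier H" by simp
  have t: "trilinear_map R H H H P (\<lambda>x y z. \<epsilon> y \<odot>\<^sub>P f x z)"
    by (intro trilinear_mapI linear_intros bilinear_mapD[OF f] P; simp)
  have "sw P (\<lambda>a b. f a (et b)) \<one>\<^sub>H =
      sw P (\<lambda>a b. sw P (\<lambda>c d. \<epsilon> (c \<otimes>\<^sub>H b) \<odot>\<^sub>P f a d) \<one>\<^sub>H) \<one>\<^sub>H"
    by (rule sw_cong[OF one], rule linear_map_eps(1)[OF P bilinear_mapD(2)[OF f]])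
  also have "\<dots> = sw P (\<lambda>r d. sw P (\<lambda>a y. \<epsilon> y \<odot>\<^sub>P f a d) r) \<one>\<^sub>H"
    by (rule rc_sw[OF rc P t])
  also have "\<dots> = sw P f \<one>\<^sub>H"
    by (rule sw_cong[OF one], rule sw_counit_right[OF P bilinear_mapD(1)[OF f]])
  finally show ?thesis .
qed

lemma rc_one_eps_s:
  assumes rc: "axiom_rc R H \<Delta>" and P: "module R P" and f: "bilinear_map R H H P f"
  shows "sw P (\<lambda>a b. f (es a) b) \<one>\<^sub>H = sw P f \<one>\<^sub>H"
proof -
  interpret P: module R P by (rule P)
  have one: "\<one>\<^sub>H \<in> carrier H" by simp
  note fc = bilinear_mapD(3)[OF f]
  have t: "trilinear_map R H H H P (\<lambda>x y z. \<epsilon> y \<odot>\<^sub>P f x z)"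
    by (intro trilinear_mapI linear_intros bilinear_mapD[OF f] P; simp)
  have "sw P (\<lambda>a b. f (es a) b) \<one>\<^sub>H =
      sw P (\<lambda>c d. sw P (\<lambda>a b. \<epsilon> (c \<otimes>\<^sub>H b) \<odot>\<^sub>P f a d) \<one>\<^sub>H) \<one>\<^sub>H"
    by (rule sw_cong[OF one], rule linear_map_eps(2)[OF P bilinear_mapD(1)[OF f]])
  also have "\<dots> = sw P (\<lambda>a b. sw P (\<lambda>c d. \<epsilon> (c \<otimes>\<^sub>H b) \<odot>\<^sub>P f a d) \<one>\<^sub>H) \<one>\<^sub>H"
    by (rule sw_swap[OF P one one]) (simp add: fc)
  also have "\<dots> = sw P (\<lambda>r d. sw P (\<lambda>a y. \<epsilon> y \<odot>\<^sub>P f a d) r) \<one>\<^sub>H"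
    by (rule rc_sw[OF rc P t])
  also have "\<dots> = sw P f \<one>\<^sub>H"
    by (rule sw_cong[OF one], rule sw_counit_right[OF P bilinear_mapD(1)[OF f]])
  finally show ?thesis .
qed

text \<open>Applying \<open>\<epsilon>(u -)\<close> to the last factor of (rc) computes \<open>\<Delta>(\<epsilon>\<^sub>s(u))\<close>.\<close>

lemma rc_comult_eps_s:
  assumes rc: "axiom_rc R H \<Delta>" and P: "module R P" and f: "bilinear_map R H H P f"
    and u: "u \<in> carrier H"
  shows "sw P f (es u) = sw P (\<lambda>a b. f a (es u \<otimes>\<^sub>H b)) \<one>\<^sub>H"
proof -
  interpret P: module R P by (rule P)
  have one: "\<one>\<^sub>H \<in> carrier H" by simp
  note fc = bilinear_mapD(3)[OF f]
  have t: "trilinear_map R H H H P (\<lambda>a p q. \<epsilon> (u \<otimes>\<^sub>H q) \<odot>\<^sub>P f a p)"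
    by (intro trilinear_mapI linear_intros bilinear_mapD[OF f] P; simp add: u)
  have "sw P f (es u) = sw P (\<lambda>r q. \<epsilon> (u \<otimes>\<^sub>H q) \<odot>\<^sub>P sw P f r) \<one>\<^sub>H"
    by (rule linear_map_eps(2)[OF P linear_sw[OF module_H P f linear_map_id] u])
  also have "\<dots> = sw P (\<lambda>r q. sw P (\<lambda>a p. \<epsilon> (u \<otimes>\<^sub>H q) \<odot>\<^sub>P f a p) r) \<one>\<^sub>H"
    by (rule sw_cong[OF one], rule smult_sw[OF P, symmetric]) (simp_all add: u fc)
  also have "\<dots> = sw P (\<lambda>a b. sw P (\<lambda>c d. \<epsilon> (u \<otimes>\<^sub>H d) \<odot>\<^sub>P f a (c \<otimes>\<^sub>H b)) \<one>\<^sub>H) \<one>\<^sub>H"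
    by (rule rc_sw[OF rc P t, symmetric])
  also have "\<dots> = sw P (\<lambda>a b. f a (es u \<otimes>\<^sub>H b)) \<one>\<^sub>H"
    by (rule sw_cong[OF one], rule linear_map_eps(2)[OF P _ u, symmetric],
        rule linear_map_comp[OF bilinear_mapD(2)[OF f] linear_mult_right[OF _ linear_map_id module_H]])
  finally show ?thesis .
qed

text \<open>\<open>H\<^sub>s\<close> is closed under multiplication: for \<open>y, z \<in> H\<^sub>s\<close> one has
  \<open>\<Delta>(y z) = \<Delta>(y) \<Delta>(z) = (1 \<otimes> y) \<Delta>(1) \<Delta>(z) = (1 \<otimes> y) \<Delta>(z) = 1\<^sub>1 \<otimes> y z 1\<^sub>2\<close>, and the counit law turns
  this into \<open>y z = \<epsilon>\<^sub>s(y z)\<close>.\<close>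

lemma rc_eps_s_mult:
  assumes rc: "axiom_rc R H \<Delta>" and u: "u \<in> carrier H" and v: "v \<in> carrier H"
  shows "es (es u \<otimes>\<^sub>H es v) = es u \<otimes>\<^sub>H es v"
proof -
  have one: "\<one>\<^sub>H \<in> carrier H" by simp
  define y z where "y = es u" and "z = es v"
  have yz: "y \<in> carrier H" "z \<in> carrier H" using u v by (simp_all add: y_def z_def)
  have b1: "bilinear_map R H H H (\<lambda>a b. \<epsilon> b \<odot>\<^sub>H a)"
    "bilinear_map R H H H (\<lambda>a b. sw H (\<lambda>c d. \<epsilon> (b \<otimes>\<^sub>H d) \<odot>\<^sub>H (a \<otimes>\<^sub>H c)) z)"
    "bilinear_map R H H H (\<lambda>a w. \<epsilon> (y \<otimes>\<^sub>H w) \<odot>\<^sub>H a)"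
    by (intro bilinear_mapI linear_intros; simp add: yz)+
  have "y \<otimes>\<^sub>H z = sw H (\<lambda>a b. \<epsilon> b \<odot>\<^sub>H a) (y \<otimes>\<^sub>H z)"
    by (rule sw_counit_right[OF module_H linear_map_id, symmetric]) (simp add: yz)
  also have "\<dots> = sw H (\<lambda>a b. sw H (\<lambda>c d. \<epsilon> (b \<otimes>\<^sub>H d) \<odot>\<^sub>H (a \<otimes>\<^sub>H c)) z) y"
    by (rule sw_mult[OF module_H b1(1) yz])
  also have "\<dots> = sw H (\<lambda>a b. sw H (\<lambda>c d. \<epsilon> (y \<otimes>\<^sub>H b \<otimes>\<^sub>H d) \<odot>\<^sub>H (a \<otimes>\<^sub>H c)) z) \<one>\<^sub>H"
    unfolding y_def by (rule rc_comult_eps_s[OF rc module_H b1(2) u])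
  also have "\<dots> = sw H (\<lambda>a b. sw H (\<lambda>c d. \<epsilon> (y \<otimes>\<^sub>H (b \<otimes>\<^sub>H d)) \<odot>\<^sub>H (a \<otimes>\<^sub>H c)) z) \<one>\<^sub>H"
    by (rule sw_cong[OF one], rule sw_cong[OF yz(2)]) (simp add: m_assoc yz)
  also have "\<dots> = sw H (\<lambda>a w. \<epsilon> (y \<otimes>\<^sub>H w) \<odot>\<^sub>H a) (\<one>\<^sub>H \<otimes>\<^sub>H z)"
    by (rule sw_mult[OF module_H b1(3) one yz(2), symmetric])
  also have "\<dots> = sw H (\<lambda>a w. \<epsilon> (y \<otimes>\<^sub>H w) \<odot>\<^sub>H a) z"
    by (simp add: yz)
  also have "\<dots> = sw H (\<lambda>a b. \<epsilon> (y \<otimes>\<^sub>H (z \<otimes>\<^sub>H b)) \<odot>\<^sub>H a) \<one>\<^sub>H"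
    unfolding z_def by (rule rc_comult_eps_s[OF rc module_H b1(3) v])
  also have "\<dots> = es (y \<otimes>\<^sub>H z)"
    unfolding eps_sw[OF m_closed[OF yz]] by (rule sw_cong[OF one]) (simp add: m_assoc yz)
  finally show ?thesis by (simp add: y_def z_def)
qed

text \<open>Both sides are \<open>\<epsilon>(1\<^sub>1 h) \<epsilon>(y 1\<^sub>2)\<close>.\<close>

lemma counit_eps_s_eps_t:
  assumes y: "y \<in> carrier H" and h: "h \<in> carrier H"
  shows "\<epsilon> (y \<otimes>\<^sub>H et h) = \<epsilon> (es y \<otimes>\<^sub>H h)"
proof -
  let ?R = "regular_module R"
  have one: "\<one>\<^sub>H \<in> carrier H" by simp
  have "\<epsilon> (y \<otimes>\<^sub>H et h) = sw ?R (\<lambda>a b. \<epsilon> (a \<otimes>\<^sub>H h) \<odot>\<^bsub>?R\<^esub> \<epsilon> (y \<otimes>\<^sub>H b)) \<one>\<^sub>H"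
    by (rule linear_map_eps(1)[OF module_R linear_counit_comp h])
      (rule linear_mult_left[OF y linear_map_id module_H])
  also have "\<dots> = sw ?R (\<lambda>a b. \<epsilon> (y \<otimes>\<^sub>H b) \<odot>\<^bsub>?R\<^esub> \<epsilon> (a \<otimes>\<^sub>H h)) \<one>\<^sub>H"
    by (rule sw_cong[OF one]) (simp add: regular_simps R.m_comm y h)
  also have "\<dots> = \<epsilon> (es y \<otimes>\<^sub>H h)"
    by (rule linear_map_eps(2)[OF module_R linear_counit_comp y, symmetric])
      (rule linear_mult_right[OF h linear_map_id module_H])
  finally show ?thesis .
qed

text \<open>Since \<open>\<Delta>(1) = \<epsilon>\<^sub>s(1\<^sub>1) \<otimes> 1\<^sub>2\<close>, the value \<open>\<epsilon>\<^sub>t(\<epsilon>\<^sub>s(v) x)\<close> depends only on the scalars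
  \<open>\<epsilon>(y x)\<close> with \<open>y = \<epsilon>\<^sub>s(c) \<epsilon>\<^sub>s(v)\<close>, and such \<open>y\<close> is fixed by \<open>\<epsilon>\<^sub>s\<close>, so that
  \<open>\<epsilon>(y \<epsilon>\<^sub>t(h)) = \<epsilon>(\<epsilon>\<^sub>s(y) h) = \<epsilon>(y h)\<close>.\<close>

lemma rc_eps_t_absorb:
  assumes rc: "axiom_rc R H \<Delta>" and v: "v \<in> carrier H" and h: "h \<in> carrier H"
  shows "et (es v \<otimes>\<^sub>H et h) = et (es v \<otimes>\<^sub>H h)"
proof -
  have one: "\<one>\<^sub>H \<in> carrier H" by simp
  have et: "et y = sw H (\<lambda>c d. \<epsilon> (es c \<otimes>\<^sub>H y) \<odot>\<^sub>H d) \<one>\<^sub>H" if y: "y \<in> carrier H" for y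
    unfolding eps_sw[OF y]
    by (rule rc_one_eps_s[OF rc module_H, symmetric]) (rule bilinear_eps[OF module_H y linear_map_id])
  have e: "\<epsilon> (es c \<otimes>\<^sub>H (es v \<otimes>\<^sub>H et h)) = \<epsilon> (es c \<otimes>\<^sub>H (es v \<otimes>\<^sub>H h))" if c: "c \<in> carrier H" for c
    using counit_eps_s_eps_t[of "es c \<otimes>\<^sub>H es v" h]
    by (simp add: rc_eps_s_mult[OF rc c v] c v h m_assoc)
  show ?thesis
    unfolding et[OF m_closed[OF eps_closed(2)[OF v] eps_closed(1)[OF h]]]
      et[OF m_closed[OF eps_closed(2)[OF v] h]]
    by (rule sw_cong[OF one]) (simp only: e)
qed

lemma lc_sw:
  assumes "axiom_lc R H \<Delta>" "module R P" "trilinear_map R H H H P f"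
  shows "sw P (\<lambda>a b. sw P (\<lambda>c d. f a (b \<otimes>\<^sub>H c) d) \<one>\<^sub>H) \<one>\<^sub>H =
    sw P (\<lambda>a b. sw P (\<lambda>x y. f x y b) a) \<one>\<^sub>H"
proof -
  interpret O: prebialgebra R "opposite H" \<Delta> \<epsilon>
    by (rule prebialgebra_opposite) unfold_locales
  show ?thesis
    using O.rc_sw[of P f] assms by (simp add: axiom_rc_opposite sweedler_opposite)
qed


section \<open>\<open>\<epsilon>\<^sub>t\<close> is a coalgebra map\<close>

lemma eps_t_idem:
  assumes "axiom_rm R H \<Delta> \<epsilon> \<or> axiom_rc R H \<Delta>" and h: "h \<in> carrier H"
  shows "et (et h) = et h"
  using assms(1)
proof
  assume rm: "axiom_rm R H \<Delta> \<epsilon>"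
  show ?thesis using rm_eps_t_absorb[OF rm one_closed h] h by simp
next
  assume rc: "axiom_rc R H \<Delta>"
  have "et (et h) = sw H (\<lambda>a b. \<epsilon> (a \<otimes>\<^sub>H h) \<odot>\<^sub>H et b) \<one>\<^sub>H"
    by (rule linear_map_eps(1)[OF module_H linear_eps(1) h])
  also have "\<dots> = et h"
    unfolding eps_sw(1)[OF h]
    by (rule rc_one_eps_t[OF rc module_H bilinear_eps(1)[OF module_H h linear_map_id]])
  finally show ?thesis .
qed

text \<open>The point where (rm) and (rc) meet. Under (rm) the right-hand side comes from the formula for
  \<open>\<epsilon>\<^sub>t(b d)\<close> and coassociativity; under (rc) one expands the outer \<open>\<epsilon>\<^sub>t\<close> of \<open>\<epsilon>\<^sub>t(\<epsilon>\<^sub>t(b d))\<close>, which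
  creates the product of two copies of \<open>\<Delta>(1)\<close> that occurs in (rc).\<close>

lemma one_mult_eps_t:
  assumes "axiom_rm R H \<Delta> \<epsilon> \<or> axiom_rc R H \<Delta>" and P: "module R P"
    and G: "bilinear_map R H H P (\<lambda>x y. G x (et y))" and d: "d \<in> carrier H"
  shows "sw P (\<lambda>a b. G a (et (b \<otimes>\<^sub>H d))) \<one>\<^sub>H =
    sw P (\<lambda>r q. sw P (\<lambda>a p. \<epsilon> (p \<otimes>\<^sub>H d) \<odot>\<^sub>P G a (et q)) r) \<one>\<^sub>H"
proof -
  interpret P: module R P by (rule P)
  have one: "\<one>\<^sub>H \<in> carrier H" by simp
  have t: "trilinear_map R H H H P (\<lambda>a p q. \<epsilon> (p \<otimes>\<^sub>H d) \<odot>\<^sub>P G a (et q))"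
    by (intro trilinear_mapI linear_intros bilinear_mapD[OF G] P; simp add: d)
  from assms(1) show ?thesis
  proof
    assume rm: "axiom_rm R H \<Delta> \<epsilon>"
    have "sw P (\<lambda>a b. G a (et (b \<otimes>\<^sub>H d))) \<one>\<^sub>H =
        sw P (\<lambda>a b. sw P (\<lambda>p q. \<epsilon> (p \<otimes>\<^sub>H d) \<odot>\<^sub>P G a (et q)) b) \<one>\<^sub>H"
      by (rule sw_cong[OF one], rule rm_sw_eps_t[OF rm P bilinear_mapD(2)[OF G] _ d])
    also have "\<dots> = sw P (\<lambda>r q. sw P (\<lambda>a p. \<epsilon> (p \<otimes>\<^sub>H d) \<odot>\<^sub>P G a (et q)) r) \<one>\<^sub>H"
      by (rule sw_coassoc[OF P t one, symmetric])
    finally show ?thesis .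
  next
    assume rc: "axiom_rc R H \<Delta>"
    have "sw P (\<lambda>a b. G a (et (b \<otimes>\<^sub>H d))) \<one>\<^sub>H =
        sw P (\<lambda>a b. G a (et (et (b \<otimes>\<^sub>H d)))) \<one>\<^sub>H"
      by (rule sw_cong[OF one]) (simp add: eps_t_idem[OF assms(1)] d)
    also have "\<dots> = sw P (\<lambda>a b. sw P (\<lambda>c q. \<epsilon> (c \<otimes>\<^sub>H (b \<otimes>\<^sub>H d)) \<odot>\<^sub>P G a (et q)) \<one>\<^sub>H) \<one>\<^sub>H"
      by (rule sw_cong[OF one], rule linear_map_eps(1)[OF P bilinear_mapD(2)[OF G]]) (simp_all add: d)
    also have "\<dots> = sw P (\<lambda>a b. sw P (\<lambda>c q. \<epsilon> (c \<otimes>\<^sub>H b \<otimes>\<^sub>H d) \<odot>\<^sub>P G a (et q)) \<one>\<^sub>H) \<one>\<^sub>H"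
      by (rule sw_cong[OF one], rule sw_cong[OF one]) (simp add: m_assoc d)
    also have "\<dots> = sw P (\<lambda>r q. sw P (\<lambda>a p. \<epsilon> (p \<otimes>\<^sub>H d) \<odot>\<^sub>P G a (et q)) r) \<one>\<^sub>H"
      by (rule rc_sw[OF rc P t])
    finally show ?thesis .
  qed
qed

text \<open>From \<open>\<Delta>(h) = \<Delta>(1) \<Delta>(h)\<close> and the preceding lemma,
  \<open>\<epsilon>\<^sub>t(h\<^sub>1) \<otimes> \<epsilon>\<^sub>t(h\<^sub>2) = \<epsilon>\<^sub>t(1\<^sub>1 h\<^sub>1) \<otimes> \<epsilon>(1\<^sub>2 h\<^sub>2) \<epsilon>\<^sub>t(1\<^sub>3)\<close>, and \<open>1\<^sub>1 h\<^sub>1 \<epsilon>(1\<^sub>2 h\<^sub>2)\<close> is \<open>1\<^sub>1 h\<close> by the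
  counit law. The map \<open>B\<close> stands for tensors over \<open>H\<^sub>t\<close>, so bilinearity is assumed after \<open>\<epsilon>\<^sub>t\<close>.\<close>

lemma sw_eps_t_eps_t:
  assumes ax: "axiom_rm R H \<Delta> \<epsilon> \<or> axiom_rc R H \<Delta>" and P: "module R P"
    and B: "bilinear_map R H H P (\<lambda>x y. B (et x) (et y))" and h: "h \<in> carrier H"
  shows "sw P (\<lambda>a b. B (et a) (et b)) h = sw P (\<lambda>a b. B (et (a \<otimes>\<^sub>H h)) (et b)) \<one>\<^sub>H"
proof -
  interpret P: module R P by (rule P)
  have one: "\<one>\<^sub>H \<in> carrier H" by simp
  note Bc = bilinear_mapD(3)[OF B]
  have l: "(\<lambda>x. B (et (g x)) (et y)) \<in> linear_maps R H P"
    if "y \<in> carrier H" "g \<in> linear_maps R H H" for y g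
    by (rule linear_map_comp[OF bilinear_mapD(1)[OF B that(1)] that(2)])
  note l_right = l[OF _ linear_mult_right[OF _ linear_map_id module_H]]
  have "sw P (\<lambda>a b. B (et a) (et b)) h = sw P (\<lambda>a b. B (et a) (et b)) (\<one>\<^sub>H \<otimes>\<^sub>H h)"
    by (simp add: h)
  also have "\<dots> = sw P (\<lambda>a b. sw P (\<lambda>c d. B (et (a \<otimes>\<^sub>H c)) (et (b \<otimes>\<^sub>H d))) h) \<one>\<^sub>H"
    by (rule sw_mult[OF P B one h])
  also have "\<dots> = sw P (\<lambda>c d. sw P (\<lambda>a b. B (et (a \<otimes>\<^sub>H c)) (et (b \<otimes>\<^sub>H d))) \<one>\<^sub>H) h"
    by (rule sw_swap[OF P one h]) (simp add: Bc)
  also have "\<dots> = sw P (\<lambda>c d. sw P (\<lambda>r q. sw P (\<lambda>a p.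
      \<epsilon> (p \<otimes>\<^sub>H d) \<odot>\<^sub>P B (et (a \<otimes>\<^sub>H c)) (et q)) r) \<one>\<^sub>H) h"
    by (rule sw_cong[OF h], rule one_mult_eps_t[OF ax P, where G = "\<lambda>a y. B (et (a \<otimes>\<^sub>H c)) y" for c])
      (intro bilinear_mapI l_right bilinear_mapD(2)[OF B]; simp)
  also have "\<dots> = sw P (\<lambda>r q. sw P (\<lambda>c d. sw P (\<lambda>a p.
      \<epsilon> (p \<otimes>\<^sub>H d) \<odot>\<^sub>P B (et (a \<otimes>\<^sub>H c)) (et q)) r) h) \<one>\<^sub>H"
    by (rule sw_swap[OF P h one]) (simp add: Bc sw_closed[OF P])
  also have "\<dots> = sw P (\<lambda>r q. sw P (\<lambda>a p. sw P (\<lambda>c d.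
      \<epsilon> (p \<otimes>\<^sub>H d) \<odot>\<^sub>P B (et (a \<otimes>\<^sub>H c)) (et q)) h) r) \<one>\<^sub>H"
    by (rule sw_cong[OF one], rule sw_swap[OF P h]) (simp_all add: Bc)
  also have "\<dots> = sw P (\<lambda>r q. sw P (\<lambda>u v. \<epsilon> v \<odot>\<^sub>P B (et u) (et q)) (r \<otimes>\<^sub>H h)) \<one>\<^sub>H"
    by (rule sw_cong[OF one], rule sw_mult[OF P _ _ h, symmetric])
      (intro bilinear_mapI linear_intros bilinear_mapD(1)[OF B] P; simp add: Bc)
  also have "\<dots> = sw P (\<lambda>r q. B (et (r \<otimes>\<^sub>H h)) (et q)) \<one>\<^sub>H"
    by (rule sw_cong[OF one], rule sw_counit_right[OF P bilinear_mapD(1)[OF B]]) (simp_all add: h)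
  finally show ?thesis .
qed

text \<open>Under (rc) the map \<open>\<epsilon>\<^sub>t\<close> is absorbed only after a factor in \<open>H\<^sub>s\<close>, so \<open>1\<^sub>1\<close> is replaced by
  \<open>\<epsilon>\<^sub>s(1\<^sub>1)\<close> before the absorption and back afterwards.\<close>

lemma sw_one_eps_t_absorb:
  assumes "axiom_rm R H \<Delta> \<epsilon> \<or> axiom_rc R H \<Delta>" and P: "module R P"
    and B: "bilinear_map R H H P (\<lambda>x y. B (et x) (et y))" and h: "h \<in> carrier H"
  shows "sw P (\<lambda>a b. B (et (a \<otimes>\<^sub>H et h)) (et b)) \<one>\<^sub>H =
    sw P (\<lambda>a b. B (et (a \<otimes>\<^sub>H h)) (et b)) \<one>\<^sub>H"
  using assms(1)
proof
  assume rm: "axiom_rm R H \<Delta> \<epsilon>"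
  show ?thesis
    by (rule sw_cong) (simp_all add: rm_eps_t_absorb[OF rm _ h])
next
  assume rc: "axiom_rc R H \<Delta>"
  have bil: "bilinear_map R H H P (\<lambda>a b. B (et (a \<otimes>\<^sub>H k)) (et b))" if "k \<in> carrier H" for k
    by (rule bilinear_map_comp[OF B linear_mult_right[OF that linear_map_id module_H] linear_map_id])
  have "sw P (\<lambda>a b. B (et (a \<otimes>\<^sub>H et h)) (et b)) \<one>\<^sub>H =
      sw P (\<lambda>a b. B (et (es a \<otimes>\<^sub>H et h)) (et b)) \<one>\<^sub>H"
    by (rule rc_one_eps_s[OF rc P bil, symmetric]) (simp add: h)
  also have "\<dots> = sw P (\<lambda>a b. B (et (es a \<otimes>\<^sub>H h)) (et b)) \<one>\<^sub>H"
    by (rule sw_cong) (simp_all add: rc_eps_t_absorb[OF rc _ h])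
  also have "\<dots> = sw P (\<lambda>a b. B (et (a \<otimes>\<^sub>H h)) (et b)) \<one>\<^sub>H"
    by (rule rc_one_eps_s[OF rc P bil[OF h]])
  finally show ?thesis .
qed

text \<open>With \<open>B x y = x \<otimes> y\<close> in \<open>H\<^sub>t \<otimes> H\<^sub>t\<close> this is \<open>\<Delta>\<^sub>t(\<epsilon>\<^sub>t(h)) = \<epsilon>\<^sub>t(h\<^sub>1) \<otimes> \<epsilon>\<^sub>t(h\<^sub>2)\<close>.\<close>

lemma eps_t_comult:
  assumes ax: "axiom_rm R H \<Delta> \<epsilon> \<or> axiom_rc R H \<Delta>" and P: "module R P"
    and B: "bilinear_map R H H P (\<lambda>x y. B (et x) (et y))" and h: "h \<in> carrier H"
  shows "sw P (\<lambda>a b. B (et (a \<otimes>\<^sub>H et h)) (et b)) \<one>\<^sub>H = sw P (\<lambda>a b. B (et a) (et b)) h"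
  unfolding sw_eps_t_eps_t[OF ax P B h] by (rule sw_one_eps_t_absorb[OF ax P B h])


section \<open>Consequences of (c)\<close>

lemma rc_eps_t_bar_eps_t:
  assumes rc: "axiom_rc R H \<Delta>" and h: "h \<in> carrier H"
  shows "et (bt h) = bt h"
proof -
  have "et (bt h) = sw H (\<lambda>a b. \<epsilon> (h \<otimes>\<^sub>H a) \<odot>\<^sub>H et b) \<one>\<^sub>H"
    by (rule linear_map_eps(3)[OF module_H linear_eps(1) h])
  also have "\<dots> = bt h"
    unfolding eps_sw(3)[OF h]
    by (rule rc_one_eps_t[OF rc module_H bilinear_eps(2)[OF module_H h linear_map_id]])
  finally show ?thesis .
qed

lemma lc_bar_eps_t_eps_t:
  assumes lc: "axiom_lc R H \<Delta>" and h: "h \<in> carrier H"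
  shows "bt (et h) = et h"
proof -
  interpret O: prebialgebra R "opposite H" \<Delta> \<epsilon>
    by (rule prebialgebra_opposite) unfold_locales
  show ?thesis
    using O.rc_eps_t_bar_eps_t[of h] lc h by (simp add: axiom_rc_opposite eps_opposite)
qed

lemma lc_one_bar_eps_t:
  assumes lc: "axiom_lc R H \<Delta>" and "module R P" "bilinear_map R H H P f"
  shows "sw P (\<lambda>a b. f a (bt b)) \<one>\<^sub>H = sw P f \<one>\<^sub>H"
proof -
  interpret O: prebialgebra R "opposite H" \<Delta> \<epsilon>
    by (rule prebialgebra_opposite) unfold_locales
  show ?thesis
    using O.rc_one_eps_t[of P f] assms by (simp add: axiom_rc_opposite eps_opposite sweedler_opposite)
qed

text \<open>The two products involve \<open>1\<^sub>1 \<otimes> 1\<^sub>1\<^sub>' 1\<^sub>2 \<otimes> 1\<^sub>2\<^sub>'\<close> and \<open>1\<^sub>1 \<otimes> 1\<^sub>2 1\<^sub>1\<^sub>' \<otimes> 1\<^sub>2\<^sub>'\<close>, which are both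
  \<open>\<Delta>\<^sup>2(1)\<close>. So both are \<open>\<epsilon>(1\<^sub>1 h) 1\<^sub>2 \<epsilon>(k 1\<^sub>3)\<close>.\<close>

lemma eps_s_eps_t_commute:
  assumes lc: "axiom_lc R H \<Delta>" and rc: "axiom_rc R H \<Delta>"
    and h: "h \<in> carrier H" and k: "k \<in> carrier H"
  shows "es k \<otimes>\<^sub>H et h = et h \<otimes>\<^sub>H es k"
proof -
  have one: "\<one>\<^sub>H \<in> carrier H" by simp
  let ?t = "\<lambda>a p d. \<epsilon> (a \<otimes>\<^sub>H h) \<odot>\<^sub>H (\<epsilon> (k \<otimes>\<^sub>H d) \<odot>\<^sub>H p)"
  have t: "trilinear_map R H H H H ?t"
    by (intro trilinear_mapI linear_intros; simp add: h k)
  have inner: "\<epsilon> (a \<otimes>\<^sub>H h) \<odot>\<^sub>H g (es k) = sw H (\<lambda>c d. \<epsilon> (a \<otimes>\<^sub>H h) \<odot>\<^sub>H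
      (\<epsilon> (k \<otimes>\<^sub>H d) \<odot>\<^sub>H g c)) \<one>\<^sub>H"
    if a: "a \<in> carrier H" and g: "g \<in> linear_maps R H H" for a g
    unfolding linear_map_eps(2)[OF module_H g k]
    by (rule smult_sw[OF module_H _ one, symmetric]) (simp_all add: a h k linear_mapsD(1)[OF g])
  have "es k \<otimes>\<^sub>H et h = sw H (\<lambda>a b. \<epsilon> (a \<otimes>\<^sub>H h) \<odot>\<^sub>H (es k \<otimes>\<^sub>H b)) \<one>\<^sub>H"
    by (rule linear_map_eps(1)[OF module_H _ h])
      (rule linear_mult_left[OF eps_closed(2)[OF k] linear_map_id module_H])
  also have "\<dots> = sw H (\<lambda>a b. sw H (\<lambda>c d. ?t a (c \<otimes>\<^sub>H b) d) \<one>\<^sub>H) \<one>\<^sub>H"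
    by (rule sw_cong[OF one], rule inner) (assumption | rule linear_mult_right linear_map_id module_H)+
  also have "\<dots> = sw H (\<lambda>r d. sw H (\<lambda>a p. ?t a p d) r) \<one>\<^sub>H"
    by (rule rc_sw[OF rc module_H t])
  also have "\<dots> = sw H (\<lambda>a b. sw H (\<lambda>c d. ?t a (b \<otimes>\<^sub>H c) d) \<one>\<^sub>H) \<one>\<^sub>H"
    by (rule lc_sw[OF lc module_H t, symmetric])
  also have "\<dots> = sw H (\<lambda>a b. \<epsilon> (a \<otimes>\<^sub>H h) \<odot>\<^sub>H (b \<otimes>\<^sub>H es k)) \<one>\<^sub>H"
    by (rule sw_cong[OF one], rule inner[symmetric])
      (assumption | rule linear_mult_left linear_map_id module_H)+
  also have "\<dots> = et h \<otimes>\<^sub>H es k"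
    by (rule linear_map_eps(1)[OF module_H _ h, symmetric])
      (rule linear_mult_right[OF eps_closed(2)[OF k] linear_map_id module_H])
  finally show ?thesis .
qed

text \<open>Put \<open>z = \<epsilon>\<^sub>t(h)\<close>. With two copies of \<open>\<Delta>(1) = \<epsilon>\<^sub>s(1\<^sub>1) \<otimes> 1\<^sub>2\<close> the two sides become the sums of
  \<open>\<epsilon>(z \<epsilon>\<^sub>s(a) \<epsilon>\<^sub>s(c)) B(\<epsilon>\<^sub>t(d), \<epsilon>\<^sub>t(b))\<close> and of \<open>\<epsilon>(\<epsilon>\<^sub>s(a) \<epsilon>\<^sub>s(c) z) B(\<epsilon>\<^sub>t(d), \<epsilon>\<^sub>t(b))\<close> over \<open>a \<otimes> b\<close> and \<open>c \<otimes> d\<close> in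
  \<open>\<Delta>(1)\<close>, and \<open>z\<close> commutes with \<open>H\<^sub>s\<close>.\<close>

lemma c_bar_eps_t_comult:
  assumes lc: "axiom_lc R H \<Delta>" and rc: "axiom_rc R H \<Delta>" and P: "module R P"
    and B: "bilinear_map R H H P (\<lambda>x y. B (et x) (et y))" and h: "h \<in> carrier H"
  shows "sw P (\<lambda>a b. B (bt (et h \<otimes>\<^sub>H a)) (bt b)) \<one>\<^sub>H =
    sw P (\<lambda>a b. B (et b) (et (a \<otimes>\<^sub>H et h))) \<one>\<^sub>H"
proof -
  interpret P: module R P by (rule P)
  have one: "\<one>\<^sub>H \<in> carrier H" by simp
  have z: "et h \<in> carrier H" using h by simp
  let ?z = "et h" and ?B = "\<lambda>x y. B (et x) (et y)"
  note Bc = bilinear_mapD(3)[OF B] and idem = eps_t_idem[OF disjI2[OF rc]]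
  have bil: "bilinear_map R H H P (\<lambda>a b. ?B (bt (?z \<otimes>\<^sub>H a)) b)"
    by (intro bilinear_map_comp[OF B] linear_map_comp[OF linear_eps(3)]
        linear_mult_left linear_map_id module_H z)
  have bil': "bilinear_map R H H P (\<lambda>a b. ?B b (et (a \<otimes>\<^sub>H ?z)))"
    by (intro bilinear_mapI linear_map_comp[OF bilinear_mapD(1)[OF B]] linear_map_id
        linear_map_comp[OF bilinear_mapD(2)[OF B]] linear_map_comp[OF linear_eps(1)]
        linear_mult_right module_H z)
      (simp_all add: z)
  have "sw P (\<lambda>a b. B (bt (?z \<otimes>\<^sub>H a)) (bt b)) \<one>\<^sub>H =
      sw P (\<lambda>a b. ?B (bt (?z \<otimes>\<^sub>H a)) (bt b)) \<one>\<^sub>H"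
    by (rule sw_cong[OF one]) (simp add: rc_eps_t_bar_eps_t[OF rc] h)
  also have "\<dots> = sw P (\<lambda>a b. ?B (bt (?z \<otimes>\<^sub>H a)) b) \<one>\<^sub>H"
    by (rule lc_one_bar_eps_t[OF lc P bil])
  also have "\<dots> = sw P (\<lambda>a b. ?B (bt (?z \<otimes>\<^sub>H es a)) b) \<one>\<^sub>H"
    by (rule rc_one_eps_s[OF rc P bil, symmetric])
  also have "\<dots> = sw P (\<lambda>a b. sw P (\<lambda>c d. \<epsilon> (?z \<otimes>\<^sub>H es a \<otimes>\<^sub>H es c) \<odot>\<^sub>P ?B d b) \<one>\<^sub>H) \<one>\<^sub>H"
  proof (rule sw_cong[OF one])
    fix a b assume a: "a \<in> carrier H" and b: "b \<in> carrier H"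
    have y: "?z \<otimes>\<^sub>H es a \<in> carrier H" using z a by simp
    have "?B (bt (?z \<otimes>\<^sub>H es a)) b =
        sw P (\<lambda>c d. \<epsilon> (?z \<otimes>\<^sub>H es a \<otimes>\<^sub>H c) \<odot>\<^sub>P ?B d b) \<one>\<^sub>H"
      by (rule linear_map_eps(3)[OF P bilinear_mapD(1)[OF B b] y])
    also have "\<dots> = sw P (\<lambda>c d. \<epsilon> (?z \<otimes>\<^sub>H es a \<otimes>\<^sub>H es c) \<odot>\<^sub>P ?B d b) \<one>\<^sub>H"
      by (rule rc_one_eps_s[OF rc P, symmetric])
        (rule bilinear_eps(2)[OF P y bilinear_mapD(1)[OF B b]])
    finally show "?B (bt (?z \<otimes>\<^sub>H es a)) b = \<dots>" .
  qed
  also have "\<dots> = sw P (\<lambda>a b. sw P (\<lambda>c d. \<epsilon> (es a \<otimes>\<^sub>H (es c \<otimes>\<^sub>H ?z)) \<odot>\<^sub>P ?B d b) \<one>\<^sub>H) \<one>\<^sub>H"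
  proof (rule sw_cong[OF one], rule sw_cong[OF one])
    fix a b c d assume *: "a \<in> carrier H" "b \<in> carrier H" "c \<in> carrier H" "d \<in> carrier H"
    note comm = eps_s_eps_t_commute[OF lc rc h]
    have "?z \<otimes>\<^sub>H es a \<otimes>\<^sub>H es c = es a \<otimes>\<^sub>H (?z \<otimes>\<^sub>H es c)"
      using * z by (simp add: comm[OF *(1), symmetric] m_assoc)
    also have "\<dots> = es a \<otimes>\<^sub>H (es c \<otimes>\<^sub>H ?z)"
      by (simp only: comm[OF *(3)])
    finally show "\<epsilon> (?z \<otimes>\<^sub>H es a \<otimes>\<^sub>H es c) \<odot>\<^sub>P ?B d b =
        \<epsilon> (es a \<otimes>\<^sub>H (es c \<otimes>\<^sub>H ?z)) \<odot>\<^sub>P ?B d b" by simp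
  qed
  also have "\<dots> = sw P (\<lambda>c d. sw P (\<lambda>a b. \<epsilon> (es a \<otimes>\<^sub>H (es c \<otimes>\<^sub>H ?z)) \<odot>\<^sub>P ?B d b) \<one>\<^sub>H) \<one>\<^sub>H"
    by (rule sw_swap[OF P one one]) (simp add: Bc h)
  also have "\<dots> = sw P (\<lambda>c d. ?B d (et (es c \<otimes>\<^sub>H ?z))) \<one>\<^sub>H"
  proof (rule sw_cong[OF one])
    fix c d assume c: "c \<in> carrier H" and d: "d \<in> carrier H"
    have y: "es c \<otimes>\<^sub>H ?z \<in> carrier H" using z c by simp
    have "?B d (et (es c \<otimes>\<^sub>H ?z)) =
        sw P (\<lambda>a b. \<epsilon> (a \<otimes>\<^sub>H (es c \<otimes>\<^sub>H ?z)) \<odot>\<^sub>P ?B d b) \<one>\<^sub>H"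
      by (rule linear_map_eps(1)[OF P bilinear_mapD(2)[OF B d] y])
    also have "\<dots> = sw P (\<lambda>a b. \<epsilon> (es a \<otimes>\<^sub>H (es c \<otimes>\<^sub>H ?z)) \<odot>\<^sub>P ?B d b) \<one>\<^sub>H"
      by (rule rc_one_eps_s[OF rc P, symmetric])
        (rule bilinear_eps(1)[OF P y bilinear_mapD(2)[OF B d]])
    finally show "sw P (\<lambda>a b. \<epsilon> (es a \<otimes>\<^sub>H (es c \<otimes>\<^sub>H ?z)) \<odot>\<^sub>P ?B d b) \<one>\<^sub>H =
        ?B d (et (es c \<otimes>\<^sub>H ?z))" ..
  qed
  also have "\<dots> = sw P (\<lambda>a b. ?B b (et (a \<otimes>\<^sub>H ?z))) \<one>\<^sub>H"
    by (rule rc_one_eps_s[OF rc P bil'])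
  also have "\<dots> = sw P (\<lambda>a b. B (et b) (et (a \<otimes>\<^sub>H ?z))) \<one>\<^sub>H"
    by (rule sw_cong[OF one]) (simp add: idem h)
  finally show ?thesis .
qed

end


section \<open>Quotient coalgebras\<close>

lemma tensor_lift_map:
  assumes "module R M" "module R N" "module R M'" "module R N'" "module R P"
    and f: "f \<in> linear_maps R M M'" and g: "g \<in> linear_maps R N N'"
    and b: "bilinear_map R M' N' P b" and X: "X \<in> carrier (tensor R M N)"
  shows "tensor_lift P b (tensor_map R M' N' f g X) = tensor_lift P (\<lambda>x y. b (f x) (g y)) X"
proof -
  interpret MN: two_modules R M N using assms(1,2) by (simp add: two_modules_def)
  interpret MN': two_modules R M' N' using assms(3,4) by (simp add: two_modules_def)
  note bt = bilinear_map_comp[OF MN'.bilinear_tens f g]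
  have "tensor_lift P b (tensor_map R M' N' f g X) =
      tensor_lift P (\<lambda>x y. tensor_lift P b (tens R M' N' (f x) (g y))) X"
    unfolding tensor_map_def
    by (rule MN.linear_map_tensor_lift[OF MN'.module_tensor assms(5) bt
          MN'.linear_tensor_lift[OF assms(5) b] X])
  also have "\<dots> = tensor_lift P (\<lambda>x y. b (f x) (g y)) X"
    by (rule MN.tensor_lift_cong[OF assms(5) bilinear_map_comp[OF b f g] X, symmetric])
      (rule MN'.tensor_lift_tens[OF assms(5) b linear_mapsD(1)[OF f] linear_mapsD(1)[OF g], symmetric])
  finally show ?thesis .
qed

lemma linear_tensor_map:
  assumes "module R M" "module R N" "module R M'" "module R N'"
    and f: "f \<in> linear_maps R M M'" and g: "g \<in> linear_maps R N N'"
  shows "tensor_map R M' N' f g \<in> linear_maps R (tensor R M N) (tensor R M' N')"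
proof -
  interpret MN: two_modules R M N using assms(1,2) by (simp add: two_modules_def)
  interpret MN': two_modules R M' N' using assms(3,4) by (simp add: two_modules_def)
  show ?thesis
    unfolding tensor_map_def
    by (rule MN.linear_tensor_lift[OF MN'.module_tensor bilinear_map_comp[OF MN'.bilinear_tens f g]])
qed

lemma linear_map_descends:
  assumes "module R C" and p: "p \<in> linear_maps R C D" and surj: "p ` carrier C = carrier D"
    and q: "q \<in> linear_maps R C E" and fp: "\<And>c. c \<in> carrier C \<Longrightarrow> f (p c) = q c"
  shows "f \<in> linear_maps R D E"
proof -
  interpret C: module R C by fact
  show ?thesis
  proof (rule linear_mapsI)
    fix x assume "x \<in> carrier D"
    then obtain c where c: "c \<in> carrier C" "x = p c" using surj by blast
    show "f x \<in> carrier E"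
      unfolding c(2) fp[OF c(1)] by (rule linear_mapsD(1)[OF q c(1)])
    show "f (r \<odot>\<^sub>D x) = r \<odot>\<^sub>E f x" if r: "r \<in> carrier R" for r
      unfolding c(2) linear_mapsD(3)[OF p r c(1), symmetric] fp[OF c(1)] fp[OF C.smult_closed[OF r c(1)]]
      by (rule linear_mapsD(3)[OF q r c(1)])
    fix y assume "y \<in> carrier D"
    then obtain d where d: "d \<in> carrier C" "y = p d" using surj by blast
    show "f (x \<oplus>\<^sub>D y) = f x \<oplus>\<^sub>E f y"
      unfolding c(2) d(2) linear_mapsD(2)[OF p c(1) d(1), symmetric] fp[OF c(1)] fp[OF d(1)]
        fp[OF C.M.add.m_closed[OF c(1) d(1)]]
      by (rule linear_mapsD(2)[OF q c(1) d(1)])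
  qed
qed

text \<open>As \<open>p\<close> is surjective, every law for \<open>\<Delta>'\<close> may be checked on elements \<open>p c\<close>, where it is the image
  of the law for \<open>\<Delta>\<close>.\<close>

lemma quotient_coalgebra_hom:
  fixes D :: "('k, 'd, 'e) module_scheme"
  assumes C: "coalgebra R C \<Delta> \<epsilon>" and D: "module R D"
    and p: "p \<in> linear_maps R C D" and surj: "p ` carrier C = carrier D"
    and comult: "\<And>c. c \<in> carrier C \<Longrightarrow> \<Delta>' (p c) = tensor_map R D D p p (\<Delta> c)"
    and counit: "\<And>c. c \<in> carrier C \<Longrightarrow> \<epsilon>' (p c) = \<epsilon> c"
  shows "coalgebra_hom R C \<Delta> \<epsilon> D \<Delta>' \<epsilon>' p"
proof -
  interpret C: coalgebra R C \<Delta> \<epsilon> by fact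
  interpret D: module R D by fact
  interpret DD: two_modules R D D by unfold_locales
  interpret TR: two_modules R D "tensor R D D"
    by (rule two_modules.intro) unfold_locales
  note mC = C.module_axioms and mT = TR.module_tensor
  have pc: "p c \<in> carrier D" if "c \<in> carrier C" for c
    by (rule linear_mapsD(1)[OF p that])
  have lin: "\<Delta>' \<in> linear_maps R D (tensor R D D)"
    by (rule linear_map_descends[OF mC p surj
          linear_map_comp[OF linear_tensor_map[OF mC mC D D p p] C.comult_linear] comult])
  have lin': "\<epsilon>' \<in> linear_maps R D (regular_module R)"
    by (rule linear_map_descends[OF mC p surj C.counit_linear counit])
  have lift: "tensor_lift P b (\<Delta>' (p c)) = tensor_lift P (\<lambda>x y. b (p x) (p y)) (\<Delta> c)"
    if "module R P" "bilinear_map R D D P b" "c \<in> carrier C"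
    for P :: "('k, ('d \<times> ('d \<times> 'd) list set) list set) module" and b c
    unfolding comult[OF that(3)]
    by (rule tensor_lift_map[OF mC mC D D that(1) p p that(2) C.comult_closed[OF that(3)]])
  let ?T = "tensor R D (tensor R D D)"
  let ?t = "\<lambda>x y z. tens R D (tensor R D D) x (tens R D D y z)"
  note t = trilinear_tens_right[OF D D D]
  have tp: "trilinear_map R C C C ?T (\<lambda>x y z. ?t (p x) (p y) (p z))"
    by (intro trilinear_mapI linear_map_comp[OF trilinear_mapD(1)[OF t] p]
        linear_map_comp[OF trilinear_mapD(2)[OF t] p] linear_map_comp[OF trilinear_mapD(3)[OF t] p] pc)
  have coassoc: "tensor_assoc R D D D (tensor_map R (tensor R D D) D \<Delta>' (\<lambda>x. x) (\<Delta>' d)) =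
      tensor_map R D (tensor R D D) (\<lambda>x. x) \<Delta>' (\<Delta>' d)" if d: "d \<in> carrier D" for d
  proof -
    obtain c where c: "c \<in> carrier C" "d = p c" using d surj by blast
    note X = linear_mapsD(1)[OF lin d] and Y = C.comult_closed[OF c(1)]
    note left = bilinear_lift_comult_left[OF D mT lin t]
      and right = bilinear_lift_comult_right[OF D mT lin t]
    have "tensor_assoc R D D D (tensor_map R (tensor R D D) D \<Delta>' (\<lambda>x. x) (\<Delta>' d)) =
        tensor_lift ?T (\<lambda>a b. tensor_lift ?T (\<lambda>x y. ?t x y b) (\<Delta>' a)) (\<Delta>' d)"
      by (rule tensor_assoc_comult[OF D lin X])
    also have "\<dots> = tensor_lift ?T (\<lambda>a b. tensor_lift ?T (\<lambda>x y. ?t x y (p b)) (\<Delta>' (p a))) (\<Delta> c)"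
      unfolding c(2) by (rule lift[OF mT left c(1)])
    also have "\<dots> = tensor_lift ?T (\<lambda>a b. tensor_lift ?T (\<lambda>x y. ?t (p x) (p y) (p b)) (\<Delta> a)) (\<Delta> c)"
      by (rule C.CC.tensor_lift_cong[OF mT bilinear_map_comp[OF left p p] Y])
        (rule lift[OF mT trilinear_mapD(5)[OF t pc]])
    also have "\<dots> = tensor_lift ?T (\<lambda>a b. tensor_lift ?T (\<lambda>x y. ?t (p a) (p x) (p y)) (\<Delta> b)) (\<Delta> c)"
      using C.sw_coassoc[OF mT tp c(1)]
      by (simp only: C.lift_lift_left_eq_sw[OF mT tp c(1)]
          C.lift_lift_right_eq_sw[OF mT tp c(1)])
    also have "\<dots> = tensor_lift ?T (\<lambda>a b. tensor_lift ?T (\<lambda>x y. ?t (p a) x y) (\<Delta>' (p b))) (\<Delta> c)"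
      by (rule C.CC.tensor_lift_cong[OF mT bilinear_map_comp[OF right p p] Y, symmetric])
        (rule lift[OF mT trilinear_mapD(6)[OF t pc]])
    also have "\<dots> = tensor_lift ?T (\<lambda>a b. tensor_lift ?T (\<lambda>x y. ?t a x y) (\<Delta>' b)) (\<Delta>' d)"
      unfolding c(2) by (rule lift[OF mT right c(1), symmetric])
    also have "\<dots> = tensor_map R D (tensor R D D) (\<lambda>x. x) \<Delta>' (\<Delta>' d)"
      by (rule tensor_map_comult[OF D lin X, symmetric])
    finally show ?thesis .
  qed
  have counits: "tensor_lift D (\<lambda>x y. \<epsilon>' x \<odot>\<^sub>D y) (\<Delta>' d) = d"
    "tensor_lift D (\<lambda>x y. \<epsilon>' y \<odot>\<^sub>D x) (\<Delta>' d) = d" if d: "d \<in> carrier D" for d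
  proof -
    obtain c where c: "c \<in> carrier C" "d = p c" using d surj by blast
    note Y = C.comult_closed[OF c(1)]
    have ec: "\<epsilon>' x \<in> carrier R" if "x \<in> carrier D" for x
      using linear_mapsD(1)[OF lin' that] by (simp add: regular_module_def)
    have smult: "(\<lambda>x. \<epsilon>' x \<odot>\<^sub>D y) \<in> linear_maps R D D" if "y \<in> carrier D" for y
    proof -
      have "(\<lambda>r. r \<odot>\<^sub>D y) \<in> linear_maps R (regular_module R) D"
        using that by (intro linear_mapsI) (simp_all add: regular_module_def D.smult_l_distr D.smult_assoc1)
      from linear_map_comp[OF this lin'] show ?thesis .
    qed
    have bl: "bilinear_map R D D D (\<lambda>x y. \<epsilon>' x \<odot>\<^sub>D y)" and br: "bilinear_map R D D D (\<lambda>x y. \<epsilon>' y \<odot>\<^sub>D x)"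
      by (intro bilinear_mapI smult linear_map_smult[OF D ec]; assumption)+
    have "tensor_lift D (\<lambda>x y. \<epsilon>' x \<odot>\<^sub>D y) (\<Delta>' d) = tensor_lift D (\<lambda>x y. \<epsilon>' (p x) \<odot>\<^sub>D p y) (\<Delta> c)"
      unfolding c(2) comult[OF c(1)] by (rule tensor_lift_map[OF mC mC D D D p p bl Y])
    also have "\<dots> = C.sw D (\<lambda>x y. \<epsilon> x \<odot>\<^sub>D p y) c"
      unfolding C.tensor_lift_comult[OF D bilinear_map_comp[OF bl p p] c(1)]
      by (rule C.sw_cong[OF c(1)]) (simp only: counit)
    also have "\<dots> = d" unfolding c(2) by (rule C.sw_counit_left[OF D p c(1)])
    finally show "tensor_lift D (\<lambda>x y. \<epsilon>' x \<odot>\<^sub>D y) (\<Delta>' d) = d" .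
    have "tensor_lift D (\<lambda>x y. \<epsilon>' y \<odot>\<^sub>D x) (\<Delta>' d) = tensor_lift D (\<lambda>x y. \<epsilon>' (p y) \<odot>\<^sub>D p x) (\<Delta> c)"
      unfolding c(2) comult[OF c(1)] by (rule tensor_lift_map[OF mC mC D D D p p br Y])
    also have "\<dots> = C.sw D (\<lambda>x y. \<epsilon> y \<odot>\<^sub>D p x) c"
      unfolding C.tensor_lift_comult[OF D bilinear_map_comp[OF br p p] c(1)]
      by (rule C.sw_cong[OF c(1)]) (simp only: counit)
    also have "\<dots> = d" unfolding c(2) by (rule C.sw_counit_right[OF D p c(1)])
    finally show "tensor_lift D (\<lambda>x y. \<epsilon>' y \<odot>\<^sub>D x) (\<Delta>' d) = d" .
  qed
  have "coalgebra R D \<Delta>' \<epsilon>'"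
    by (intro coalgebra.intro coalgebra_axioms.intro D lin lin' coassoc counits)
  then show ?thesis
    by (intro coalgebra_hom.intro coalgebra_hom_axioms.intro C p comult counit)
qed

text \<open>A map between two quotients of a coalgebra is a coalgebra map as soon as it is compatible with the
  projections. Under (m) this applies to the restrictions of \<open>\<epsilon>\<^sub>t\<close> and \<open>\<epsilon>\<^sub>s\<close>-bar, which are compatible
  with the projections because the two maps absorb each other.\<close>

lemma coalgebra_hom_descends:
  assumes p: "coalgebra_hom R C \<Delta>C \<epsilon>C D \<Delta>D \<epsilon>D p" and surj: "p ` carrier C = carrier D"
    and q: "coalgebra_hom R C \<Delta>C \<epsilon>C E \<Delta>E \<epsilon>E q"
    and fp: "\<And>c. c \<in> carrier C \<Longrightarrow> f (p c) = q c"
  shows "coalgebra_hom R D \<Delta>D \<epsilon>D E \<Delta>E \<epsilon>E f"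
proof -
  interpret p: coalgebra_hom R C \<Delta>C \<epsilon>C D \<Delta>D \<epsilon>D p by fact
  interpret q: coalgebra_hom R C \<Delta>C \<epsilon>C E \<Delta>E \<epsilon>E q by fact
  note mC = p.C.module_axioms and mD = p.D.module_axioms
  have lin: "f \<in> linear_maps R D E"
    by (rule linear_map_descends[OF mC p.hom_linear surj q.hom_linear fp])
  note bt = bilinear_map_comp[OF q.D.CC.bilinear_tens lin lin]
  have "\<Delta>E (f d) = tensor_map R E E f f (\<Delta>D d) \<and> \<epsilon>E (f d) = \<epsilon>D d" if d: "d \<in> carrier D" for d
  proof -
    obtain c where c: "c \<in> carrier C" "d = p c" using d surj by blast
    have "tensor_map R E E f f (\<Delta>D d) =
        tensor_lift (tensor R E E) (\<lambda>x y. tens R E E (f (p x)) (f (p y))) (\<Delta>C c)"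
      unfolding c(2) p.hom_comult[OF c(1)] tensor_map_def[of R E E f f]
      by (rule tensor_lift_map[OF mC mC mD mD q.D.CC.module_tensor p.hom_linear p.hom_linear bt
            p.C.comult_closed[OF c(1)]])
    also have "\<dots> = tensor_map R E E q q (\<Delta>C c)"
      unfolding tensor_map_def
      by (rule p.C.CC.tensor_lift_cong[OF q.D.CC.module_tensor
            bilinear_map_comp[OF bt p.hom_linear p.hom_linear] p.C.comult_closed[OF c(1)]])
        (simp only: fp)
    finally show ?thesis
      using q.hom_comult[OF c(1)] q.hom_counit[OF c(1)] p.hom_counit[OF c(1)]
      by (simp add: c(2) fp[OF c(1)])
  qed
  then show ?thesis
    by (intro coalgebra_hom.intro coalgebra_hom_axioms.intro p.D.coalgebra_axioms q.D.coalgebra_axioms lin)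
      blast+
qed

lemma module_image:
  assumes "module R M" and p: "p \<in> linear_maps R M M"
  shows "module R (M\<lparr>carrier := p ` carrier M\<rparr>)" (is "module R ?D")
    and "p \<in> linear_maps R M (M\<lparr>carrier := p ` carrier M\<rparr>)"
proof -
  interpret M: module R M by fact
  note D = linear_mapsD[OF p]
  have sub: "x \<in> carrier M" if "x \<in> p ` carrier M" for x
    using that D(1) by auto
  have add: "x \<oplus>\<^sub>M y \<in> p ` carrier M" if "x \<in> p ` carrier M" "y \<in> p ` carrier M" for x y
  proof -
    from that(1) obtain a where a: "x = p a" "a \<in> carrier M" by (rule imageE)
    from that(2) obtain b where b: "y = p b" "b \<in> carrier M" by (rule imageE)
    show ?thesis
      unfolding a(1) b(1) D(2)[OF a(2) b(2), symmetric]
      by (rule imageI, rule M.M.add.m_closed[OF a(2) b(2)])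
  qed
  have smult: "r \<odot>\<^sub>M x \<in> p ` carrier M" if "r \<in> carrier R" "x \<in> p ` carrier M" for r x
  proof -
    from that(2) obtain a where a: "x = p a" "a \<in> carrier M" by (rule imageE)
    show ?thesis
      unfolding a(1) D(3)[OF that(1) a(2), symmetric]
      by (rule imageI, rule M.smult_closed[OF that(1) a(2)])
  qed
  have zero: "\<zero>\<^bsub>M\<^esub> \<in> p ` carrier M"
    using linear_map_zero[OF assms(1,1) p] M.zero_closed by (metis image_eqI)
  have neg: "\<exists>y\<in>p ` carrier M. y \<oplus>\<^sub>M x = \<zero>\<^bsub>M\<^esub>" if x: "x \<in> p ` carrier M" for x
  proof
    show "(\<ominus>\<^bsub>R\<^esub> \<one>\<^sub>R) \<odot>\<^sub>M x \<in> p ` carrier M" by (rule smult[OF _ x]) simp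
    show "(\<ominus>\<^bsub>R\<^esub> \<one>\<^sub>R) \<odot>\<^sub>M x \<oplus>\<^sub>M x = \<zero>\<^bsub>M\<^esub>"
      using sub[OF x] by (simp add: M.smult_l_minus M.M.l_neg)
  qed
  have eqs: "carrier ?D = p ` carrier M" "add ?D = add M" "zero ?D = \<zero>\<^bsub>M\<^esub>" "smult ?D = smult M"
    by simp_all
  show "module R ?D"
  proof (rule moduleI, unfold eqs)
    show "cring R" by (rule M.R.is_cring)
    show "abelian_group ?D"
      by (rule abelian_groupI, unfold eqs)
        (assumption | rule add zero neg M.M.a_assoc M.M.a_comm M.M.l_zero sub)+
  qed (assumption | rule smult M.smult_l_distr M.smult_r_distr M.smult_assoc1 M.smult_one sub)+
  show "p \<in> linear_maps R M ?D"
    using D by (intro linear_mapsI) simp_all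
qed


section \<open>The four coalgebra maps\<close>

text \<open>Reversing only the comultiplication amounts to reversing both structures of the opposite
  prebialgebra.\<close>

lemma axiom_coopposite:
  assumes "prebialgebra R H \<Delta> \<epsilon>"
  shows "axiom_lm R H \<Delta> \<epsilon> \<Longrightarrow> axiom_rm R H (coopposite R H \<Delta>) \<epsilon>"
    and "axiom_rm R H \<Delta> \<epsilon> \<Longrightarrow> axiom_lm R H (coopposite R H \<Delta>) \<epsilon>"
    and "axiom_lc R H \<Delta> \<Longrightarrow> axiom_rc R H (coopposite R H \<Delta>)"
    and "axiom_rc R H \<Delta> \<Longrightarrow> axiom_lc R H (coopposite R H \<Delta>)"
proof -
  note op = prebialgebra_opposite[OF assms]
  show "axiom_rm R H (coopposite R H \<Delta>) \<epsilon>" if "axiom_lm R H \<Delta> \<epsilon>"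
    using axiom_rm_opposite_coopposite[OF op] that
    by (simp add: axiom_rm_opposite[OF assms] coopposite_opposite)
  show "axiom_lm R H (coopposite R H \<Delta>) \<epsilon>" if "axiom_rm R H \<Delta> \<epsilon>"
    using axiom_rm_opposite_coopposite[OF assms that]
    by (simp add: axiom_rm_opposite[OF prebialgebra_coopposite[OF assms]])
  show "axiom_rc R H (coopposite R H \<Delta>)" if "axiom_lc R H \<Delta>"
    using axiom_rc_opposite_coopposite[OF op] that
    by (simp add: axiom_rc_opposite coopposite_opposite)
  show "axiom_lc R H (coopposite R H \<Delta>)" if "axiom_rc R H \<Delta>"
    using axiom_rc_opposite_coopposite[OF assms that] by (simp add: axiom_rc_opposite)
qed

context prebialgebra
begin

lemma prebialgebra_self: "prebialgebra R H \<Delta> \<epsilon>"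
  by unfold_locales

lemma bar_eps_t_comult:
  assumes ax: "axiom_lm R H \<Delta> \<epsilon> \<or> axiom_lc R H \<Delta>" and P: "module R P"
    and B: "bilinear_map R H H P (\<lambda>x y. B (bt x) (bt y))" and h: "h \<in> carrier H"
  shows "sw P (\<lambda>a b. B (bt (bt h \<otimes>\<^sub>H a)) (bt b)) \<one>\<^sub>H = sw P (\<lambda>a b. B (bt a) (bt b)) h"
proof -
  interpret O: prebialgebra R "opposite H" \<Delta> \<epsilon>
    by (rule prebialgebra_opposite[OF prebialgebra_self])
  show ?thesis
    using O.eps_t_comult[of P B h] assms
    by (simp add: axiom_rc_opposite axiom_rm_opposite[OF prebialgebra_self] eps_opposite sweedler_opposite)
qed

lemma bar_eps_s_comult:
  assumes ax: "axiom_lm R H \<Delta> \<epsilon> \<or> axiom_lc R H \<Delta>" and P: "module R P"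
    and B: "bilinear_map R H H P (\<lambda>x y. B (bs x) (bs y))" and h: "h \<in> carrier H"
  shows "sw P (\<lambda>a b. B (bs a) (bs (b \<otimes>\<^sub>H bs h))) \<one>\<^sub>H = sw P (\<lambda>a b. B (bs a) (bs b)) h"
proof -
  interpret C: prebialgebra R H "coopposite R H \<Delta>" \<epsilon>
    by (rule prebialgebra_coopposite[OF prebialgebra_self])
  note eps = eps_coopposite(1)[OF prebialgebra_self]
  have one: "\<one>\<^sub>H \<in> carrier H" by simp
  have B': "bilinear_map R H H P (\<lambda>x y. B (bs y) (bs x))"
    by (intro bilinear_mapI bilinear_mapD[OF B])
  have B'': "bilinear_map R H H P (\<lambda>x y. B (C.et y) (C.et x))"
    by (rule bilinear_map_cong[OF module_H module_H B']) (simp only: eps)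
  have bil: "bilinear_map R H H P (\<lambda>a b. B (bs b) (bs (a \<otimes>\<^sub>H bs h)))"
    by (rule bilinear_map_comp[OF B' linear_mult_right[OF _ linear_map_id module_H] linear_map_id])
      (simp add: h)
  have ax': "axiom_rm R H (coopposite R H \<Delta>) \<epsilon> \<or> axiom_rc R H (coopposite R H \<Delta>)"
    using ax axiom_coopposite(1,3)[OF prebialgebra_self] by blast
  have "sw P (\<lambda>a b. B (bs a) (bs (b \<otimes>\<^sub>H bs h))) \<one>\<^sub>H =
      C.sw P (\<lambda>a b. B (bs b) (bs (a \<otimes>\<^sub>H bs h))) \<one>\<^sub>H"
    by (rule sw_coopposite[OF P bil one, symmetric])
  also have "\<dots> = C.sw P (\<lambda>a b. B (C.et b) (C.et (a \<otimes>\<^sub>H C.et h))) \<one>\<^sub>H"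
    by (rule C.sw_cong[OF one]) (simp add: eps h)
  also have "\<dots> = C.sw P (\<lambda>a b. B (C.et b) (C.et a)) h"
    by (rule C.eps_t_comult[OF ax' P B'' h])
  also have "\<dots> = C.sw P (\<lambda>a b. B (bs b) (bs a)) h"
    by (rule C.sw_cong[OF h]) (simp only: eps)
  also have "\<dots> = sw P (\<lambda>a b. B (bs a) (bs b)) h"
    by (rule sw_coopposite[OF P B' h])
  finally show ?thesis .
qed

lemma eps_s_comult:
  assumes ax: "axiom_rm R H \<Delta> \<epsilon> \<or> axiom_rc R H \<Delta>" and P: "module R P"
    and B: "bilinear_map R H H P (\<lambda>x y. B (es x) (es y))" and h: "h \<in> carrier H"
  shows "sw P (\<lambda>a b. B (es a) (es (es h \<otimes>\<^sub>H b))) \<one>\<^sub>H = sw P (\<lambda>a b. B (es a) (es b)) h"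
proof -
  interpret O: prebialgebra R "opposite H" \<Delta> \<epsilon>
    by (rule prebialgebra_opposite[OF prebialgebra_self])
  show ?thesis
    using O.bar_eps_s_comult[of P B h] assms
    by (simp add: axiom_lc_opposite axiom_lm_opposite[OF prebialgebra_self] eps_opposite sweedler_opposite)
qed

lemma counit_eps:
  assumes h: "h \<in> carrier H"
  shows "\<epsilon> (et h) = \<epsilon> h" "\<epsilon> (es h) = \<epsilon> h" "\<epsilon> (bt h) = \<epsilon> h" "\<epsilon> (bs h) = \<epsilon> h"
proof -
  interpret O: prebialgebra R "opposite H" \<Delta> \<epsilon>
    by (rule prebialgebra_opposite[OF prebialgebra_self])
  interpret C: prebialgebra R H "coopposite R H \<Delta>" \<epsilon>
    by (rule prebialgebra_coopposite[OF prebialgebra_self])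
  interpret OC: prebialgebra R "opposite H" "coopposite R H \<Delta>" \<epsilon>
    by (rule prebialgebra_opposite[OF C.prebialgebra_self])
  note c = eps_coopposite[OF prebialgebra_self]
  show "\<epsilon> (et h) = \<epsilon> h" by (rule counit_eps_t[OF h])
  show "\<epsilon> (es h) = \<epsilon> h" using OC.counit_eps_t[of h] h by (simp add: eps_opposite c)
  show "\<epsilon> (bt h) = \<epsilon> h" using O.counit_eps_t[of h] h by (simp add: eps_opposite)
  show "\<epsilon> (bs h) = \<epsilon> h" using C.counit_eps_t[of h] h by (simp add: c)
qed

text \<open>The tensor square is formed over the image \<open>D\<close> itself, so the hypothesis on \<open>\<Delta>'\<close> is an equation
  in \<open>D \<otimes> D\<close> and not in \<open>H \<otimes> H\<close>.\<close>

lemma image_coalgebra_hom: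
  assumes p: "p \<in> linear_maps R H H" and D: "D = H\<lparr>carrier := p ` carrier H\<rparr>"
    and counit: "\<And>h. h \<in> carrier H \<Longrightarrow> \<epsilon> (p h) = \<epsilon> h"
    and comult: "\<And>h. h \<in> carrier H \<Longrightarrow> \<Delta>' (p h) = sw (tensor R D D) (\<lambda>a b. tens R D D (p a) (p b)) h"
  shows "coalgebra_hom R H \<Delta> \<epsilon> D \<Delta>' \<epsilon> p"
proof -
  have mD: "module R D" and pD: "p \<in> linear_maps R H D"
    unfolding D by (rule module_image[OF module_H p])+
  interpret DD: two_modules R D D using mD by (simp add: two_modules_def)
  show ?thesis
  proof (rule quotient_coalgebra_hom)
    show "module R D" by (rule mD)
    show "p \<in> linear_maps R H D" by (rule pD)
    show "\<epsilon> (p h) = \<epsilon> h" if "h \<in> carrier H" for h by (rule counit[OF that])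
    show "coalgebra R H \<Delta> \<epsilon>" by unfold_locales
    show "p ` carrier H = carrier D" by (simp add: D)
    show "\<Delta>' (p h) = tensor_map R D D p p (\<Delta> h)" if "h \<in> carrier H" for h
      unfolding tensor_map_def comult[OF that]
      by (rule tensor_lift_comult[OF DD.module_tensor bilinear_map_comp[OF DD.bilinear_tens pD pD] that,
            symmetric])
  qed
qed

lemma bilinear_tens_image:
  assumes p: "p \<in> linear_maps R H H" and D: "D = H\<lparr>carrier := p ` carrier H\<rparr>"
  shows "bilinear_map R H H (tensor R D D) (\<lambda>x y. tens R D D (p x) (p y))"
    and "module R (tensor R D D)"
proof -
  have mD: "module R D" and pD: "p \<in> linear_maps R H D"
    unfolding D by (rule module_image[OF module_H p])+
  interpret DD: two_modules R D D using mD by (simp add: two_modules_def)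
  show "bilinear_map R H H (tensor R D D) (\<lambda>x y. tens R D D (p x) (p y))"
    by (rule bilinear_map_comp[OF DD.bilinear_tens pD pD])
  show "module R (tensor R D D)" by (rule DD.module_tensor)
qed

lemma comult_image_sw:
  assumes z: "z \<in> carrier H"
  shows "comult_t R H \<Delta> \<epsilon> z = sw (tensor R (im_t H \<Delta> \<epsilon>) (im_t H \<Delta> \<epsilon>))
      (\<lambda>a b. tens R (im_t H \<Delta> \<epsilon>) (im_t H \<Delta> \<epsilon>) (et (a \<otimes>\<^sub>H z)) (et b)) \<one>\<^sub>H" (is ?th1)
    and "comult_s R H \<Delta> \<epsilon> z = sw (tensor R (im_s H \<Delta> \<epsilon>) (im_s H \<Delta> \<epsilon>))
      (\<lambda>a b. tens R (im_s H \<Delta> \<epsilon>) (im_s H \<Delta> \<epsilon>) (es a) (es (z \<otimes>\<^sub>H b))) \<one>\<^sub>H" (is ?th2)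
    and "bar_comult_t R H \<Delta> \<epsilon> z = sw (tensor R (bar_im_t H \<Delta> \<epsilon>) (bar_im_t H \<Delta> \<epsilon>))
      (\<lambda>a b. tens R (bar_im_t H \<Delta> \<epsilon>) (bar_im_t H \<Delta> \<epsilon>) (bt (z \<otimes>\<^sub>H a)) (bt b)) \<one>\<^sub>H" (is ?th3)
    and "bar_comult_s R H \<Delta> \<epsilon> z = sw (tensor R (bar_im_s H \<Delta> \<epsilon>) (bar_im_s H \<Delta> \<epsilon>))
      (\<lambda>a b. tens R (bar_im_s H \<Delta> \<epsilon>) (bar_im_s H \<Delta> \<epsilon>) (bs a) (bs (b \<otimes>\<^sub>H z))) \<one>\<^sub>H" (is ?th4)
proof -
  note t = bilinear_tens_image[OF linear_eps(1) im_t_def] bilinear_tens_image[OF linear_eps(2) im_s_def]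
    bilinear_tens_image[OF linear_eps(3) bar_im_t_def] bilinear_tens_image[OF linear_eps(4) bar_im_s_def]
  note r = linear_mult_right[OF z linear_map_id module_H]
    and l = linear_mult_left[OF z linear_map_id module_H] and i = linear_map_id
  note lift = tensor_lift_comult[OF _ _ one_closed]
  show ?th1
    unfolding comult_t_def by (rule lift[OF t(2) bilinear_map_comp[OF t(1) r i]])
  show ?th2
    unfolding comult_s_def by (rule lift[OF t(4) bilinear_map_comp[OF t(3) i l]])
  show ?th3
    unfolding bar_comult_t_def by (rule lift[OF t(6) bilinear_map_comp[OF t(5) l i]])
  show ?th4
    unfolding bar_comult_s_def by (rule lift[OF t(8) bilinear_map_comp[OF t(7) i r]])
qed

lemma eps_coalgebra_hom:
  shows "axiom_rm R H \<Delta> \<epsilon> \<or> axiom_rc R H \<Delta> \<Longrightarrow>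
      coalgebra_hom R H \<Delta> \<epsilon> (im_t H \<Delta> \<epsilon>) (comult_t R H \<Delta> \<epsilon>) \<epsilon> et"
    and "axiom_rm R H \<Delta> \<epsilon> \<or> axiom_rc R H \<Delta> \<Longrightarrow>
      coalgebra_hom R H \<Delta> \<epsilon> (im_s H \<Delta> \<epsilon>) (comult_s R H \<Delta> \<epsilon>) \<epsilon> es"
    and "axiom_lm R H \<Delta> \<epsilon> \<or> axiom_lc R H \<Delta> \<Longrightarrow>
      coalgebra_hom R H \<Delta> \<epsilon> (bar_im_t H \<Delta> \<epsilon>) (bar_comult_t R H \<Delta> \<epsilon>) \<epsilon> bt"
    and "axiom_lm R H \<Delta> \<epsilon> \<or> axiom_lc R H \<Delta> \<Longrightarrow>
      coalgebra_hom R H \<Delta> \<epsilon> (bar_im_s H \<Delta> \<epsilon>) (bar_comult_s R H \<Delta> \<epsilon>) \<epsilon> bs"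
proof -
  note t = bilinear_tens_image[OF linear_eps(1) im_t_def] bilinear_tens_image[OF linear_eps(2) im_s_def]
    bilinear_tens_image[OF linear_eps(3) bar_im_t_def] bilinear_tens_image[OF linear_eps(4) bar_im_s_def]
  show "coalgebra_hom R H \<Delta> \<epsilon> (im_t H \<Delta> \<epsilon>) (comult_t R H \<Delta> \<epsilon>) \<epsilon> et"
    if ax: "axiom_rm R H \<Delta> \<epsilon> \<or> axiom_rc R H \<Delta>"
    by (rule image_coalgebra_hom[OF linear_eps(1) im_t_def counit_eps(1)]; assumption?)
      (unfold comult_image_sw(1)[OF eps_closed(1)], rule eps_t_comult[OF ax t(2,1)])
  show "coalgebra_hom R H \<Delta> \<epsilon> (im_s H \<Delta> \<epsilon>) (comult_s R H \<Delta> \<epsilon>) \<epsilon> es"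
    if ax: "axiom_rm R H \<Delta> \<epsilon> \<or> axiom_rc R H \<Delta>"
    by (rule image_coalgebra_hom[OF linear_eps(2) im_s_def counit_eps(2)]; assumption?)
      (unfold comult_image_sw(2)[OF eps_closed(2)], rule eps_s_comult[OF ax t(4,3)])
  show "coalgebra_hom R H \<Delta> \<epsilon> (bar_im_t H \<Delta> \<epsilon>) (bar_comult_t R H \<Delta> \<epsilon>) \<epsilon> bt"
    if ax: "axiom_lm R H \<Delta> \<epsilon> \<or> axiom_lc R H \<Delta>"
    by (rule image_coalgebra_hom[OF linear_eps(3) bar_im_t_def counit_eps(3)]; assumption?)
      (unfold comult_image_sw(3)[OF eps_closed(3)], rule bar_eps_t_comult[OF ax t(6,5)])
  show "coalgebra_hom R H \<Delta> \<epsilon> (bar_im_s H \<Delta> \<epsilon>) (bar_comult_s R H \<Delta> \<epsilon>) \<epsilon> bs"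
    if ax: "axiom_lm R H \<Delta> \<epsilon> \<or> axiom_lc R H \<Delta>"
    by (rule image_coalgebra_hom[OF linear_eps(4) bar_im_s_def counit_eps(4)]; assumption?)
      (unfold comult_image_sw(4)[OF eps_closed(4)], rule bar_eps_s_comult[OF ax t(8,7)])
qed


section \<open>The isomorphisms under (m)\<close>

text \<open>\<open>\<epsilon>\<^sub>s\<close>-bar is \<open>\<epsilon>\<^sub>t\<close> for the co-opposite, which also satisfies (m); so each statement about \<open>\<epsilon>\<^sub>t\<close> has
  a counterpart for \<open>\<epsilon>\<^sub>s\<close>-bar. Antimultiplicativity compares the formula for \<open>\<epsilon>\<^sub>t(k) \<epsilon>\<^sub>t(h)\<close> in the
  co-opposite with \<open>rm_bar_eps_s_eps_t_mult\<close>.\<close>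

lemma m_eps_t_bar_eps_s:
  assumes m: "axiom_m R H \<Delta> \<epsilon>" and h: "h \<in> carrier H" and k: "k \<in> carrier H"
  shows "et (et h) = et h" (is ?th1) "bs (bs h) = bs h" (is ?th2) "bs (et h) = bs h" (is ?th3) "et (bs h) = et h" (is ?th4)
    and "et \<one>\<^sub>H = \<one>\<^sub>H" (is ?th5) "bs \<one>\<^sub>H = \<one>\<^sub>H" (is ?th6)
    and "et h \<otimes>\<^sub>H et k \<in> et ` carrier H" (is ?th7) "bs h \<otimes>\<^sub>H bs k \<in> bs ` carrier H" (is ?th8)
    and "bs (et h \<otimes>\<^sub>H et k) = bs k \<otimes>\<^sub>H bs h" (is ?th9)
    and "et (bs h \<otimes>\<^sub>H bs k) = et k \<otimes>\<^sub>H et h" (is ?th10)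
proof -
  interpret C: prebialgebra R H "coopposite R H \<Delta>" \<epsilon>
    by (rule prebialgebra_coopposite[OF prebialgebra_self])
  have lm: "axiom_lm R H \<Delta> \<epsilon>" and rm: "axiom_rm R H \<Delta> \<epsilon>"
    using m by (simp_all add: axiom_m_def)
  have crm: "axiom_rm R H (coopposite R H \<Delta>) \<epsilon>"
    by (rule axiom_coopposite(1)[OF prebialgebra_self lm])
  note c = eps_coopposite(1,2)[OF prebialgebra_self]
  show ?th1 by (rule eps_t_idem[OF disjI1[OF rm] h])
  show ?th2 using C.eps_t_idem[OF disjI1[OF crm] h] h by (simp add: c)
  show ?th3 using rm_bar_eps_s_absorb[OF rm one_closed h] h by simp
  show ?th4 using C.rm_bar_eps_s_absorb[OF crm one_closed h] h by (simp add: c)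
  show ?th5 by (rule eps_t_one)
  show ?th6 using C.eps_t_one by (simp add: c)
  show ?th7
    unfolding rm_eps_t_mult(2)[OF rm h k] using h k by simp
  show ?th8
    using C.rm_eps_t_mult(2)[OF crm h k] h k by (simp add: c)
  have one: "\<one>\<^sub>H \<in> carrier H" by simp
  \<comment> \<open>With the product written for \<open>\<epsilon>\<^sub>t(k) \<epsilon>\<^sub>t(h)\<close> in the co-opposite, undoing the two flips leaves
    \<open>1\<^sub>1 \<epsilon>(1\<^sub>2 h) \<epsilon>(1\<^sub>3 k)\<close> up to coassociativity and the order of the scalars.\<close>
  have anti: "bs (et h \<otimes>\<^sub>H et k) = bs k \<otimes>\<^sub>H bs h" if h: "h \<in> carrier H" and k: "k \<in> carrier H" for h k
  proof -
    let ?t = "\<lambda>q p a. \<epsilon> (a \<otimes>\<^sub>H k) \<odot>\<^sub>H (\<epsilon> (p \<otimes>\<^sub>H h) \<odot>\<^sub>H q)"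
    have t: "trilinear_map R H H H H ?t"
      by (intro trilinear_mapI linear_intros; simp add: h k)
    have inner: "bilinear_map R H H H (\<lambda>p q. ?t q p a)" if "a \<in> carrier H" for a
      by (intro bilinear_mapI trilinear_mapD[OF t] that)
    have outer: "bilinear_map R H H H (\<lambda>a b. C.sw H (\<lambda>p q. ?t q p a) b)"
      by (intro bilinear_mapI C.linear_sw_param[OF module_H module_H] trilinear_mapD(3)[OF t]
          C.linear_sw[OF module_H module_H inner linear_map_id])
    have "bs k \<otimes>\<^sub>H bs h = C.sw H (\<lambda>a b. C.sw H (\<lambda>p q. ?t q p a) b) \<one>\<^sub>H"
      using C.rm_eps_t_mult(1)[OF crm k h] by (simp only: c(1)[OF h] c(1)[OF k])
    also have "\<dots> = sw H (\<lambda>b a. C.sw H (\<lambda>p q. ?t q p a) b) \<one>\<^sub>H"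
      by (rule sw_coopposite[OF module_H outer one])
    also have "\<dots> = sw H (\<lambda>b a. sw H (\<lambda>q p. ?t q p a) b) \<one>\<^sub>H"
      by (rule sw_cong[OF one], rule sw_coopposite[OF module_H inner])
    also have "\<dots> = sw H (\<lambda>q b. sw H (\<lambda>p a. ?t q p a) b) \<one>\<^sub>H"
      by (rule sw_coassoc[OF module_H t one])
    also have "\<dots> = bs (et h \<otimes>\<^sub>H et k)"
      unfolding rm_bar_eps_s_eps_t_mult[OF rm h k]
      by (rule sw_cong[OF one], rule sw_cong)
        (simp_all add: smult_assoc1[symmetric] R.m_comm h k)
    finally show ?thesis ..
  qed
  show ?th9 by (rule anti[OF h k])
  show ?th10
  proof -
    have "et (bs h \<otimes>\<^sub>H bs k) = et (bs (et k \<otimes>\<^sub>H et h))" unfolding anti[OF k h] ..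
    also have "\<dots> = et (et k \<otimes>\<^sub>H et h)"
      using C.rm_bar_eps_s_absorb[OF crm one_closed, of "et k \<otimes>\<^sub>H et h"] h k by (simp add: c)
    also have "\<dots> = et k \<otimes>\<^sub>H et h"
      unfolding rm_eps_t_mult(2)[OF rm k h]
      by (rule eps_t_idem[OF disjI1[OF rm]]) (simp add: h k)
    finally show ?thesis .
  qed
qed

lemma assoc_algebra_image:
  assumes p: "p \<in> linear_maps R H H" and D: "D = H\<lparr>carrier := p ` carrier H\<rparr>"
    and one: "p \<one>\<^sub>H = \<one>\<^sub>H"
    and mult: "\<And>h k. \<lbrakk>h \<in> carrier H; k \<in> carrier H\<rbrakk> \<Longrightarrow> p h \<otimes>\<^sub>H p k \<in> p ` carrier H"
  shows "assoc_algebra R D"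
proof -
  have sub: "x \<in> carrier H" if "x \<in> p ` carrier H" for x
    using that linear_mapsD(1)[OF p] by (elim imageE) simp
  have mult': "x \<otimes>\<^sub>H y \<in> p ` carrier H" if "x \<in> p ` carrier H" "y \<in> p ` carrier H" for x y
    using that by (elim imageE) (simp only: mult)
  have one': "\<one>\<^sub>H \<in> p ` carrier H"
    by (rule image_eqI[where x = "\<one>\<^sub>H"]) (simp_all add: one)
  have eqs: "carrier D = p ` carrier H" "mult D = mult H" "\<one>\<^sub>D = \<one>\<^sub>H" "add D = add H"
    "smult D = smult H"
    by (simp_all add: D)
  have mD: "module R D"
    unfolding D by (rule module_image(1)[OF module_H p])
  have mon: "monoid D"
    by (rule monoidI, unfold eqs) (assumption | rule mult' one' m_assoc l_one r_one sub)+
  have ring: "ring D"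
    by (rule ringI[OF module.axioms(2)[OF mD] mon], unfold eqs) (assumption | rule l_distr r_distr sub)+
  show ?thesis
    by (rule assoc_algebra.intro[OF mD ring], rule assoc_algebra_axioms.intro, unfold eqs)
      (assumption | rule smult_mult_left smult_mult_right sub)+
qed

text \<open>The common shape of the two pairs in (2). Compatibility of \<open>q\<close> with \<open>p\<close> makes the restriction of
  \<open>q\<close> to the image of \<open>p\<close> the map induced by \<open>q\<close> on this quotient of \<open>H\<close>.\<close>

lemma inverse_isos_of_images:
  assumes p: "p \<in> linear_maps R H H" and q: "q \<in> linear_maps R H H"
    and D: "D = H\<lparr>carrier := p ` carrier H\<rparr>" and E: "E = H\<lparr>carrier := q ` carrier H\<rparr>"
    and ph: "coalgebra_hom R H \<Delta> \<epsilon> D \<Delta>D \<epsilon> p" and qh: "coalgebra_hom R H \<Delta> \<epsilon> E \<Delta>E \<epsilon> q"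
    and idem: "\<And>h. h \<in> carrier H \<Longrightarrow> p (p h) = p h" "\<And>h. h \<in> carrier H \<Longrightarrow> q (q h) = q h"
    and qp: "\<And>h. h \<in> carrier H \<Longrightarrow> q (p h) = q h" and pq: "\<And>h. h \<in> carrier H \<Longrightarrow> p (q h) = p h"
    and one: "p \<one>\<^sub>H = \<one>\<^sub>H" "q \<one>\<^sub>H = \<one>\<^sub>H"
    and closed: "\<And>h k. \<lbrakk>h \<in> carrier H; k \<in> carrier H\<rbrakk> \<Longrightarrow> p h \<otimes>\<^sub>H p k \<in> p ` carrier H"
      "\<And>h k. \<lbrakk>h \<in> carrier H; k \<in> carrier H\<rbrakk> \<Longrightarrow> q h \<otimes>\<^sub>H q k \<in> q ` carrier H"
    and anti: "\<And>h k. \<lbrakk>h \<in> carrier H; k \<in> carrier H\<rbrakk> \<Longrightarrow> q (p h \<otimes>\<^sub>H p k) = q k \<otimes>\<^sub>H q h"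
      "\<And>h k. \<lbrakk>h \<in> carrier H; k \<in> carrier H\<rbrakk> \<Longrightarrow> p (q h \<otimes>\<^sub>H q k) = p k \<otimes>\<^sub>H p h"
  shows "inverse_anti_algebra_coalgebra_isos R D \<Delta>D \<epsilon> E \<Delta>E \<epsilon> q p"
proof -
  have cD: "p ` carrier H = carrier D" and cE: "q ` carrier H = carrier E"
    by (simp_all add: D E)
  have q_hom: "coalgebra_hom R D \<Delta>D \<epsilon> E \<Delta>E \<epsilon> q"
    by (rule coalgebra_hom_descends[OF ph cD qh qp])
  have p_hom: "coalgebra_hom R E \<Delta>E \<epsilon> D \<Delta>D \<epsilon> p"
    by (rule coalgebra_hom_descends[OF qh cE ph pq])
  have AD: "assoc_algebra R D" by (rule assoc_algebra_image[OF p D one(1) closed(1)])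
  have AE: "assoc_algebra R E" by (rule assoc_algebra_image[OF q E one(2) closed(2)])
  have eqs: "mult D = mult H" "\<one>\<^sub>D = \<one>\<^sub>H" "mult E = mult H" "\<one>\<^sub>E = \<one>\<^sub>H"
    by (simp_all add: D E)
  have q_mult: "q (x \<otimes>\<^sub>D y) = q y \<otimes>\<^sub>E q x" if "x \<in> carrier D" "y \<in> carrier D" for x y
    using that unfolding cD[symmetric] eqs by (elim imageE) (simp only: anti(1) qp)
  have p_mult: "p (x \<otimes>\<^sub>E y) = p y \<otimes>\<^sub>D p x" if "x \<in> carrier E" "y \<in> carrier E" for x y
    using that unfolding cE[symmetric] eqs by (elim imageE) (simp only: anti(2) pq)
  have "anti_algebra_hom R D E q"
    using coalgebra_hom.hom_linear[OF q_hom] q_mult one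
    by (intro anti_algebra_hom.intro anti_algebra_hom_axioms.intro AD AE) (simp_all only: eqs)
  moreover have "anti_algebra_hom R E D p"
    using coalgebra_hom.hom_linear[OF p_hom] p_mult one
    by (intro anti_algebra_hom.intro anti_algebra_hom_axioms.intro AD AE) (simp_all only: eqs)
  moreover have "p (q x) = x" if "x \<in> carrier D" for x
    using that unfolding cD[symmetric] by (elim imageE) (simp add: pq idem linear_mapsD(1)[OF p])
  moreover have "q (p x) = x" if "x \<in> carrier E" for x
    using that unfolding cE[symmetric] by (elim imageE) (simp add: qp idem linear_mapsD(1)[OF q])
  ultimately show ?thesis
    unfolding inverse_anti_algebra_coalgebra_isos_def using p_hom q_hom by blast
qed

lemma inverse_isos_m:
  assumes m: "axiom_m R H \<Delta> \<epsilon>"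
  shows "inverse_anti_algebra_coalgebra_isos R (im_t H \<Delta> \<epsilon>) (comult_t R H \<Delta> \<epsilon>) \<epsilon>
      (bar_im_s H \<Delta> \<epsilon>) (bar_comult_s R H \<Delta> \<epsilon>) \<epsilon> bs et"
    and "inverse_anti_algebra_coalgebra_isos R (im_s H \<Delta> \<epsilon>) (comult_s R H \<Delta> \<epsilon>) \<epsilon>
      (bar_im_t H \<Delta> \<epsilon>) (bar_comult_t R H \<Delta> \<epsilon>) \<epsilon> bt es"
proof -
  have lm: "axiom_lm R H \<Delta> \<epsilon>" and rm: "axiom_rm R H \<Delta> \<epsilon>"
    using m by (simp_all add: axiom_m_def)
  note hom = eps_coalgebra_hom(1,2)[OF disjI1[OF rm]] eps_coalgebra_hom(3,4)[OF disjI1[OF lm]]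
  note f = m_eps_t_bar_eps_s[OF m] and f1 = m_eps_t_bar_eps_s(1-4)[OF m _ one_closed]
    and f2 = m_eps_t_bar_eps_s(5,6)[OF m one_closed one_closed]
  show "inverse_anti_algebra_coalgebra_isos R (im_t H \<Delta> \<epsilon>) (comult_t R H \<Delta> \<epsilon>) \<epsilon>
      (bar_im_s H \<Delta> \<epsilon>) (bar_comult_s R H \<Delta> \<epsilon>) \<epsilon> bs et"
    by (rule inverse_isos_of_images[OF linear_eps(1,4) im_t_def bar_im_s_def hom(1,4)])
      (rule f1 f2 f(7-10); assumption)+
  interpret C: prebialgebra R H "coopposite R H \<Delta>" \<epsilon>
    by (rule prebialgebra_coopposite[OF prebialgebra_self])
  interpret OC: prebialgebra R "opposite H" "coopposite R H \<Delta>" \<epsilon>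
    by (rule prebialgebra_opposite[OF C.prebialgebra_self])
  have "axiom_m R (opposite H) (coopposite R H \<Delta>) \<epsilon>"
    using axiom_coopposite(1,2)[OF prebialgebra_self] lm rm
    by (simp add: axiom_m_def axiom_rm_opposite[OF C.prebialgebra_self]
        axiom_lm_opposite[OF C.prebialgebra_self])
  note g = OC.m_eps_t_bar_eps_s[OF this, unfolded opposite_simps eps_opposite]
  note c = eps_coopposite(3,4)[OF prebialgebra_self]
  have cong: "p ` carrier H = p' ` carrier H" if "\<And>h. h \<in> carrier H \<Longrightarrow> p h = p' h" for p p' :: "'c \<Rightarrow> 'c"
    using that by simp
  note imgs = cong[OF c(1)] cong[OF c(2)]
  show "inverse_anti_algebra_coalgebra_isos R (im_s H \<Delta> \<epsilon>) (comult_s R H \<Delta> \<epsilon>) \<epsilon>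
      (bar_im_t H \<Delta> \<epsilon>) (bar_comult_t R H \<Delta> \<epsilon>) \<epsilon> bt es"
  proof (rule inverse_isos_of_images[OF linear_eps(2,3) im_s_def bar_im_t_def hom(2,3)])
    fix h k assume h: "h \<in> carrier H" and k: "k \<in> carrier H"
    show "es h \<otimes>\<^sub>H es k \<in> es ` carrier H" using g(7)[OF k h] h k by (simp add: c imgs)
    show "bt h \<otimes>\<^sub>H bt k \<in> bt ` carrier H" using g(8)[OF k h] h k by (simp add: c imgs)
    show "bt (es h \<otimes>\<^sub>H es k) = bt k \<otimes>\<^sub>H bt h" using g(9)[OF k h] h k by (simp add: c)
    show "es (bt h \<otimes>\<^sub>H bt k) = es k \<otimes>\<^sub>H es h" using g(10)[OF k h] h k by (simp add: c)
  next
    fix h assume h: "h \<in> carrier H"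
    show "es (es h) = es h" "bt (bt h) = bt h" "bt (es h) = bt h" "es (bt h) = es h"
      using g(1-4)[OF h h] h by (simp_all add: c)
  next
    show "es \<one>\<^sub>H = \<one>\<^sub>H" "bt \<one>\<^sub>H = \<one>\<^sub>H"
      using g(5,6)[OF one_closed one_closed] by (simp_all add: c)
  qed
qed


section \<open>Agreement under (c)\<close>

lemma flip_sw:
  assumes D: "module R D" and b: "bilinear_map R H H (tensor R D D) (\<lambda>x y. tens R D D (f x) (g y))"
    and f: "\<And>x. x \<in> carrier H \<Longrightarrow> f x \<in> carrier D" and g: "\<And>x. x \<in> carrier H \<Longrightarrow> g x \<in> carrier D"
    and h: "h \<in> carrier H"
  shows "tensor_flip R D D (sw (tensor R D D) (\<lambda>x y. tens R D D (f x) (g y)) h) =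
    sw (tensor R D D) (\<lambda>x y. tens R D D (g y) (f x)) h"
proof -
  interpret DD: two_modules R D D using D by (simp add: two_modules_def)
  note mT = DD.module_tensor
  have lin: "tensor_flip R D D \<in> linear_maps R (tensor R D D) (tensor R D D)"
    unfolding tensor_flip_def by (rule DD.linear_tensor_lift[OF mT DD.bilinear_tens_flip])
  have "tensor_flip R D D (sw (tensor R D D) (\<lambda>x y. tens R D D (f x) (g y)) h) =
      sw (tensor R D D) (\<lambda>x y. tensor_flip R D D (tens R D D (f x) (g y))) h"
    by (rule linear_map_sw[OF mT mT lin h bilinear_mapD(3)[OF b]])
  also have "\<dots> = sw (tensor R D D) (\<lambda>x y. tens R D D (g y) (f x)) h"
    unfolding tensor_flip_def
    by (rule sw_cong[OF h], rule DD.tensor_lift_tens[OF mT DD.bilinear_tens_flip f g])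
  finally show ?thesis .
qed

text \<open>Each of the two projections fixes the image of the other.\<close>

lemma c_images:
  assumes "axiom_c R H \<Delta>"
  shows "bar_im_t H \<Delta> \<epsilon> = im_t H \<Delta> \<epsilon>" "bar_im_s H \<Delta> \<epsilon> = im_s H \<Delta> \<epsilon>"
proof -
  have lc: "axiom_lc R H \<Delta>" and rc: "axiom_rc R H \<Delta>"
    using assms by (simp_all add: axiom_c_def)
  interpret C: prebialgebra R H "coopposite R H \<Delta>" \<epsilon>
    by (rule prebialgebra_coopposite[OF prebialgebra_self])
  note c = eps_coopposite[OF prebialgebra_self]
  have eq: "p ` carrier H = q ` carrier H"
    if "\<And>h. h \<in> carrier H \<Longrightarrow> p (q h) = q h" "\<And>h. h \<in> carrier H \<Longrightarrow> q (p h) = p h"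
      "p \<in> linear_maps R H H" "q \<in> linear_maps R H H" for p q
  proof (intro equalityI image_subsetI)
    fix x assume x: "x \<in> carrier H"
    show "p x \<in> q ` carrier H"
      using imageI[OF linear_mapsD(1)[OF that(3) x], of q] that(2)[OF x] by simp
    show "q x \<in> p ` carrier H"
      using imageI[OF linear_mapsD(1)[OF that(4) x], of p] that(1)[OF x] by simp
  qed
  have "bt ` carrier H = et ` carrier H"
    by (rule eq[OF lc_bar_eps_t_eps_t[OF lc] rc_eps_t_bar_eps_t[OF rc] linear_eps(3,1)])
  then show "bar_im_t H \<Delta> \<epsilon> = im_t H \<Delta> \<epsilon>" by (simp add: bar_im_t_def im_t_def)
  have 1: "es (bs h) = bs h" if "h \<in> carrier H" for h
    using C.lc_bar_eps_t_eps_t[OF axiom_coopposite(4)[OF prebialgebra_self rc] that] that by (simp add: c)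
  have 2: "bs (es h) = es h" if "h \<in> carrier H" for h
    using C.rc_eps_t_bar_eps_t[OF axiom_coopposite(3)[OF prebialgebra_self lc] that] that by (simp add: c)
  have "bs ` carrier H = es ` carrier H"
    by (rule eq[OF 2 1 linear_eps(4,2)])
  then show "bar_im_s H \<Delta> \<epsilon> = im_s H \<Delta> \<epsilon>" by (simp add: bar_im_s_def im_s_def)
qed

lemma c_comult_t:
  assumes c: "axiom_c R H \<Delta>" and z: "z \<in> carrier (im_t H \<Delta> \<epsilon>)"
  shows "bar_comult_t R H \<Delta> \<epsilon> z =
    tensor_flip R (im_t H \<Delta> \<epsilon>) (im_t H \<Delta> \<epsilon>) (comult_t R H \<Delta> \<epsilon> z)"
proof -
  have lc: "axiom_lc R H \<Delta>" and rc: "axiom_rc R H \<Delta>"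
    using c by (simp_all add: axiom_c_def)
  obtain h where h: "h \<in> carrier H" "z = et h" using z by (auto simp: im_t_def)
  have zc: "z \<in> carrier H" using h by simp
  let ?D = "im_t H \<Delta> \<epsilon>"
  note t = bilinear_tens_image[OF linear_eps(1) im_t_def]
  have D: "module R ?D" unfolding im_t_def by (rule module_image(1)[OF module_H linear_eps(1)])
  have "tensor_flip R ?D ?D (comult_t R H \<Delta> \<epsilon> z) =
      sw (tensor R ?D ?D) (\<lambda>a b. tens R ?D ?D (et b) (et (a \<otimes>\<^sub>H z))) \<one>\<^sub>H"
    unfolding comult_image_sw(1)[OF zc]
    by (rule flip_sw[OF D bilinear_map_comp[OF t(1) linear_mult_right[OF zc linear_map_id module_H]
            linear_map_id]])
      (simp_all add: im_t_def zc)
  also have "\<dots> = sw (tensor R ?D ?D) (\<lambda>a b. tens R ?D ?D (bt (z \<otimes>\<^sub>H a)) (bt b)) \<one>\<^sub>H"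
    unfolding h(2) by (rule c_bar_eps_t_comult[OF lc rc t(2,1) h(1), symmetric])
  also have "\<dots> = bar_comult_t R H \<Delta> \<epsilon> z"
    by (simp only: comult_image_sw(3)[OF zc] c_images[OF c])
  finally show ?thesis ..
qed

text \<open>\<open>c_bar_eps_t_comult\<close> for the prebialgebra with both structures reversed, where \<open>\<epsilon>\<^sub>t\<close> becomes \<open>\<epsilon>\<^sub>s\<close>.\<close>

lemma c_bar_eps_s_comult:
  assumes lc: "axiom_lc R H \<Delta>" and rc: "axiom_rc R H \<Delta>" and P: "module R P"
    and B: "bilinear_map R H H P (\<lambda>x y. B (es x) (es y))"
    and B': "bilinear_map R H H P (\<lambda>x y. B (bs x) (bs y))" and h: "h \<in> carrier H"
  shows "sw P (\<lambda>a b. B (bs a) (bs (b \<otimes>\<^sub>H es h))) \<one>\<^sub>H =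
    sw P (\<lambda>a b. B (es (es h \<otimes>\<^sub>H b)) (es a)) \<one>\<^sub>H"
proof -
  interpret C: prebialgebra R H "coopposite R H \<Delta>" \<epsilon>
    by (rule prebialgebra_coopposite[OF prebialgebra_self])
  interpret OC: prebialgebra R "opposite H" "coopposite R H \<Delta>" \<epsilon>
    by (rule prebialgebra_opposite[OF C.prebialgebra_self])
  note c = eps_coopposite[OF prebialgebra_self]
  have one: "\<one>\<^sub>H \<in> carrier H" by simp
  have eh: "es h \<in> carrier H" using h by simp
  have et: "OC.et x = es x" and bt: "OC.bt x = bs x" if "x \<in> carrier H" for x
    using that by (simp_all add: eps_opposite c)
  have ax: "axiom_lc R (opposite H) (coopposite R H \<Delta>)" "axiom_rc R (opposite H) (coopposite R H \<Delta>)"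
    using axiom_coopposite(3,4)[OF prebialgebra_self] lc rc
    by (simp_all add: axiom_lc_opposite axiom_rc_opposite)
  have Be: "bilinear_map R H H P (\<lambda>x y. B (es y) (es x))"
    by (intro bilinear_mapI bilinear_mapD[OF B])
  have "bilinear_map R H H P (\<lambda>x y. B (OC.et y) (OC.et x))"
    by (rule bilinear_map_cong[OF module_H module_H Be]) (simp only: et)
  then have key: "C.sw P (\<lambda>a b. B (OC.bt b) (OC.bt (a \<otimes>\<^sub>H OC.et h))) \<one>\<^sub>H =
      C.sw P (\<lambda>a b. B (OC.et (OC.et h \<otimes>\<^sub>H a)) (OC.et b)) \<one>\<^sub>H"
    using OC.c_bar_eps_t_comult[OF ax P, of "\<lambda>x y. B y x" h] h by (simp add: sweedler_opposite)
  have b1: "bilinear_map R H H P (\<lambda>x y. B (bs y) (bs (x \<otimes>\<^sub>H es h)))"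
  proof -
    have "bilinear_map R H H P (\<lambda>x y. B (bs y) (bs x))"
      by (intro bilinear_mapI bilinear_mapD[OF B'])
    from bilinear_map_comp[OF this linear_mult_right[OF eh linear_map_id module_H] linear_map_id]
    show ?thesis .
  qed
  have b2: "bilinear_map R H H P (\<lambda>x y. B (es (es h \<otimes>\<^sub>H x)) (es y))"
    by (rule bilinear_map_comp[OF B linear_mult_left[OF eh linear_map_id module_H] linear_map_id])
  have "sw P (\<lambda>a b. B (bs a) (bs (b \<otimes>\<^sub>H es h))) \<one>\<^sub>H =
      C.sw P (\<lambda>a b. B (bs b) (bs (a \<otimes>\<^sub>H es h))) \<one>\<^sub>H"
    by (rule sw_coopposite[OF P b1 one, symmetric])
  also have "\<dots> = C.sw P (\<lambda>a b. B (OC.bt b) (OC.bt (a \<otimes>\<^sub>H OC.et h))) \<one>\<^sub>H"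
    by (rule C.sw_cong[OF one]) (simp add: et bt h eh)
  also note key
  also have "C.sw P (\<lambda>a b. B (OC.et (OC.et h \<otimes>\<^sub>H a)) (OC.et b)) \<one>\<^sub>H =
      C.sw P (\<lambda>a b. B (es (es h \<otimes>\<^sub>H a)) (es b)) \<one>\<^sub>H"
    by (rule C.sw_cong[OF one]) (simp add: et h eh)
  also have "\<dots> = sw P (\<lambda>a b. B (es (es h \<otimes>\<^sub>H b)) (es a)) \<one>\<^sub>H"
    by (rule sw_coopposite[OF P b2 one])
  finally show ?thesis .
qed

lemma c_comult_s:
  assumes c: "axiom_c R H \<Delta>" and z: "z \<in> carrier (im_s H \<Delta> \<epsilon>)"
  shows "bar_comult_s R H \<Delta> \<epsilon> z =
    tensor_flip R (im_s H \<Delta> \<epsilon>) (im_s H \<Delta> \<epsilon>) (comult_s R H \<Delta> \<epsilon> z)"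
proof -
  have lc: "axiom_lc R H \<Delta>" and rc: "axiom_rc R H \<Delta>"
    using c by (simp_all add: axiom_c_def)
  obtain h where h: "h \<in> carrier H" "z = es h" using z by (auto simp: im_s_def)
  have zc: "z \<in> carrier H" using h by simp
  let ?D = "im_s H \<Delta> \<epsilon>"
  note t = bilinear_tens_image[OF linear_eps(2) im_s_def]
    and t' = bilinear_tens_image(1)[OF linear_eps(4) bar_im_s_def, unfolded c_images[OF c]]
  have D: "module R ?D" unfolding im_s_def by (rule module_image(1)[OF module_H linear_eps(2)])
  have "tensor_flip R ?D ?D (comult_s R H \<Delta> \<epsilon> z) =
      sw (tensor R ?D ?D) (\<lambda>a b. tens R ?D ?D (es (z \<otimes>\<^sub>H b)) (es a)) \<one>\<^sub>H"
    unfolding comult_image_sw(2)[OF zc]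
    by (rule flip_sw[OF D bilinear_map_comp[OF t(1) linear_map_id
            linear_mult_left[OF zc linear_map_id module_H]]])
      (simp_all add: im_s_def zc)
  also have "\<dots> = sw (tensor R ?D ?D) (\<lambda>a b. tens R ?D ?D (bs a) (bs (b \<otimes>\<^sub>H z))) \<one>\<^sub>H"
    unfolding h(2) by (rule c_bar_eps_s_comult[OF lc rc t(2,1) t' h(1), symmetric])
  also have "\<dots> = bar_comult_s R H \<Delta> \<epsilon> z"
    by (simp only: comult_image_sw(4)[OF zc] c_images[OF c])
  finally show ?thesis ..
qed

end

theorem proposition1p18:
  fixes R :: "('k, 'c) ring_scheme"
    and H :: "('k, 'h, 'd) module_scheme"
    and \<Delta> :: "'h \<Rightarrow> ('h \<times> 'h) list set"
    and \<epsilon> :: "'h \<Rightarrow> 'k"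
  assumes "prebialgebra R H \<Delta> \<epsilon>"
  shows
    "(axiom_rm R H \<Delta> \<epsilon> \<or> axiom_rc R H \<Delta> \<longrightarrow>
      coalgebra_hom R H \<Delta> \<epsilon> (im_t H \<Delta> \<epsilon>) (comult_t R H \<Delta> \<epsilon>) \<epsilon> (eps_t H \<Delta> \<epsilon>) \<and>
      coalgebra_hom R H \<Delta> \<epsilon> (im_s H \<Delta> \<epsilon>) (comult_s R H \<Delta> \<epsilon>) \<epsilon> (eps_s H \<Delta> \<epsilon>)) \<and>
     (axiom_lm R H \<Delta> \<epsilon> \<or> axiom_lc R H \<Delta> \<longrightarrow>
      coalgebra_hom R H \<Delta> \<epsilon> (bar_im_s H \<Delta> \<epsilon>) (bar_comult_s R H \<Delta> \<epsilon>) \<epsilon> (bar_eps_s H \<Delta> \<epsilon>) \<and>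
      coalgebra_hom R H \<Delta> \<epsilon> (bar_im_t H \<Delta> \<epsilon>) (bar_comult_t R H \<Delta> \<epsilon>) \<epsilon> (bar_eps_t H \<Delta> \<epsilon>)) \<and>
     (axiom_m R H \<Delta> \<epsilon> \<longrightarrow>
      inverse_anti_algebra_coalgebra_isos R
        (im_t H \<Delta> \<epsilon>) (comult_t R H \<Delta> \<epsilon>) \<epsilon> (bar_im_s H \<Delta> \<epsilon>) (bar_comult_s R H \<Delta> \<epsilon>) \<epsilon>
        (bar_eps_s H \<Delta> \<epsilon>) (eps_t H \<Delta> \<epsilon>) \<and>
      inverse_anti_algebra_coalgebra_isos R
        (im_s H \<Delta> \<epsilon>) (comult_s R H \<Delta> \<epsilon>) \<epsilon> (bar_im_t H \<Delta> \<epsilon>) (bar_comult_t R H \<Delta> \<epsilon>) \<epsilon>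
        (bar_eps_t H \<Delta> \<epsilon>) (eps_s H \<Delta> \<epsilon>)) \<and>
     (axiom_c R H \<Delta> \<longrightarrow>
      carrier (bar_im_t H \<Delta> \<epsilon>) = carrier (im_t H \<Delta> \<epsilon>) \<and>
      carrier (bar_im_s H \<Delta> \<epsilon>) = carrier (im_s H \<Delta> \<epsilon>) \<and>
      (\<forall>z\<in>carrier (im_t H \<Delta> \<epsilon>). bar_comult_t R H \<Delta> \<epsilon> z =
        tensor_flip R (im_t H \<Delta> \<epsilon>) (im_t H \<Delta> \<epsilon>) (comult_t R H \<Delta> \<epsilon> z)) \<and>
      (\<forall>y\<in>carrier (im_s H \<Delta> \<epsilon>). bar_comult_s R H \<Delta> \<epsilon> y =
        tensor_flip R (im_s H \<Delta> \<epsilon>) (im_s H \<Delta> \<epsilon>) (comult_s R H \<Delta> \<epsilon> y)))"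
proof -
  interpret prebialgebra R H \<Delta> \<epsilon> by fact
  show ?thesis
    by (intro conjI impI ballI; (elim eps_coalgebra_hom inverse_isos_m c_comult_t c_comult_s)?)
      (simp_all only: c_images)
qed

end
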